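(* Let $n\ge 2$ and $r\ge 1$ be integers, and let $q_1,q_2\in\mathbb{C}$ with $q_1q_2\neq 0$ be such that $q=-q_2/q_1$ is not a root of unity; put $[n]_q=1+q+\cdots+q^{n-1}$. Regard $\mathbf{E}^{\otimes r}$ as a $(\mathbb{C}B_n,\mathcal{P}'_r([n]_q))$-bimodule, with $B_n$ acting diagonally via the generalized Burau representation and $\mathcal{P}'_r([n]_q)$ acting by the place-permutation/pseudo-projection action described in the context. Then $\mathbf{E}^{\otimes r}$ satisfies Schur--Weyl duality, i.e. \[ \operatorname{im}(\mathbb{C}B_n)=\operatorname{End}_{\mathcal{P}'_r([n]_q)}(\mathbf{E}^{\otimes r}),\qquad \operatorname{im}(\mathcal{P}'_r([n]_q))=\operatorname{End}_{B_n}(\mathbf{E}^{\otimes r}), \] where $\operatorname{im}$ denotes the image of the algebra in $\operatorname{End}(\mathbf{E}^{\otimes r})$. Moreover the action of $\mathcal{P}'_r([n]_q)$ on $\mathbf{E}^{\otimes r}$ is faithful if and only if $n>r$, in which case $\mathcal{P}'_r([n]_q)\cong\operatorname{End}_{B_n}(\mathbf{E}^{\otimes r})$.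
   Context: Artin's braid group $B_n$ is generated by $\sigma_1,\dots,\sigma_{n-1}$ subject to $\sigma_i\sigma_{i+1}\sigma_i=\sigma_{i+1}\sigma_i\sigma_{i+1}$ and $\sigma_i\sigma_j=\sigma_j\sigma_i$ for $|i-j|>1$. Let $\mathbf{E}=\mathbb{C}^n$ with basis $e_1,\dots,e_n$. The generalized Burau representation $B_n\to\mathrm{GL}(\mathbf{E})$ is given by $\sigma_i e_j=q_1e_j$ if $j\ne i,i+1$, $\sigma_i e_{i+1}=-q_2e_i$, $\sigma_i e_i=(q_1+q_2)e_i+q_1e_{i+1}$. $B_n$ acts on $\mathbf{E}^{\otimes r}$ diagonally: $b(v_1\otimes\cdots\otimes v_r)=bv_1\otimes\cdots\otimes bv_r$. Let $P\in\operatorname{End}(\mathbf{E})$ be the operator with matrix $(q^{j-1})_{1\le i,j\le n}$, i.e. $Pe_j=q^{j-1}(e_1+\cdots+e_n)$. A partial permutation of $\{1,\dots,r\}$ is a bijection $d:X\to Y$ between subsets $X=\mathrm{dom}(d)$, $Y=\mathrm{im}(d)$ of $\{1,\dots,r\}$; maps are written on the right and composed by $x(d_1\circ d_2)=(xd_1)d_2$ (defined on $(\mathrm{im}(d_1)\cap\mathrm{dom}(d_2))d_1^{-1}$). For $z\in\mathbb{C}$, $z\neq0$, $\mathcal{P}'_r(z)$ is the algebra with basis the set of partial permutations of $\{1,\dots,r\}$ and product $d_1d_2=z^{N}(d_1\circ d_2)$, where $N=r-|\mathrm{im}(d_1)\cup\mathrm{dom}(d_2)|$; equivalently it is the subalgebra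 of the partition algebra $\mathcal{P}_r(z)$ spanned by the diagrams all of whose blocks have size $1$ or $2$ with each $2$-block joining a top node to a bottom node. It is generated by $s_i$ ($1\le i\le r-1$, the permutation swapping $i,i+1$) and $p_j$ ($1\le j\le r$, the identity map of $\{1,\dots,r\}\setminus\{j\}$). Its action on $\mathbf{E}^{\otimes r}$ is: $s_i$ swaps the $i$th and $(i+1)$st tensor factors, and $p_j$ applies $P$ to the $j$th tensor factor and the identity to the others. *)

theory Defs
  imports Complex_Main "HOL-Library.FuncSet"
begin

text \<open>The basis of E^{\<otimes> r} (E = C^n with basis e_1..e_n) is indexed by
  e_{i_1} \<otimes> ... \<otimes> e_{i_r}, i.e. by extensional functions
  i : {1..r} \<rightarrow> {1..n}.  An endomorphism of E^{\<otimes> r} is represented by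
  its matrix A out inp (coefficient of basis vector out in A(basis vector inp)),
  vanishing outside the index set.\<close>

type_synonym midx = "nat \<Rightarrow> nat"
type_synonym tmat = "midx \<Rightarrow> midx \<Rightarrow> complex"

definition Idx :: "nat \<Rightarrow> nat \<Rightarrow> midx set" where
  "Idx n r = PiE {1..r} (\<lambda>_. {1..n})"

definition Mats :: "nat \<Rightarrow> nat \<Rightarrow> tmat set" where
  "Mats n r = {A. \<forall>x y. (x \<notin> Idx n r \<or> y \<notin> Idx n r) \<longrightarrow> A x y = 0}"

definition mmul :: "nat \<Rightarrow> nat \<Rightarrow> tmat \<Rightarrow> tmat \<Rightarrow> tmat" where
  "mmul n r A B = (\<lambda>x z. \<Sum>y\<in>Idx n r. A x y * B y z)"

definition mone :: "nat \<Rightarrow> nat \<Rightarrow> tmat" where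
  "mone n r = (\<lambda>x y. if x \<in> Idx n r \<and> x = y then 1 else 0)"

definition madd :: "tmat \<Rightarrow> tmat \<Rightarrow> tmat" where
  "madd A B = (\<lambda>x y. A x y + B x y)"

definition msmult :: "complex \<Rightarrow> tmat \<Rightarrow> tmat" where
  "msmult c A = (\<lambda>x y. c * A x y)"

inductive_set alg_gen :: "nat \<Rightarrow> nat \<Rightarrow> tmat set \<Rightarrow> tmat set"
  for n r :: nat and G :: "tmat set" where
  gen_one: "mone n r \<in> alg_gen n r G"
| gen_gen: "g \<in> G \<Longrightarrow> g \<in> alg_gen n r G"
| gen_mul: "A \<in> alg_gen n r G \<Longrightarrow> B \<in> alg_gen n r G \<Longrightarrow> mmul n r A B \<in> alg_gen n r G"
| gen_add: "A \<in> alg_gen n r G \<Longrightarrow> B \<in> alg_gen n r G \<Longrightarrow> madd A B \<in> alg_gen n r G"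
| gen_smult: "A \<in> alg_gen n r G \<Longrightarrow> msmult c A \<in> alg_gen n r G"

definition commutant :: "nat \<Rightarrow> nat \<Rightarrow> tmat set \<Rightarrow> tmat set" where
  "commutant n r S = {A \<in> Mats n r. \<forall>B\<in>S. mmul n r A B = mmul n r B A}"

text \<open>Matrix of \<sigma>_i on E: burau q1 q2 i a b = coefficient of e_a in \<sigma>_i e_b.\<close>
definition burau :: "complex \<Rightarrow> complex \<Rightarrow> nat \<Rightarrow> nat \<Rightarrow> nat \<Rightarrow> complex" where
  "burau q1 q2 i a b =
     (if b = i then (if a = i then q1 + q2 else if a = i + 1 then q1 else 0)
      else if b = i + 1 then (if a = i then - q2 else 0)
      else (if a = b then q1 else 0))"

definition bten :: "nat \<Rightarrow> nat \<Rightarrow> complex \<Rightarrow> complex \<Rightarrow> nat \<Rightarrow> tmat" where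
  "bten n r q1 q2 i = (\<lambda>x y. if x \<in> Idx n r \<and> y \<in> Idx n r
        then \<Prod>k\<in>{1..r}. burau q1 q2 i (x k) (y k) else 0)"

definition binv :: "nat \<Rightarrow> nat \<Rightarrow> complex \<Rightarrow> complex \<Rightarrow> nat \<Rightarrow> tmat" where
  "binv n r q1 q2 i = (THE B. B \<in> Mats n r \<and> mmul n r (bten n r q1 q2 i) B = mone n r
                              \<and> mmul n r B (bten n r q1 q2 i) = mone n r)"

text \<open>im(C B_n): the span of the images of all braids, i.e. the unital algebra
  generated by the images of the \<sigma>_i and their inverses.\<close>
definition imB :: "nat \<Rightarrow> nat \<Rightarrow> complex \<Rightarrow> complex \<Rightarrow> tmat set" where
  "imB n r q1 q2 = alg_gen n r
     ({bten n r q1 q2 i | i. i \<in> {1..<n}} \<union> {binv n r q1 q2 i | i. i \<in> {1..<n}})"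

definition qpar :: "complex \<Rightarrow> complex \<Rightarrow> complex" where
  "qpar q1 q2 = - q2 / q1"

definition qint :: "nat \<Rightarrow> complex \<Rightarrow> complex" where
  "qint n q = (\<Sum>k<n. q ^ k)"

text \<open>Generators: s_i swaps tensor factors i,i+1; p_j applies P to factor j,
  where P e_b = q^{b-1}(e_1+...+e_n).\<close>
definition swap_mat :: "nat \<Rightarrow> nat \<Rightarrow> nat \<Rightarrow> tmat" where
  "swap_mat n r i = (\<lambda>x y. if x \<in> Idx n r \<and> y \<in> Idx n r \<and>
       x = (\<lambda>k. if k = i then y (i + 1) else if k = i + 1 then y i else y k) then 1 else 0)"

definition proj_mat :: "nat \<Rightarrow> nat \<Rightarrow> complex \<Rightarrow> nat \<Rightarrow> tmat" where
  "proj_mat n r q j = (\<lambda>x y. if x \<in> Idx n r \<and> y \<in> Idx n r \<and>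
       (\<forall>k\<in>{1..r} - {j}. x k = y k) then q ^ (y j - 1) else 0)"

text \<open>Partial permutations of {1..r}, as partial maps; x(d1\<circ>d2) = (x d1) d2
  is the map  map_comp d2 d1.\<close>
definition PPerm :: "nat \<Rightarrow> (nat \<rightharpoonup> nat) set" where
  "PPerm r = {d. dom d \<subseteq> {1..r} \<and> ran d \<subseteq> {1..r} \<and> inj_on d (dom d)}"

definition PAlg :: "nat \<Rightarrow> ((nat \<rightharpoonup> nat) \<Rightarrow> complex) set" where
  "PAlg r = {c. \<forall>d. d \<notin> PPerm r \<longrightarrow> c d = 0}"

definition pmul :: "nat \<Rightarrow> complex \<Rightarrow> ((nat \<rightharpoonup> nat) \<Rightarrow> complex) \<Rightarrow> ((nat \<rightharpoonup> nat) \<Rightarrow> complex)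
                    \<Rightarrow> ((nat \<rightharpoonup> nat) \<Rightarrow> complex)" where
  "pmul r z c1 c2 = (\<lambda>d. \<Sum>p\<in>{p \<in> PPerm r \<times> PPerm r. snd p \<circ>\<^sub>m fst p = d}.
       c1 (fst p) * c2 (snd p) * z ^ (r - card (ran (fst p) \<union> dom (snd p))))"

definition punit :: "nat \<Rightarrow> ((nat \<rightharpoonup> nat) \<Rightarrow> complex)" where
  "punit r = (\<lambda>d. if d = (\<lambda>x. if x \<in> {1..r} then Some x else None) then 1 else 0)"

text \<open>Action of a partial permutation d on E^{\<otimes> r} (this is the unique extension
  of the generator action: s_i \<mapsto> swap_mat, p_j \<mapsto> proj_mat).\<close>
definition pp_mat :: "nat \<Rightarrow> nat \<Rightarrow> complex \<Rightarrow> (nat \<rightharpoonup> nat) \<Rightarrow> tmat" where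
  "pp_mat n r q d = (\<lambda>x y. if x \<in> Idx n r \<and> y \<in> Idx n r \<and>
        (\<forall>k\<in>dom d. x k = y (the (d k)))
      then \<Prod>l\<in>{1..r} - ran d. q ^ (y l - 1) else 0)"

definition pact :: "nat \<Rightarrow> nat \<Rightarrow> complex \<Rightarrow> ((nat \<rightharpoonup> nat) \<Rightarrow> complex) \<Rightarrow> tmat" where
  "pact n r q c = (\<lambda>x y. \<Sum>d\<in>PPerm r. c d * pp_mat n r q d x y)"

definition imP :: "nat \<Rightarrow> nat \<Rightarrow> complex \<Rightarrow> tmat set" where
  "imP n r q = alg_gen n r
     ({swap_mat n r i | i. i \<in> {1..<r}} \<union> {proj_mat n r q j | j. j \<in> {1..r}})"

end

theory Submission
  imports Defs "HOL-Combinatorics.Permutations" "HOL-Library.Function_Algebras"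
begin

text \<open>Normalise \<open>q1 = 1\<close>. The vector \<open>v = e\<^sub>1 + \<dots> + e\<^sub>n\<close> and the covector \<open>w = (1, q, \<dots>, q\<^bsup>n-1\<^esup>)\<close> are
  fixed by the braid group, \<open>P = v w\<close>, and \<open>w v = [n]\<^sub>q \<noteq> 0\<close>, so \<open>E = \<complex> v \<oplus> ker w\<close> and the centraliser of
  \<open>P\<close> in \<open>End E\<close> is \<open>C = End (\<complex> v) \<times> End (ker w)\<close>. The commutant of the partial permutations is the
  symmetric part of \<open>C\<^bsup>\<otimes> r\<^esup>\<close>, which is generated by the derivations \<open>X \<mapsto> \<Sum>\<^sub>j 1 \<otimes> \<dots> \<otimes> X \<otimes> \<dots> \<otimes> 1\<close> with
  \<open>X \<in> C\<close>. Each \<open>\<sigma>\<^sub>i\<close> is a pseudo-reflection \<open>1 + a\<^sub>i \<phi>\<^sub>i\<close> of infinite order, so the image of the braid group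
  algebra contains the derivation of \<open>a\<^sub>i \<phi>\<^sub>i\<close>; these generate \<open>gl (ker w)\<close> as a Lie algebra. This
  gives the first equality; the second one follows from the double commutant property of the
  hyperoctahedral group, whose image spans that of the partial permutations.\<close>

section \<open>Matrices on tensor powers\<close>

text \<open>The generators of \<open>imB\<close> are tensor powers, while the argument runs on
  derivations. Where an analytic proof would differentiate a one-parameter group, a Vandermonde
  argument separates the powers of a single generator; this is where the infinite order of the
  eigenvalue \<open>-q\<close> enters. The same hypothesis gives \<open>1 + q \<noteq> 0\<close>, so
  that each \<open>a\<^sub>i \<phi>\<^sub>i\<close> is a multiple of an idempotent, and it makes
  \<open>P\<close> a multiple of a projection. Brackets of the
  \<open>a\<^sub>i \<phi>\<^sub>i\<close> all vanish on \<open>v\<close>; the missing factor of the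
  centraliser comes from the identity, whose derivation is a scalar. Once the first equality is
  known, the second needs nothing more about braids, only averaging over a finite group.
  Faithfulness is a separate question of ranks: \<open>ker w\<close> has dimension
  \<open>n - 1\<close>, which leaves room for \<open>r\<close> independent vectors exactly when
  \<open>n > r\<close>; otherwise a determinant of size \<open>n + 1\<close> yields an explicit
  relation.\<close>

declare One_nat_def [simp del]

definition msum :: "'i set \<Rightarrow> ('i \<Rightarrow> tmat) \<Rightarrow> tmat" where
  "msum S F = (\<lambda>x y. \<Sum>i\<in>S. F i x y)"

lemma msum_cong [fundef_cong]:
  "S = T \<Longrightarrow> (\<And>i. i \<in> T \<Longrightarrow> F i = G i) \<Longrightarrow> msum S F = msum T G"
  by (simp add: msum_def)

text \<open>The zero matrix is written with a free \<open>A\<close> because \<open>alg_gen\<close>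
  has no constructor for zero; taking \<open>mone n r\<close> for \<open>A\<close> gives membership
  at once.\<close>

lemma msum_empty: "msum {} F = msmult 0 A"
  by (simp add: msum_def msmult_def)

lemma msum_insert: "finite S \<Longrightarrow> i \<notin> S \<Longrightarrow> msum (insert i S) F = madd (F i) (msum S F)"
  by (simp add: msum_def madd_def)

lemma msum_reindex: "bij_betw h S T \<Longrightarrow> msum T F = msum S (\<lambda>i. F (h i))"
  unfolding msum_def by (intro ext sum.reindex_bij_betw[symmetric])

lemma msmult_simps [simp]: "msmult 1 A = A" "msmult c (msmult d A) = msmult (c * d) A"
  by (simp_all add: msmult_def mult.assoc)

text \<open>Operators on a single factor \<open>E\<close> are total functions with no condition
  outside \<open>{1..n}\<close>. Identities between them are often available only for indices in
  range, and \<open>ten_cong\<close> carries these over to tensors.\<close>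

definition smul :: "nat \<Rightarrow> (nat \<Rightarrow> nat \<Rightarrow> complex) \<Rightarrow> (nat \<Rightarrow> nat \<Rightarrow> complex) \<Rightarrow> nat \<Rightarrow> nat \<Rightarrow> complex"
  where "smul n X Y = (\<lambda>a b. \<Sum>c\<in>{1..n}. X a c * Y c b)"

definition sid :: "nat \<Rightarrow> nat \<Rightarrow> complex" where
  "sid = (\<lambda>a b. if a = b then 1 else 0)"

definition ten :: "nat \<Rightarrow> nat \<Rightarrow> (nat \<Rightarrow> nat \<Rightarrow> nat \<Rightarrow> complex) \<Rightarrow> tmat" where
  "ten n r X = (\<lambda>x y. if x \<in> Idx n r \<and> y \<in> Idx n r
     then \<Prod>k\<in>{1..r}. X k (x k) (y k) else 0)"

lemma finite_Idx [simp]: "finite (Idx n r)"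
  by (simp add: Idx_def finite_PiE)

lemma Idx_range: "x \<in> Idx n r \<Longrightarrow> k \<in> {1..r} \<Longrightarrow> x k \<in> {1..n}"
  by (auto simp: Idx_def)

lemma Idx_eqI: "x \<in> Idx n r \<Longrightarrow> y \<in> Idx n r \<Longrightarrow> (\<And>k. k \<in> {1..r} \<Longrightarrow> x k = y k) \<Longrightarrow> x = y"
  unfolding Idx_def by (rule PiE_ext)

lemma Idx_comp_permutes: "w permutes {1..r} \<Longrightarrow> x \<circ> w \<in> Idx n r \<longleftrightarrow> x \<in> Idx n r"
proof -
  have *: "x \<in> Idx n r \<Longrightarrow> w permutes {1..r} \<Longrightarrow> x \<circ> w \<in> Idx n r" for x w
    unfolding Idx_def PiE_iff extensional_def
    by (simp del: atLeastAtMost_iff add: permutes_in_image permutes_not_in)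
  assume w: "w permutes {1..r}"
  have "x \<circ> w \<circ> inv w = x" using permutes_inv_o[OF w] by (simp add: comp_assoc)
  then show ?thesis using *[OF _ w] *[OF _ permutes_inv[OF w]] by metis
qed

lemma MatsI: "(\<And>x y. x \<notin> Idx n r \<or> y \<notin> Idx n r \<Longrightarrow> A x y = 0) \<Longrightarrow> A \<in> Mats n r"
  by (auto simp: Mats_def)

lemma MatsD: "A \<in> Mats n r \<Longrightarrow> x \<notin> Idx n r \<or> y \<notin> Idx n r \<Longrightarrow> A x y = 0"
  by (auto simp: Mats_def)

lemma Mats_eqI:
  "A \<in> Mats n r \<Longrightarrow> B \<in> Mats n r \<Longrightarrow> (\<And>x y. x \<in> Idx n r \<Longrightarrow> y \<in> Idx n r \<Longrightarrow> A x y = B x y) \<Longrightarrow> A = B"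
  by (intro ext) (metis MatsD)

lemma Mats_mmul [simp]: "A \<in> Mats n r \<Longrightarrow> B \<in> Mats n r \<Longrightarrow> mmul n r A B \<in> Mats n r"
  by (rule MatsI) (auto simp: mmul_def intro!: sum.neutral dest: MatsD)

lemma Mats_mone [simp]: "mone n r \<in> Mats n r"
  by (rule MatsI) (auto simp: mone_def)

lemma Mats_madd [simp]: "A \<in> Mats n r \<Longrightarrow> B \<in> Mats n r \<Longrightarrow> madd A B \<in> Mats n r"
  by (simp add: Mats_def madd_def)

lemma Mats_msmult [simp]: "A \<in> Mats n r \<Longrightarrow> msmult c A \<in> Mats n r"
  by (simp add: Mats_def msmult_def)

lemma Mats_msum: "(\<And>i. i \<in> S \<Longrightarrow> F i \<in> Mats n r) \<Longrightarrow> msum S F \<in> Mats n r"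
  by (simp add: Mats_def msum_def)

lemma Mats_ten [simp]: "ten n r X \<in> Mats n r"
  by (rule MatsI) (auto simp: ten_def)

lemma mmul_assoc: "mmul n r (mmul n r A B) C = mmul n r A (mmul n r B C)"
  unfolding mmul_def
  by (intro ext) (simp add: sum_distrib_left sum_distrib_right mult.assoc, rule sum.swap)

lemma mmul_one_left: "A \<in> Mats n r \<Longrightarrow> mmul n r (mone n r) A = A"
proof (rule Mats_eqI[of _ n r])
  fix x y assume x: "x \<in> Idx n r"
  have "mmul n r (mone n r) A x y = (\<Sum>z\<in>Idx n r. if z = x then A x y else 0)"
    unfolding mmul_def mone_def using x by (intro sum.cong) auto
  then show "mmul n r (mone n r) A x y = A x y" using x by simp
qed auto

lemma mmul_one_right: "A \<in> Mats n r \<Longrightarrow> mmul n r A (mone n r) = A"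
proof (rule Mats_eqI[of _ n r])
  fix x y assume y: "y \<in> Idx n r"
  have "mmul n r A (mone n r) x y = (\<Sum>z\<in>Idx n r. if z = y then A x y else 0)"
    unfolding mmul_def mone_def by (rule sum.cong) auto
  then show "mmul n r A (mone n r) x y = A x y" using y by simp
qed auto

lemma mmul_msum_right: "mmul n r A (msum S F) = msum S (\<lambda>i. mmul n r A (F i))"
  unfolding mmul_def msum_def by (intro ext) (simp add: sum_distrib_left, rule sum.swap)

lemma mmul_msum_left: "mmul n r (msum S F) A = msum S (\<lambda>i. mmul n r (F i) A)"
  unfolding mmul_def msum_def by (intro ext) (simp add: sum_distrib_right, rule sum.swap)

lemma mmul_msmult_right: "mmul n r A (msmult c B) = msmult c (mmul n r A B)"
  unfolding mmul_def msmult_def by (intro ext) (simp add: sum_distrib_left algebra_simps)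

lemma mmul_msmult_left: "mmul n r (msmult c A) B = msmult c (mmul n r A B)"
  unfolding mmul_def msmult_def by (intro ext) (simp add: sum_distrib_left algebra_simps)

lemma mmul_madd_right: "mmul n r A (madd B C) = madd (mmul n r A B) (mmul n r A C)"
  unfolding mmul_def madd_def by (intro ext) (simp add: sum.distrib algebra_simps)

lemma mmul_madd_left: "mmul n r (madd B C) A = madd (mmul n r B A) (mmul n r C A)"
  unfolding mmul_def madd_def by (intro ext) (simp add: sum.distrib algebra_simps)

lemma ten_mul: "mmul n r (ten n r X) (ten n r Y) = ten n r (\<lambda>k. smul n (X k) (Y k))"
proof (rule Mats_eqI[of _ n r])
  fix x z assume xz: "x \<in> Idx n r" "z \<in> Idx n r"
  have "mmul n r (ten n r X) (ten n r Y) x z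
      = (\<Sum>y\<in>Idx n r. \<Prod>k\<in>{1..r}. X k (x k) (y k) * Y k (y k) (z k))"
    unfolding mmul_def using xz by (intro sum.cong) (auto simp: ten_def prod.distrib)
  also have "\<dots> = (\<Prod>k\<in>{1..r}. \<Sum>a\<in>{1..n}. X k (x k) a * Y k a (z k))"
    unfolding Idx_def by (rule prod_sum_PiE[symmetric]) auto
  finally show "mmul n r (ten n r X) (ten n r Y) x z = ten n r (\<lambda>k. smul n (X k) (Y k)) x z"
    using xz by (simp add: ten_def smul_def)
qed auto

lemma ten_one: "ten n r (\<lambda>k. sid) = mone n r"
proof (rule Mats_eqI[of _ n r])
  fix x y assume xy: "x \<in> Idx n r" "y \<in> Idx n r"
  show "ten n r (\<lambda>k. sid) x y = mone n r x y"
  proof (cases "x = y")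
    case False
    then obtain k where "k \<in> {1..r}" "x k \<noteq> y k" using xy Idx_eqI by blast
    then show ?thesis using xy False by (auto simp: ten_def mone_def sid_def intro!: prod_zero bexI)
  qed (use xy in \<open>simp add: ten_def mone_def sid_def\<close>)
qed auto

lemma ten_cong:
  assumes "\<And>k a b. k \<in> {1..r} \<Longrightarrow> a \<in> {1..n} \<Longrightarrow> b \<in> {1..n} \<Longrightarrow> X k a b = Y k a b"
  shows "ten n r X = ten n r Y"
proof (rule Mats_eqI[of _ n r])
  fix x y assume xy: "x \<in> Idx n r" "y \<in> Idx n r"
  have "(\<Prod>k\<in>{1..r}. X k (x k) (y k)) = (\<Prod>k\<in>{1..r}. Y k (x k) (y k))"
  proof (rule prod.cong)
    fix k assume k: "k \<in> {1..r}"
    show "X k (x k) (y k) = Y k (x k) (y k)"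
      by (rule assms[OF k Idx_range[OF xy(1) k] Idx_range[OF xy(2) k]])
  qed simp
  then show "ten n r X x y = ten n r Y x y" using xy by (simp add: ten_def)
qed auto

lemma prod_fun_upd:
  assumes "finite S" "j \<in> S"
  shows "(\<Prod>k\<in>S. (X(j := Y)) k (x k) (y k)) = Y (x j) (y j) * (\<Prod>k\<in>S - {j}. X k (x k) (y k))"
proof -
  have "(\<Prod>k\<in>S. (X(j := Y)) k (x k) (y k))
      = (X(j := Y)) j (x j) (y j) * (\<Prod>k\<in>S - {j}. (X(j := Y)) k (x k) (y k))"
    using assms by (rule prod.remove)
  also have "(\<Prod>k\<in>S - {j}. (X(j := Y)) k (x k) (y k)) = (\<Prod>k\<in>S - {j}. X k (x k) (y k))"
    by (rule prod.cong) auto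
  finally show ?thesis by simp
qed

lemma ten_upd_sum:
  assumes "j \<in> {1..r}"
  shows "ten n r (X(j := \<lambda>a b. \<Sum>i\<in>S. c i * Y i a b))
       = msum S (\<lambda>i. msmult (c i) (ten n r (X(j := Y i))))"
  unfolding ten_def msum_def msmult_def prod_fun_upd[OF finite_atLeastAtMost assms]
  by (intro ext) (auto simp: sum_distrib_left sum_distrib_right mult.assoc)

lemma ten_upd_lincomb:
  assumes "j \<in> {1..r}"
  shows "ten n r (X(j := \<lambda>a b. c * Y a b + d * Z a b))
       = madd (msmult c (ten n r (X(j := Y)))) (msmult d (ten n r (X(j := Z))))"
  unfolding ten_def madd_def msmult_def prod_fun_upd[OF finite_atLeastAtMost assms]
  by (intro ext) (auto simp: algebra_simps)

definition sunit :: "nat \<Rightarrow> nat \<Rightarrow> nat \<Rightarrow> nat \<Rightarrow> complex" where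
  "sunit a b = (\<lambda>a' b'. if a' = a \<and> b' = b then 1 else 0)"

lemma ten_sunit:
  assumes "x \<in> Idx n r" "y \<in> Idx n r"
  shows "ten n r (\<lambda>k. sunit (x k) (y k)) = (\<lambda>x' y'. if x' = x \<and> y' = y then 1 else 0)"
proof (rule Mats_eqI[of _ n r])
  fix x' y' assume xy: "x' \<in> Idx n r" "y' \<in> Idx n r"
  show "ten n r (\<lambda>k. sunit (x k) (y k)) x' y' = (if x' = x \<and> y' = y then 1 else 0)"
  proof (cases "x' = x \<and> y' = y")
    case False
    then obtain k where "k \<in> {1..r}" "x' k \<noteq> x k \<or> y' k \<noteq> y k" using xy assms Idx_eqI by metis
    then show ?thesis using xy False by (auto simp: ten_def sunit_def intro!: prod_zero bexI)
  qed (use xy in \<open>simp add: ten_def sunit_def\<close>)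
qed (use assms in \<open>auto intro!: MatsI\<close>)

text \<open>Matrix units of the tensor power are pure tensors of matrix units of \<open>E\<close>;
  in this form each factor can later be modified separately.\<close>

lemma Mats_expand:
  assumes "A \<in> Mats n r"
  shows "A = msum (Idx n r \<times> Idx n r) (\<lambda>(x, y). msmult (A x y) (ten n r (\<lambda>k. sunit (x k) (y k))))"
proof (rule Mats_eqI[of _ n r])
  fix x y assume xy: "x \<in> Idx n r" "y \<in> Idx n r"
  have "msum (Idx n r \<times> Idx n r) (\<lambda>(x, y). msmult (A x y) (ten n r (\<lambda>k. sunit (x k) (y k)))) x y
     = (\<Sum>p\<in>Idx n r \<times> Idx n r. if p = (x, y) then A x y else 0)"
    unfolding msum_def msmult_def by (rule sum.cong) (auto simp: ten_sunit split: if_splits)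
  then show "A x y = msum (Idx n r \<times> Idx n r)
      (\<lambda>(x, y). msmult (A x y) (ten n r (\<lambda>k. sunit (x k) (y k)))) x y"
    using xy by simp
qed (use assms in \<open>auto intro!: Mats_msum\<close>)

section \<open>Generated algebras and commutants\<close>

lemma alg_gen_msum:
  assumes "\<And>i. i \<in> S \<Longrightarrow> F i \<in> alg_gen n r G"
  shows "msum S F \<in> alg_gen n r G"
proof (cases "finite S")
  case True
  then show ?thesis using assms
    by (induction S) (auto simp: msum_insert msum_empty[of _ "mone n r"] intro: alg_gen.intros)
next
  case False
  then have "msum S F = msmult 0 (mone n r)" by (simp add: msum_def msmult_def)
  then show ?thesis by (auto intro: alg_gen.intros)
qed

lemma alg_gen_subset_Mats: "G \<subseteq> Mats n r \<Longrightarrow> alg_gen n r G \<subseteq> Mats n r"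
proof
  fix A assume "G \<subseteq> Mats n r" "A \<in> alg_gen n r G"
  from this(2,1) show "A \<in> Mats n r" by induction auto
qed

lemma commutant_alg_gen: "commutant n r (alg_gen n r G) = commutant n r G"
proof (intro equalityI subsetI)
  fix A assume A: "A \<in> commutant n r G"
  have "mmul n r A B = mmul n r B A" if "B \<in> alg_gen n r G" for B using that
  proof induction
    case (gen_mul C D)
    then show ?case by (metis mmul_assoc)
  qed (use A in \<open>auto simp: commutant_def mmul_one_left mmul_one_right
        mmul_madd_left mmul_madd_right mmul_msmult_left mmul_msmult_right\<close>)
  then show "A \<in> commutant n r (alg_gen n r G)" using A by (auto simp: commutant_def)
qed (auto simp: commutant_def intro: gen_gen)

lemma alg_gen_subset_commutant:
  assumes "G \<subseteq> commutant n r S" "S \<subseteq> Mats n r"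
  shows "alg_gen n r G \<subseteq> commutant n r S"
proof
  fix A assume "A \<in> alg_gen n r G"
  then show "A \<in> commutant n r S"
  proof induction
    case (gen_mul C D)
    then have "mmul n r (mmul n r C D) B = mmul n r B (mmul n r C D)" if "B \<in> S" for B
      using that unfolding commutant_def by (simp add: mmul_assoc) (metis mmul_assoc)
    with gen_mul show ?case by (simp add: commutant_def)
  qed (use assms in \<open>auto simp: commutant_def mmul_one_left mmul_one_right
        mmul_madd_left mmul_madd_right mmul_msmult_left mmul_msmult_right\<close>)
qed

lemma commutant_inverse:
  assumes "A \<in> commutant n r S" "B \<in> Mats n r" "S \<subseteq> Mats n r"
    and "mmul n r A B = mone n r" "mmul n r B A = mone n r"
  shows "B \<in> commutant n r S"
proof -
  have "mmul n r B X = mmul n r X B" if X: "X \<in> S" for X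
  proof -
    have XM: "X \<in> Mats n r" using X assms by auto
    have "mmul n r B X = mmul n r B (mmul n r X (mmul n r A B))"
      using assms XM by (simp add: mmul_one_right)
    also have "\<dots> = mmul n r (mmul n r B (mmul n r A X)) B"
      using assms(1) X by (simp add: commutant_def mmul_assoc)
    also have "mmul n r B (mmul n r A X) = X"
      using assms XM by (simp add: mmul_one_left flip: mmul_assoc)
    finally show ?thesis .
  qed
  then show ?thesis using assms by (auto simp: commutant_def)
qed

section \<open>Place permutations\<close>

text \<open>Conjugation by \<open>perm_mat n r w\<close>, encoded as a relabelling of indices so
  that invariance under place permutations involves no inverse matrix (see
  \<open>perm_mat_mmul_eq_act\<close>).\<close>

definition act :: "(nat \<Rightarrow> nat) \<Rightarrow> tmat \<Rightarrow> tmat" where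
  "act w A = (\<lambda>x y. A (x \<circ> w) (y \<circ> w))"

definition perm_mat :: "nat \<Rightarrow> nat \<Rightarrow> (nat \<Rightarrow> nat) \<Rightarrow> tmat" where
  "perm_mat n r w = (\<lambda>x y. if x \<in> Idx n r \<and> y \<in> Idx n r \<and> x = y \<circ> w then 1 else 0)"

lemma Mats_perm_mat [simp]: "perm_mat n r w \<in> Mats n r"
  by (rule MatsI) (auto simp: perm_mat_def)

lemma Mats_act [simp]: "w permutes {1..r} \<Longrightarrow> A \<in> Mats n r \<Longrightarrow> act w A \<in> Mats n r"
  using Idx_comp_permutes[of w r _ n] by (intro MatsI) (metis act_def MatsD)

lemma bij_betw_comp_permutes:
  assumes "w permutes {1..r}"
  shows "bij_betw (\<lambda>x. x \<circ> w) (Idx n r) (Idx n r)"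
proof (rule bij_betw_byWitness[where f'="\<lambda>x. x \<circ> inv w"])
  show "\<forall>x\<in>Idx n r. x \<circ> w \<circ> inv w = x" "\<forall>x\<in>Idx n r. x \<circ> inv w \<circ> w = x"
    using permutes_inv_o[OF assms] by (simp_all add: comp_assoc)
qed (use assms permutes_inv[OF assms] in \<open>auto simp: Idx_comp_permutes\<close>)

lemma act_mmul:
  assumes "w permutes {1..r}"
  shows "act w (mmul n r A B) = mmul n r (act w A) (act w B)"
  unfolding act_def mmul_def
  by (intro ext) (rule sum.reindex_bij_betw[OF bij_betw_comp_permutes[OF assms], symmetric])

lemma act_ten:
  assumes "w permutes {1..r}"
  shows "act w (ten n r X) = ten n r (X \<circ> inv w)"
proof -
  have "(\<Prod>k\<in>{1..r}. X k (x (w k)) (y (w k))) = (\<Prod>k\<in>{1..r}. X (inv w k) (x k) (y k))" for x y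
    using prod.reindex_bij_betw[OF permutes_imp_bij[OF assms], of "\<lambda>k. X (inv w k) (x k) (y k)"]
    by (simp add: permutes_inverses[OF assms])
  then show ?thesis
    by (auto simp: act_def ten_def Idx_comp_permutes[OF assms] fun_eq_iff)
qed

lemma act_act: "act v (act w A) = act (v \<circ> w) A"
  by (simp add: act_def comp_assoc)

lemma act_id [simp]: "act id A = A"
  by (simp add: act_def)

lemma act_msum: "act w (msum S F) = msum S (\<lambda>i. act w (F i))"
  by (simp add: act_def msum_def)

lemma act_msmult: "act w (msmult c A) = msmult c (act w A)"
  by (simp add: act_def msmult_def)

lemma perm_mat_mmul_left:
  assumes w: "w permutes {1..r}" and A: "A \<in> Mats n r"
  shows "mmul n r (perm_mat n r w) A = (\<lambda>x y. A (x \<circ> inv w) y)"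
proof (rule Mats_eqI[of _ n r])
  fix x z assume xz: "x \<in> Idx n r" "z \<in> Idx n r"
  have *: "x = y \<circ> w \<longleftrightarrow> y = x \<circ> inv w" for y
    using permutes_inv_o[OF w] by (auto simp: comp_assoc)
  have "mmul n r (perm_mat n r w) A x z = (\<Sum>y\<in>Idx n r. if y = x \<circ> inv w then A y z else 0)"
    unfolding mmul_def perm_mat_def using xz by (intro sum.cong) (auto simp: *)
  then show "mmul n r (perm_mat n r w) A x z = A (x \<circ> inv w) z"
    using xz Idx_comp_permutes[OF permutes_inv[OF w]] by simp
qed (use assms Idx_comp_permutes[OF permutes_inv[OF w]] in \<open>auto intro!: MatsI dest: MatsD\<close>)

lemma perm_mat_mmul_right:
  assumes w: "w permutes {1..r}" and A: "A \<in> Mats n r"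
  shows "mmul n r A (perm_mat n r w) = (\<lambda>x y. A x (y \<circ> w))"
proof (rule Mats_eqI[of _ n r])
  fix x z assume xz: "x \<in> Idx n r" "z \<in> Idx n r"
  have "mmul n r A (perm_mat n r w) x z = (\<Sum>y\<in>Idx n r. if y = z \<circ> w then A x y else 0)"
    unfolding mmul_def perm_mat_def using xz by (intro sum.cong) auto
  then show "mmul n r A (perm_mat n r w) x z = A x (z \<circ> w)"
    using xz Idx_comp_permutes[OF w] by simp
qed (use assms Idx_comp_permutes[OF w] in \<open>auto intro!: MatsI dest: MatsD\<close>)

text \<open>The matrix sends the basis vector of \<open>y\<close> to that of
  \<open>y \<circ> w\<close>, a right action; hence the reversed order of composition.\<close>

lemma perm_mat_mult:
  assumes "v permutes {1..r}" "w permutes {1..r}"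
  shows "mmul n r (perm_mat n r v) (perm_mat n r w) = perm_mat n r (w \<circ> v)"
proof -
  have "x \<circ> inv v = y \<circ> w \<longleftrightarrow> x = y \<circ> (w \<circ> v)" for x y :: midx
    using permutes_inv_o[OF assms(1)] by (metis comp_assoc comp_id)
  then show ?thesis
    unfolding perm_mat_mmul_left[OF assms(1) Mats_perm_mat] unfolding perm_mat_def
      Idx_comp_permutes[OF permutes_inv[OF assms(1)]] by simp
qed

lemma perm_mat_id: "perm_mat n r id = mone n r"
  unfolding perm_mat_def mone_def by (intro ext) auto

lemma perm_mat_mmul_eq_act:
  assumes w: "w permutes {1..r}" and A: "A \<in> Mats n r"
  shows "mmul n r (perm_mat n r w) (act w A) = mmul n r A (perm_mat n r w)"
proof -
  have "x \<circ> inv w \<circ> w = x" for x :: midx using permutes_inv_o[OF w] by (simp add: comp_assoc)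
  then show ?thesis
    unfolding perm_mat_mmul_right[OF assms] perm_mat_mmul_left[OF w Mats_act[OF assms]]
    by (simp add: act_def)
qed

lemma act_eq_self_of_commutes:
  assumes w: "w permutes {1..r}" and A: "A \<in> Mats n r"
    and "mmul n r A (perm_mat n r w) = mmul n r (perm_mat n r w) A"
  shows "act w A = A"
proof -
  have "mmul n r (perm_mat n r w) (act w A) = mmul n r (perm_mat n r w) A"
    using perm_mat_mmul_eq_act assms by metis
  then have "mmul n r (mmul n r (perm_mat n r (inv w)) (perm_mat n r w)) (act w A)
     = mmul n r (mmul n r (perm_mat n r (inv w)) (perm_mat n r w)) A"
    by (simp add: mmul_assoc)
  then show ?thesis
    using assms by (simp add: perm_mat_mult permutes_inv permutes_inv_o perm_mat_id mmul_one_left)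
qed

text \<open>Among the permutations, only adjacent transpositions are generators of
  \<open>imP\<close>. Conjugation lengthens a transposition by one step, and all transpositions
  together generate the symmetric group.\<close>

lemma transpose_generated:
  assumes id: "P id" and comp: "\<And>v w. P v \<Longrightarrow> P w \<Longrightarrow> P (v \<circ> w)"
    and adj: "\<And>i. i \<in> {1..<r} \<Longrightarrow> P (transpose i (i + 1))"
    and w: "w permutes {1..r::nat}"
  shows "P w"
proof -
  have up: "P (transpose a (a + d))" if "1 \<le> a" "a + d \<le> r" for a d using that
  proof (induction d)
    case (Suc d)
    show ?case
    \<comment> \<open>Conjugating \<open>transpose a a\<close> would only return the identity, so
      length one is taken from \<open>adj\<close>.\<close>
    proof (cases "d = 0")
      case True
      then show ?thesis using Suc.prems adj[of a] by (simp add: One_nat_def)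
    next
      case False
      have "transpose a (a + Suc d)
          = transpose (a + d) (a + d + 1) \<circ> transpose a (a + d) \<circ> transpose (a + d) (a + d + 1)"
        using False by (auto simp: fun_eq_iff transpose_def)
      moreover have "P (transpose a (a + d))" "P (transpose (a + d) (a + d + 1))"
        using Suc adj[of "a + d"] by auto
      ultimately show ?thesis by (simp only: comp)
    qed
  qed (simp add: id)
  have tr: "P (transpose a b)" if "a \<in> {1..r}" "b \<in> {1..r}" for a b
    using up[of a "b - a"] up[of b "a - b"] that by (cases "a \<le> b") (auto simp: transpose_commute)
  show ?thesis
    using w finite_atLeastAtMost by (induction rule: permutes_induct) (use id tr comp in \<open>auto simp only:\<close>)
qed

lemma swap_mat_eq: "i \<in> {1..<r} \<Longrightarrow> swap_mat n r i = perm_mat n r (transpose i (i + 1))"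
proof -
  have *: "(\<lambda>k. if k = i then y (i + 1) else if k = i + 1 then y i else y k)
      = y \<circ> transpose i (i + 1)" for y :: midx
    by (auto simp: fun_eq_iff transpose_def)
  show ?thesis unfolding swap_mat_def perm_mat_def * ..
qed

section \<open>Symmetrisation\<close>

definition dten :: "nat \<Rightarrow> nat \<Rightarrow> (nat \<Rightarrow> nat \<Rightarrow> complex) \<Rightarrow> tmat" where
  "dten n r X = msum {1..r} (\<lambda>j. ten n r ((\<lambda>_. sid)(j := X)))"

text \<open>Left unnormalised; the factor \<open>fact r\<close> is divided out in
  \<open>commutant_imP_subset\<close>.\<close>

definition symz :: "nat \<Rightarrow> tmat \<Rightarrow> tmat" where
  "symz r A = msum {w. w permutes {1..r}} (\<lambda>w. act w A)"

lemma smul_sid_left: "a \<in> {1..n} \<Longrightarrow> smul n sid X a b = X a b"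
proof -
  assume a: "a \<in> {1..n}"
  have "smul n sid X a b = (\<Sum>c\<in>{1..n}. if c = a then X a b else 0)"
    unfolding smul_def sid_def by (rule sum.cong) auto
  then show ?thesis using a by simp
qed

lemma smul_sid_right: "b \<in> {1..n} \<Longrightarrow> smul n X sid a b = X a b"
proof -
  assume b: "b \<in> {1..n}"
  have "smul n X sid a b = (\<Sum>c\<in>{1..n}. if c = b then X a b else 0)"
    unfolding smul_def sid_def by (rule sum.cong) auto
  then show ?thesis using b by simp
qed

lemma dten_cong:
  assumes "\<And>a b. a \<in> {1..n} \<Longrightarrow> b \<in> {1..n} \<Longrightarrow> X a b = Y a b"
  shows "dten n r X = dten n r Y"
  unfolding dten_def by (intro msum_cong refl ten_cong) (use assms in auto)

lemma Mats_dten [simp]: "dten n r X \<in> Mats n r"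
  by (simp add: dten_def Mats_msum)

lemma dten_lincomb:
  "dten n r (\<lambda>a b. c * X a b + d * Y a b) = madd (msmult c (dten n r X)) (msmult d (dten n r Y))"
proof -
  have "dten n r (\<lambda>a b. c * X a b + d * Y a b)
      = msum {1..r} (\<lambda>j. madd (msmult c (ten n r ((\<lambda>_. sid)(j := X))))
          (msmult d (ten n r ((\<lambda>_. sid)(j := Y)))))"
    unfolding dten_def by (intro msum_cong refl ten_upd_lincomb)
  then show ?thesis
    by (simp add: dten_def msum_def madd_def msmult_def sum.distrib sum_distrib_left)
qed

lemma dten_sum:
  assumes "finite S"
  shows "dten n r (\<lambda>a b. \<Sum>i\<in>S. c i * Y i a b) = msum S (\<lambda>i. msmult (c i) (dten n r (Y i)))"
proof -
  have "dten n r (\<lambda>a b. \<Sum>i\<in>S. c i * Y i a b)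
      = msum {1..r} (\<lambda>j. msum S (\<lambda>i. msmult (c i) (ten n r ((\<lambda>_. sid)(j := Y i)))))"
    unfolding dten_def by (intro msum_cong refl ten_upd_sum)
  also have "\<dots> = msum S (\<lambda>i. msmult (c i) (dten n r (Y i)))"
    unfolding msum_def msmult_def dten_def
    by (intro ext) (simp add: sum_distrib_left, rule sum.swap)
  finally show ?thesis .
qed

lemma dten_sid: "dten n r sid = msmult (of_nat r) (mone n r)"
proof -
  have "(\<lambda>_. sid)(j := sid) = (\<lambda>_. sid)" for j :: nat by auto
  then show ?thesis unfolding dten_def by (simp add: ten_one) (simp add: msum_def msmult_def)
qed

lemma act_dten: 
  assumes w: "w permutes {1..r}"
  shows "act w (dten n r X) = dten n r X"
proof -
  have "(\<lambda>_. sid)(j := X) \<circ> inv w = (\<lambda>_. sid)(w j := X)" for j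
    using permutes_inverses[OF w] by (auto simp: fun_eq_iff)
  then show ?thesis
    unfolding dten_def act_msum act_ten[OF w]
    using msum_reindex[OF permutes_imp_bij[OF w]] by (metis (no_types, lifting) msum_cong)
qed

text \<open>\<open>dten\<close> is a homomorphism of Lie algebras: in the two products the terms
  acting at different places agree and cancel, which leaves the commutators at a single
  place.\<close>

lemma dten_commutator:
  "dten n r (\<lambda>a b. smul n X Y a b - smul n Y X a b)
    = madd (mmul n r (dten n r X) (dten n r Y)) (msmult (-1) (mmul n r (dten n r Y) (dten n r X)))"
proof (intro ext)
  fix x y
  define f where "f X Y i j = ten n r (\<lambda>k. smul n (((\<lambda>_. sid)(i := X)) k) (((\<lambda>_. sid)(j := Y)) k)) x y"
    for X Y and i j :: nat
  have prod: "mmul n r (dten n r X) (dten n r Y) x y = (\<Sum>i\<in>{1..r}. \<Sum>j\<in>{1..r}. f X Y i j)" for X Y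
    unfolding dten_def mmul_msum_left mmul_msum_right ten_mul
    by (simp add: msum_def f_def) (rule sum.swap)
  have off: "f X Y i j = f Y X j i" if "i \<noteq> j" for i j
    unfolding f_def using that
    by (intro fun_cong[OF fun_cong[OF ten_cong]]) (auto simp: smul_sid_left smul_sid_right)
  have diag: "f X Y i i - f Y X i i
      = ten n r ((\<lambda>_. sid)(i := \<lambda>a b. smul n X Y a b - smul n Y X a b)) x y" if i: "i \<in> {1..r}" for i
  proof -
    have *: "f X Y i i = ten n r ((\<lambda>_. sid)(i := smul n X Y)) x y" for X Y
      unfolding f_def by (intro fun_cong[OF fun_cong[OF ten_cong]]) (auto simp: smul_sid_left)
    show ?thesis unfolding *
      using fun_cong[OF fun_cong[OF ten_upd_lincomb[OF i, of n "\<lambda>_. sid" 1 "smul n X Y" "-1" "smul n Y X"]], of x y]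
      by (simp add: madd_def msmult_def)
  qed
  have "mmul n r (dten n r X) (dten n r Y) x y - mmul n r (dten n r Y) (dten n r X) x y
     = (\<Sum>i\<in>{1..r}. \<Sum>j\<in>{1..r}. f X Y i j) - (\<Sum>j\<in>{1..r}. \<Sum>i\<in>{1..r}. f Y X i j)"
    unfolding prod by (simp only: sum.swap[of "f Y X"])
  also have "\<dots> = (\<Sum>i\<in>{1..r}. \<Sum>j\<in>{1..r}. if j = i then f X Y i i - f Y X i i else 0)"
    unfolding sum_subtractf[symmetric] by (intro sum.cong refl) (auto simp: off)
  also have "\<dots> = (\<Sum>i\<in>{1..r}. f X Y i i - f Y X i i)" by (intro sum.cong refl) simp
  also have "\<dots> = dten n r (\<lambda>a b. smul n X Y a b - smul n Y X a b) x y"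
    unfolding dten_def msum_def using diag by (intro sum.cong) auto
  finally show "dten n r (\<lambda>a b. smul n X Y a b - smul n Y X a b) x y = madd (mmul n r (dten n r X)
      (dten n r Y)) (msmult (-1) (mmul n r (dten n r Y) (dten n r X))) x y"
    by (simp add: madd_def msmult_def)
qed

lemma symz_act:
  assumes v: "v permutes {1..r}"
  shows "symz r (act v A) = symz r A"
proof (intro ext)
  fix x y
  show "symz r (act v A) x y = symz r A x y"
    using sum_permutations_compose_right[OF v, of "\<lambda>w. act w A x y"]
    by (simp add: symz_def msum_def act_act)
qed

lemma symz_eq_of_invariant:
  assumes "\<And>w. w permutes {1..r} \<Longrightarrow> act w A = A"
  shows "symz r A = msmult (fact r) A"
proof -
  have "symz r A = msum {w. w permutes {1..r}} (\<lambda>_. A)"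
    unfolding symz_def using assms by (intro msum_cong) auto
  moreover have "card {w. w permutes {1..r}} = fact r" by (subst card_permutations) auto
  ultimately show ?thesis by (simp add: msum_def msmult_def)
qed

lemma symz_msum: "symz r (msum S F) = msum S (\<lambda>i. symz r (F i))"
  unfolding symz_def msum_def act_def by (intro ext) (rule sum.swap)

lemma symz_msmult: "symz r (msmult c A) = msmult c (symz r A)"
  unfolding symz_def act_msmult by (simp add: msum_def msmult_def sum_distrib_left)

lemma symz_madd: "symz r (madd A B) = madd (symz r A) (symz r B)"
  unfolding symz_def by (simp add: msum_def madd_def act_def sum.distrib)

lemma dten_mmul_symz:
  "mmul n r (dten n r X) (symz r A) = symz r (mmul n r (dten n r X) A)"
  unfolding symz_def mmul_msum_right by (intro msum_cong refl) (simp add: act_mmul act_dten)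

lemma act_mone: "w permutes {1..r} \<Longrightarrow> act w (mone n r) = mone n r"
  by (simp add: act_ten comp_def flip: ten_one)

text \<open>Multiplying by \<open>dten X\<close> inserts one more factor \<open>X\<close> in all possible ways: at the free places,
  which all have the same symmetrisation, or by merging it with a factor already present.\<close>

lemma symz_ten_in_alg_gen:
  assumes mult: "\<And>X Y. X \<in> C \<Longrightarrow> Y \<in> C \<Longrightarrow> smul n X Y \<in> C"
    and dten: "\<And>X. X \<in> C \<Longrightarrow> dten n r X \<in> alg_gen n r G"
    and J: "J \<subseteq> {1..r}" and Z: "\<And>k. k \<in> J \<Longrightarrow> Z k \<in> C"
  shows "symz r (ten n r (\<lambda>k. if k \<in> J then Z k else sid)) \<in> alg_gen n r G"
proof -
  define T where "T J Z = ten n r (\<lambda>k. if k \<in> J then Z k else sid)" for J Z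
  have "symz r (T J Z) \<in> alg_gen n r G"
    using finite_subset[OF J finite_atLeastAtMost] J Z
  \<comment> \<open>\<open>Z\<close> varies because merging replaces the factor at a place of
    \<open>J\<close> by a product; closure of \<open>C\<close> under \<open>smul\<close> keeps the
    induction hypothesis applicable.\<close>
  proof (induction J arbitrary: Z rule: finite_induct)
    case empty
    have "symz r (mone n r) = msmult (fact r) (mone n r)"
      by (rule symz_eq_of_invariant) (rule act_mone)
    then show ?case by (auto simp: T_def ten_one intro: alg_gen.intros)
  next
    case (insert j J)
    define F where "F = {1..r} - J"
    have jF: "j \<in> F" and Jr: "J \<subseteq> {1..r}" using insert by (auto simp: F_def)
    have split: "{1..r} = J \<union> F" "J \<inter> F = {}" and finF: "finite F" using Jr by (auto simp: F_def)
    have merged: "ten n r (\<lambda>k. smul n (((\<lambda>_. sid)(i := Z j)) k) (if k \<in> J then Z k else sid))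
        = T J (Z(i := smul n (Z j) (Z i)))" if "i \<in> J" for i
      unfolding T_def using that by (intro ten_cong) (auto simp: smul_sid_left smul_sid_right)
    have added: "ten n r (\<lambda>k. smul n (((\<lambda>_. sid)(i := Z j)) k) (if k \<in> J then Z k else sid))
        = T (insert i J) (Z(i := Z j))" if "i \<in> F" for i
      unfolding T_def using that
      by (intro ten_cong) (auto simp: smul_sid_left smul_sid_right F_def)
    have sym: "symz r (T (insert i J) (Z(i := Z j))) = symz r (T (insert j J) Z)" if i: "i \<in> F" for i
    proof -
      have tr: "transpose i j permutes {1..r}"
        using i jF by (intro permutes_swap_id) (auto simp: F_def)
      have "(\<lambda>k. if k \<in> insert i J then (Z(i := Z j)) k else sid)
          = (\<lambda>k. if k \<in> insert j J then Z k else sid) \<circ> transpose i j"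
        using i jF by (auto simp: fun_eq_iff F_def transpose_def)
      then have "T (insert i J) (Z(i := Z j)) = act (transpose i j) (T (insert j J) Z)"
        unfolding T_def act_ten[OF tr] by simp
      then show ?thesis by (simp add: symz_act[OF tr])
    qed
    have "mmul n r (dten n r (Z j)) (symz r (T J Z)) = symz r (mmul n r (dten n r (Z j)) (T J Z))"
      by (rule dten_mmul_symz)
    also have "mmul n r (dten n r (Z j)) (T J Z) = madd
        (msum J (\<lambda>i. T J (Z(i := smul n (Z j) (Z i))))) (msum F (\<lambda>i. T (insert i J) (Z(i := Z j))))"
    proof -
      have "msum {1..r} H = madd (msum J H) (msum F H)" for H
        unfolding split(1) using split(2) finite_subset[OF Jr finite_atLeastAtMost]
        by (simp add: msum_def madd_def sum.union_disjoint finF)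
      moreover have "mmul n r (dten n r (Z j)) (T J Z) = msum {1..r} (\<lambda>i. ten n r (\<lambda>k.
          smul n (((\<lambda>_. sid)(i := Z j)) k) (if k \<in> J then Z k else sid)))"
        unfolding dten_def mmul_msum_left T_def ten_mul ..
      moreover have "msum J (\<lambda>i. ten n r (\<lambda>k.
          smul n (((\<lambda>_. sid)(i := Z j)) k) (if k \<in> J then Z k else sid)))
        = msum J (\<lambda>i. T J (Z(i := smul n (Z j) (Z i))))"
        by (intro msum_cong refl merged)
      moreover have "msum F (\<lambda>i. ten n r (\<lambda>k.
          smul n (((\<lambda>_. sid)(i := Z j)) k) (if k \<in> J then Z k else sid)))
        = msum F (\<lambda>i. T (insert i J) (Z(i := Z j)))"
        by (intro msum_cong refl added)
      ultimately show ?thesis by simp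
    qed
    also have "symz r \<dots> = madd (symz r (msum J (\<lambda>i. T J (Z(i := smul n (Z j) (Z i))))))
        (msmult (of_nat (card F)) (symz r (T (insert j J) Z)))"
      unfolding symz_madd symz_msum[of _ F]
      by (simp add: sym cong: msum_cong) (simp add: msum_def msmult_def)
    finally have eq: "mmul n r (dten n r (Z j)) (symz r (T J Z)) = \<dots>" .
    \<comment> \<open>The place \<open>j\<close> itself is free, so one can divide by
      \<open>card F\<close> and solve for the new symmetrised tensor.\<close>
    have cF: "card F \<noteq> 0" using jF by (auto simp: F_def)
    have "symz r (T (insert j J) Z) = msmult (1 / of_nat (card F))
       (madd (mmul n r (dten n r (Z j)) (symz r (T J Z)))
         (msmult (-1) (symz r (msum J (\<lambda>i. T J (Z(i := smul n (Z j) (Z i))))))))"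
      unfolding eq using cF by (simp add: madd_def msmult_def)
    moreover have "mmul n r (dten n r (Z j)) (symz r (T J Z)) \<in> alg_gen n r G"
      using insert Jr dten by (intro gen_mul) auto
    moreover have "symz r (msum J (\<lambda>i. T J (Z(i := smul n (Z j) (Z i))))) \<in> alg_gen n r G"
      unfolding symz_msum using insert Jr mult by (intro alg_gen_msum insert.IH) auto
    ultimately show ?case by (auto intro: alg_gen.intros)
  qed
  then show ?thesis by (simp add: T_def)
qed

section \<open>Derivatives of one-parameter families\<close>

text \<open>Inversion of a Vandermonde matrix inside the algebra: distinct nodes
  \<open>u ^ k\<close> allow each \<open>V k\<close> to be recovered from the weighted sums for all
  \<open>m\<close>.\<close>

lemma geometric_coeffs_in_alg_gen:
  assumes "\<And>i j. i \<le> d \<Longrightarrow> j \<le> d \<Longrightarrow> u ^ i = u ^ j \<Longrightarrow> i = j"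
    and "\<And>m::nat. msum {..d} (\<lambda>k. msmult (u ^ (m * k)) (V k)) \<in> alg_gen n r G"
    and "k \<le> d"
  shows "V k \<in> alg_gen n r G"
  using assms
proof (induction d arbitrary: V k)
  case 0
  from 0(2)[of 0] 0(3) show ?case by (simp add: msum_def)
next
  case (Suc d)
  \<comment> \<open>Subtracting \<open>u ^ Suc d\<close> times the sum for \<open>m\<close> from the
    sum for \<open>m + 1\<close> kills the top term and multiplies every other \<open>V k\<close> by
    a nonzero number; this is the smaller instance.\<close>
  define V' where "V' k = msmult (u ^ k - u ^ Suc d) (V k)" for k
  have "msum {..d} (\<lambda>k. msmult (u ^ (m * k)) (V' k)) \<in> alg_gen n r G" for m
  proof -
    have "msum {..d} (\<lambda>k. msmult (u ^ (m * k)) (V' k))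
       = madd (msum {..Suc d} (\<lambda>k. msmult (u ^ (Suc m * k)) (V k)))
           (msmult (- (u ^ Suc d)) (msum {..Suc d} (\<lambda>k. msmult (u ^ (m * k)) (V k))))"
      by (simp add: msum_def madd_def msmult_def V'_def sum_distrib_left fun_eq_iff
          algebra_simps power_add sum.distrib sum_negf sum_subtractf)
    then show ?thesis by (simp only: gen_add gen_smult Suc.prems(2))
  qed
  then have V': "V' k \<in> alg_gen n r G" if "k \<le> d" for k
    using Suc.IH[of V' k] Suc.prems(1) that by (metis le_SucI)
  have low: "V k \<in> alg_gen n r G" if k: "k \<le> d" for k
  proof -
    have "u ^ k \<noteq> u ^ Suc d" using Suc.prems(1)[of k "Suc d"] k by auto
    then have "V k = msmult (1 / (u ^ k - u ^ Suc d)) (V' k)" by (simp add: V'_def)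
    then show ?thesis using V'[OF k] by (auto intro: gen_smult)
  qed
  have "V (Suc d) = madd (msum {..Suc d} (\<lambda>k. msmult (u ^ (0 * k)) (V k)))
      (msmult (-1) (msum {..d} V))"
    by (simp add: msum_def madd_def msmult_def)
  moreover have "msum {..d} V \<in> alg_gen n r G" using low by (intro alg_gen_msum) auto
  ultimately have "V (Suc d) \<in> alg_gen n r G"
    using Suc.prems(2)[of 0] by (auto intro!: gen_add gen_smult)
  then show ?case using low Suc.prems(3) by (auto simp: le_Suc_eq)
qed

lemma ten_binomial:
  "ten n r (\<lambda>k a b. f k a b + g k a b)
    = msum (Pow {1..r}) (\<lambda>J. ten n r (\<lambda>k. if k \<in> J then f k else g k))"
proof (rule Mats_eqI[of _ n r])
  fix x y assume xy: "x \<in> Idx n r" "y \<in> Idx n r"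
  have "(\<Prod>k\<in>{1..r}. f k (x k) (y k) + g k (x k) (y k))
     = (\<Sum>J\<in>Pow {1..r}. \<Prod>k\<in>{1..r}. (if k \<in> J then f k else g k) (x k) (y k))"
    unfolding prod_add[OF finite_atLeastAtMost]
  proof (rule sum.cong)
    fix J assume "J \<in> Pow {1..r}"
    then have J: "J \<subseteq> {1..r}" by simp
    show "(\<Prod>k\<in>J. f k (x k) (y k)) * (\<Prod>k\<in>{1..r} - J. g k (x k) (y k))
        = (\<Prod>k\<in>{1..r}. (if k \<in> J then f k else g k) (x k) (y k))"
      unfolding prod.subset_diff[OF J finite_atLeastAtMost] by (simp add: mult.commute)
  qed simp
  then show "ten n r (\<lambda>k a b. f k a b + g k a b) x y
    = msum (Pow {1..r}) (\<lambda>J. ten n r (\<lambda>k. if k \<in> J then f k else g k)) x y"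
    using xy by (simp add: ten_def msum_def)
qed (auto intro: Mats_msum)

text \<open>Grouped by the number \<open>k\<close> of places carrying \<open>f\<close>, the tensor
  power of \<open>s f + g\<close> is a polynomial in \<open>s\<close> with coefficients
  \<open>V k\<close>. Its values at \<open>s = u ^ m\<close> determine the coefficients. Its
  derivative at \<open>s = 1\<close>, the sum of the \<open>k V k\<close>, is
  \<open>dten n r f\<close> because \<open>f + g\<close> is the identity.\<close>

lemma dten_in_alg_gen_of_powers:
  fixes f g :: "nat \<Rightarrow> nat \<Rightarrow> complex"
  assumes u: "\<And>i j. u ^ i = u ^ j \<Longrightarrow> i = j"
    and mem: "\<And>m. ten n r (\<lambda>k a b. u ^ m * f a b + g a b) \<in> alg_gen n r G"
    and sid: "\<And>a b. f a b + g a b = sid a b"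
  shows "dten n r f \<in> alg_gen n r G"
proof -
  define c where "c J = ten n r (\<lambda>k. if k \<in> J then f else g)" for J
  define V where "V k = msum {J \<in> Pow {1..r}. card J = k} c" for k
  have fin: "finite (Pow {1..r})" by simp
  have cr: "card ` Pow {1..r} \<subseteq> {..r}"
    by (auto dest: card_mono[OF finite_atLeastAtMost])
  have grp: "msum {..r} (\<lambda>k. msmult (h k) (V k)) = msum (Pow {1..r}) (\<lambda>J. msmult (h (card J)) (c J))"
    for h :: "nat \<Rightarrow> complex"
  proof (intro ext)
    fix x y
    have "msum {..r} (\<lambda>k. msmult (h k) (V k)) x y
        = (\<Sum>k\<in>{..r}. \<Sum>J\<in>{J \<in> Pow {1..r}. card J = k}. h (card J) * c J x y)"
      unfolding msum_def msmult_def V_def sum_distrib_left by (intro sum.cong) auto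
    also have "\<dots> = (\<Sum>J\<in>Pow {1..r}. h (card J) * c J x y)"
      by (rule sum.group[OF fin finite_atMost cr])
    finally show "msum {..r} (\<lambda>k. msmult (h k) (V k)) x y
        = msum (Pow {1..r}) (\<lambda>J. msmult (h (card J)) (c J)) x y"
      by (simp add: msum_def msmult_def)
  qed
  have "ten n r (\<lambda>k. if k \<in> J then \<lambda>a b. s * f a b else g) = msmult (s ^ card J) (c J)"
    if "J \<in> Pow {1..r}" for s J
  proof -
    have "(\<Prod>k\<in>{1..r}. (if k \<in> J then \<lambda>a b. s * f a b else g) (x k) (y k))
        = s ^ card J * (\<Prod>k\<in>{1..r}. (if k \<in> J then f else g) (x k) (y k))" for x y :: midx
    proof -
      have J: "J \<subseteq> {1..r}" using that by simp
      show ?thesis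
        unfolding prod.subset_diff[OF J finite_atLeastAtMost] by (simp add: prod.distrib)
    qed
    then show ?thesis by (simp add: c_def ten_def msmult_def fun_eq_iff)
  qed
  then have "ten n r (\<lambda>k a b. s * f a b + g a b) = msum (Pow {1..r}) (\<lambda>J. msmult (s ^ card J) (c J))" for s
    unfolding ten_binomial by (intro msum_cong refl)
  then have "msum {..r} (\<lambda>k. msmult (u ^ (m * k)) (V k)) \<in> alg_gen n r G" for m
    unfolding grp power_mult using mem[of m] by simp
  then have V: "V k \<in> alg_gen n r G" if "k \<le> r" for k
    using u that by (intro geometric_coeffs_in_alg_gen[of r u V n r G k]) auto
  have one: "ten n r ((\<lambda>_. sid)(j := f)) = msum {J \<in> Pow {1..r}. j \<in> J} c" if j: "j \<in> {1..r}" for j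
  proof -
    \<comment> \<open>At place \<open>j\<close> the factor is split as \<open>f + 0\<close>,
      elsewhere the identity is split as \<open>f + g\<close>; the subsets missing \<open>j\<close>
      then contribute zero.\<close>
    have "(\<lambda>_. sid)(j := f) = (\<lambda>k a b. f a b + (if k = j then \<lambda>_ _. 0 else g) a b)"
      by (auto simp: fun_eq_iff sid)
    then have "ten n r ((\<lambda>_. sid)(j := f))
       = msum (Pow {1..r}) (\<lambda>J. ten n r (\<lambda>k. if k \<in> J then f else if k = j then \<lambda>_ _. 0 else g))"
      using ten_binomial[of n r "\<lambda>_. f"] by simp
    also have "\<dots> = msum (Pow {1..r}) (\<lambda>J. if j \<in> J then c J else msmult 0 (c J))"
    proof (intro msum_cong refl)
      fix J
      show "ten n r (\<lambda>k. if k \<in> J then f else if k = j then \<lambda>_ _. 0 else g)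
          = (if j \<in> J then c J else msmult 0 (c J))"
      proof (cases "j \<in> J")
        case True
        then have "(\<lambda>k. if k \<in> J then f else if k = j then \<lambda>_ _. 0 else g) = (\<lambda>k. if k \<in> J then f else g)"
          by auto
        with True show ?thesis by (simp add: c_def)
      next
        case False
        then show ?thesis using j by (auto simp: ten_def msmult_def fun_eq_iff intro!: bexI[of _ j])
      qed
    qed
    also have "\<dots> = msum {J \<in> Pow {1..r}. j \<in> J} c"
      unfolding msum_def sum.inter_filter[OF fin] msmult_def by (intro ext sum.cong) auto
    finally show ?thesis .
  qed
  have "dten n r f = msum {1..r} (\<lambda>j. msum {J \<in> Pow {1..r}. j \<in> J} c)"
    unfolding dten_def by (intro msum_cong refl one)
  \<comment> \<open>A subset \<open>J\<close> occurs once for each of its elements, hence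
    \<open>card J\<close> times.\<close>
  also have "\<dots> = msum (Pow {1..r}) (\<lambda>J. msmult (of_nat (card J)) (c J))"
  proof (intro ext)
    fix x y
    have "msum {1..r} (\<lambda>j. msum {J \<in> Pow {1..r}. j \<in> J} c) x y
       = (\<Sum>j\<in>{1..r}. \<Sum>J\<in>Pow {1..r}. if j \<in> J then c J x y else 0)"
      unfolding msum_def sum.inter_filter[OF fin] ..
    also have "\<dots> = (\<Sum>J\<in>Pow {1..r}. \<Sum>j\<in>{1..r}. if j \<in> J then c J x y else 0)"
      by (rule sum.swap)
    also have "\<dots> = (\<Sum>J\<in>Pow {1..r}. of_nat (card J) * c J x y)"
    proof (intro sum.cong refl)
      fix J assume "J \<in> Pow {1..r}"
      then have "{j \<in> {1..r}. j \<in> J} = J" by auto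
      then show "(\<Sum>j\<in>{1..r}. if j \<in> J then c J x y else 0) = of_nat (card J) * c J x y"
        unfolding sum.inter_filter[OF finite_atLeastAtMost, symmetric] by simp
    qed
    finally show "msum {1..r} (\<lambda>j. msum {J \<in> Pow {1..r}. j \<in> J} c) x y
       = msum (Pow {1..r}) (\<lambda>J. msmult (of_nat (card J)) (c J)) x y"
      by (simp add: msum_def msmult_def)
  qed
  also have "\<dots> = msum {..r} (\<lambda>k. msmult (of_nat k) (V k))"
    by (rule grp[symmetric])
  also have "\<dots> \<in> alg_gen n r G" using V by (intro alg_gen_msum gen_smult) auto
  finally show ?thesis .
qed

section \<open>The image of the braid group algebra\<close>

lemma smul_assoc: "smul n (smul n X Y) Z = smul n X (smul n Y Z)"
  unfolding smul_def
  by (intro ext) (simp add: sum_distrib_left sum_distrib_right mult.assoc, rule sum.swap)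

lemma smul_lincomb_left:
  "smul n (\<lambda>a b. c * X a b + d * Y a b) Z = (\<lambda>a b. c * smul n X Z a b + d * smul n Y Z a b)"
  by (intro ext) (simp add: smul_def sum.distrib sum_distrib_left algebra_simps)

lemma smul_lincomb_right:
  "smul n Z (\<lambda>a b. c * X a b + d * Y a b) = (\<lambda>a b. c * smul n Z X a b + d * smul n Z Y a b)"
  by (intro ext) (simp add: smul_def sum.distrib sum_distrib_left algebra_simps)

lemma smul_cong:
  "(\<And>c. c \<in> {1..n} \<Longrightarrow> X a c = X' a c) \<Longrightarrow> (\<And>c. c \<in> {1..n} \<Longrightarrow> Y c b = Y' c b) \<Longrightarrow>
    smul n X Y a b = smul n X' Y' a b"
  unfolding smul_def by (intro sum.cong) auto

section \<open>Rank-one operators and the Burau generators\<close>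

definition outer :: "(nat \<Rightarrow> complex) \<Rightarrow> (nat \<Rightarrow> complex) \<Rightarrow> nat \<Rightarrow> nat \<Rightarrow> complex" where
  "outer \<alpha> \<phi> = (\<lambda>a b. \<alpha> a * \<phi> b)"

definition pair :: "nat \<Rightarrow> (nat \<Rightarrow> complex) \<Rightarrow> (nat \<Rightarrow> complex) \<Rightarrow> complex" where
  "pair n \<phi> \<alpha> = (\<Sum>c\<in>{1..n}. \<phi> c * \<alpha> c)"

lemma smul_outer: "smul n (outer \<alpha> \<phi>) (outer \<beta> \<psi>) = (\<lambda>a b. pair n \<phi> \<beta> * outer \<alpha> \<psi> a b)"
  by (intro ext) (simp add: smul_def outer_def pair_def sum_distrib_left algebra_simps)

definition basis :: "nat \<Rightarrow> nat \<Rightarrow> complex" where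
  "basis i = (\<lambda>a. if a = i then 1 else 0)"

lemma basis_commute: "basis i a = basis a i"
  by (auto simp: basis_def)

text \<open>The generator \<open>\<sigma>\<^sub>i\<close> is \<open>q1\<close> times
  \<open>1 + a\<^sub>i \<phi>\<^sub>i\<close>, where \<open>\<phi>\<^sub>i\<close> is
  \<open>cvec i\<close> and \<open>a\<^sub>i\<close> is \<open>avec q i\<close>. The covectors
  vanish on \<open>v\<close>, and the vectors lie in \<open>ker w\<close>.\<close>

definition cvec :: "nat \<Rightarrow> nat \<Rightarrow> complex" where
  "cvec j = (\<lambda>b. basis (j + 1) b - basis j b)"

definition avec :: "complex \<Rightarrow> nat \<Rightarrow> nat \<Rightarrow> complex" where
  "avec q i = (\<lambda>a. q * basis i a - basis (i + 1) a)"

definition pmat :: "complex \<Rightarrow> nat \<Rightarrow> nat \<Rightarrow> complex" where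
  "pmat q = (\<lambda>a b. q ^ (b - 1))"

lemma sum_basis: "i \<in> {1..n} \<Longrightarrow> (\<Sum>c\<in>{1..n}. basis i c * \<beta> c) = \<beta> i"
proof -
  assume i: "i \<in> {1..n}"
  have "(\<Sum>c\<in>{1..n}. basis i c * \<beta> c) = (\<Sum>c\<in>{1..n}. if c = i then \<beta> i else 0)"
    by (rule sum.cong) (auto simp: basis_def)
  then show ?thesis using i by simp
qed

lemma pair_cvec: "j \<in> {1..<n} \<Longrightarrow> pair n (cvec j) \<beta> = \<beta> (j + 1) - \<beta> j"
  using sum_basis[of "j + 1" n \<beta>] sum_basis[of j n \<beta>]
  by (simp add: pair_def cvec_def left_diff_distrib sum_subtractf)

lemma proj_mat_eq:
  assumes "j \<in> {1..r}"
  shows "proj_mat n r q j = ten n r ((\<lambda>_. sid)(j := pmat q))"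
proof (rule Mats_eqI[of _ n r])
  fix x y assume xy: "x \<in> Idx n r" "y \<in> Idx n r"
  have "(\<Prod>k\<in>{1..r} - {j}. sid (x k) (y k)) = (if \<forall>k\<in>{1..r} - {j}. x k = y k then 1 else 0)"
  proof (cases "\<forall>k\<in>{1..r} - {j}. x k = y k")
    case False
    then show ?thesis by (auto simp: sid_def intro!: prod_zero)
  qed (simp add: sid_def)
  then show "proj_mat n r q j x y = ten n r ((\<lambda>_. sid)(j := pmat q)) x y"
    unfolding ten_def prod_fun_upd[OF finite_atLeastAtMost assms]
    using xy by (simp add: proj_mat_def pmat_def)
qed (auto simp: proj_mat_def intro!: MatsI)

locale burau_rep =
  fixes n r :: nat and q1 q2 q :: complex
  assumes n2: "n \<ge> 2" and q12: "q1 * q2 \<noteq> 0" and qdef: "q = qpar q1 q2"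
    and not_root: "\<And>k::nat. k > 0 \<Longrightarrow> q ^ k \<noteq> 1"
begin

lemma q_nonzero [simp]: "q1 \<noteq> 0" "q2 \<noteq> 0" "q \<noteq> 0"
  using q12 by (auto simp: qdef qpar_def)

lemma q2_eq: "q2 = - (q * q1)"
  by (simp add: qdef qpar_def)

lemma q_nonroot [simp]: "q \<noteq> 1" "1 + q \<noteq> 0" "q + 1 \<noteq> 0" "- 1 \<noteq> q"
proof -
  show "q \<noteq> 1" using not_root[of 1] by simp
  show "1 + q \<noteq> 0"
  proof
    assume "1 + q = 0"
    then have "q = -1" by (simp add: add_eq_0_iff)
    then show False using not_root[of 2] by simp
  qed
  then show "q + 1 \<noteq> 0" "- 1 \<noteq> q" by (auto simp: add.commute)
qed

lemma qint_nonzero [simp]: "qint n q \<noteq> 0"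
proof -
  have "(1 - q) * qint n q = 1 - q ^ n"
    unfolding qint_def by (simp add: sum_gp_strict)
  then show ?thesis using not_root[of n] n2 by auto
qed

lemma qint_eq: "(\<Sum>c\<in>{1..n}. q ^ (c - 1)) = qint n q"
  unfolding qint_def by (rule sum.reindex_bij_witness[of _ "\<lambda>k. k + 1" "\<lambda>c. c - 1"]) auto

abbreviation "imBr \<equiv> imB n r q1 q2"
abbreviation "imPr \<equiv> imP n r q"
abbreviation "av \<equiv> avec q"

text \<open>Structure constants of the brackets below: up to sign, a q-deformed Cartan matrix of
  type A.\<close>

lemma pair_cvec_avec:
  assumes "i \<in> {1..<n}" "j \<in> {1..<n}"
  shows "pair n (cvec j) (av i) = (if j = i then - (1 + q) else if i = j + 1 then q else
            if j = i + 1 then 1 else 0)"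
  using assms by (auto simp: pair_cvec avec_def basis_def)

lemma burau_eq: "burau q1 q2 i a b = q1 * (sid a b + outer (av i) (cvec i) a b)"
  by (auto simp: burau_def sid_def outer_def avec_def cvec_def basis_def q2_eq algebra_simps)

lemma ten_burau_in_imB:
  assumes i: "i \<in> {1..<n}"
  shows "ten n r (\<lambda>_ a b. sid a b + outer (av i) (cvec i) a b) \<in> imBr"
proof -
  have "bten n r q1 q2 i = msmult (q1 ^ r) (ten n r (\<lambda>_ a b. sid a b + outer (av i) (cvec i) a b))"
    by (simp add: bten_def ten_def msmult_def burau_eq prod.distrib fun_eq_iff)
  then have "ten n r (\<lambda>_ a b. sid a b + outer (av i) (cvec i) a b)
      = msmult (1 / q1 ^ r) (bten n r q1 q2 i)" by simp
  moreover have "bten n r q1 q2 i \<in> imBr" unfolding imB_def using i by (intro gen_gen) auto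
  ultimately show ?thesis unfolding imB_def by (simp add: gen_smult)
qed

text \<open>\<open>-q\<close> is the eigenvalue of \<open>1 + a\<^sub>i \<phi>\<^sub>i\<close> other
  than \<open>1\<close>. Squaring removes the sign and turns a coincidence of its powers into a
  relation \<open>q ^ k = 1\<close>.\<close>

lemma power_uq_inj: "(- q) ^ i = (- q) ^ j \<Longrightarrow> i = j"
proof -
  have *: "\<not> i < j" if eq: "(- q) ^ i = (- q) ^ j" for i j
  proof
    assume "i < j"
    then have "(- q) ^ j = (- q) ^ i * (- q) ^ (j - i)" by (simp flip: power_add)
    then have "(- q) ^ (j - i) = 1" using eq by simp
    then have "((- q) ^ (j - i)) ^ 2 = 1" by simp
    then have "(- q) ^ (2 * (j - i)) = 1" by (metis power_mult mult.commute)
    then have "q ^ (2 * (j - i)) = 1" by simp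
    then show False using not_root[of "2 * (j - i)"] \<open>i < j\<close> by simp
  qed
  show "(- q) ^ i = (- q) ^ j \<Longrightarrow> i = j" using *[of i j] *[of j i] by auto
qed

text \<open>As \<open>-q\<close> is not a root of unity, the powers of \<open>\<sigma>\<^sub>i / q1 = 1 + a\<^sub>i \<phi>\<^sub>i\<close> are Zariski dense in a
  one-dimensional torus of pseudo-reflections, whose Lie algebra is spanned by \<open>a\<^sub>i \<phi>\<^sub>i\<close>.\<close>

lemma dten_diag:
  assumes i: "i \<in> {1..<n}"
  shows "dten n r (outer (av i) (cvec i)) \<in> imBr"
proof -
  define R where "R = outer (av i) (cvec i)"
  \<comment> \<open>Since \<open>R\<^sup>2 = - (1 + q) R\<close>, the operator \<open>f\<close> is
    idempotent, \<open>g\<close> is its complement, and \<open>1 + R = (- q) f + g\<close> is the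
    spectral decomposition.\<close>
  define f where "f = (\<lambda>a b. - (1 / (1 + q)) * R a b)"
  define g where "g = (\<lambda>a b. sid a b - f a b)"
  have RR: "smul n R R = (\<lambda>a b. - (1 + q) * R a b)"
    unfolding R_def smul_outer using i by (simp add: pair_cvec_avec)
  have ff: "smul n f f = f"
  proof -
    have "smul n f f a b = (1 / (1 + q)) * (1 / (1 + q)) * smul n R R a b" for a b
      unfolding f_def smul_def sum_distrib_left by (rule sum.cong) auto
    moreover have "(1 / (1 + q)) * (1 / (1 + q)) * (- (1 + q) * R a b) = f a b" for a b
      by (simp add: f_def divide_simps) (simp add: algebra_simps)
    ultimately show ?thesis by (intro ext) (simp only: RR)
  qed
  have lin: "c * f a b + g a b = (c - 1) * f a b + 1 * sid a b" for c a b
    by (simp add: g_def algebra_simps)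
  have base: "(- q) * f a b + g a b = sid a b + R a b" for a b
  proof -
    have "(- q - 1) * f a b = R a b" by (simp add: f_def field_simps)
    then show ?thesis unfolding lin by simp
  qed
  have "ten n r (\<lambda>k a b. (- q) ^ m * f a b + g a b) \<in> imBr" for m
  proof (induction m)
    case 0
    have "ten n r (\<lambda>k a b. (- q) ^ 0 * f a b + g a b) = mone n r"
      unfolding lin by (simp add: ten_one)
    then show ?case unfolding imB_def by (simp add: gen_one)
  next
    case (Suc m)
    have mul: "smul n (\<lambda>a b. (- q) ^ m * f a b + g a b) (\<lambda>a b. (- q) * f a b + g a b) a b
        = (- q) ^ Suc m * f a b + g a b" if ab: "a \<in> {1..n}" "b \<in> {1..n}" for a b
      unfolding lin smul_lincomb_left smul_lincomb_right ff
      using ab by (simp add: smul_sid_left smul_sid_right algebra_simps)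
    have "ten n r (\<lambda>k a b. (- q) ^ Suc m * f a b + g a b)
      = mmul n r (ten n r (\<lambda>k a b. (- q) ^ m * f a b + g a b)) (ten n r (\<lambda>k a b. (- q) * f a b + g a b))"
      unfolding ten_mul by (intro ten_cong mul[symmetric])
    also have "\<dots> \<in> imBr"
      using Suc ten_burau_in_imB[OF i] unfolding base R_def imB_def by (rule gen_mul)
    finally show ?case .
  qed
  then have "dten n r f \<in> imBr"
    unfolding imB_def
    using dten_in_alg_gen_of_powers[where u = "- q" and f = f and g = g and n = n and r = r, OF power_uq_inj]
    by (simp add: g_def)
  moreover have "dten n r R = msmult (- (1 + q)) (dten n r f)"
  proof -
    have "dten n r R = dten n r (\<lambda>a b. - (1 + q) * f a b + 0 * f a b)"
      by (rule dten_cong) (simp add: f_def divide_simps, simp add: algebra_simps)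
    then show ?thesis unfolding dten_lincomb by (simp add: madd_def msmult_def)
  qed
  ultimately show ?thesis unfolding imB_def R_def by (simp add: gen_smult)
qed

section \<open>The Lie algebra of derivations lying in the braid image\<close>

definition lie :: "(nat \<Rightarrow> nat \<Rightarrow> complex) set" where
  "lie = {X. dten n r X \<in> imBr}"

lemma lie_lincomb: "X \<in> lie \<Longrightarrow> Y \<in> lie \<Longrightarrow> (\<lambda>a b. c * X a b + d * Y a b) \<in> lie"
  unfolding lie_def imB_def mem_Collect_eq dten_lincomb by (simp only: gen_add gen_smult)

lemma lie_sum: "finite S \<Longrightarrow> (\<And>i. i \<in> S \<Longrightarrow> Y i \<in> lie) \<Longrightarrow> (\<lambda>a b. \<Sum>i\<in>S. c i * Y i a b) \<in> lie"
  unfolding lie_def imB_def by (auto simp: dten_sum intro!: alg_gen_msum gen_smult)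

lemma lie_cong: 
  "X \<in> lie \<Longrightarrow> (\<And>a b. a \<in> {1..n} \<Longrightarrow> b \<in> {1..n} \<Longrightarrow> Y a b = X a b) \<Longrightarrow> Y \<in> lie"
  unfolding lie_def using dten_cong[of n Y X r] by simp

lemma lie_scale: "X \<in> lie \<Longrightarrow> c \<noteq> 0 \<Longrightarrow> (\<And>a b. X a b = c * Y a b) \<Longrightarrow> Y \<in> lie"
  using lie_lincomb[of X X "1 / c" 0] by (auto intro: lie_cong)

lemma lie_bracket: "X \<in> lie \<Longrightarrow> Y \<in> lie \<Longrightarrow> (\<lambda>a b. smul n X Y a b - smul n Y X a b) \<in> lie"
  unfolding lie_def imB_def mem_Collect_eq dten_commutator by (simp only: gen_add gen_smult gen_mul)

lemma lie_bracket_outer: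
  assumes "outer \<alpha> \<phi> \<in> lie" "outer \<beta> \<psi> \<in> lie"
  shows "(\<lambda>a b. pair n \<phi> \<beta> * outer \<alpha> \<psi> a b - pair n \<psi> \<alpha> * outer \<beta> \<phi> a b) \<in> lie"
  using lie_bracket[OF assms] by (simp add: smul_outer)

abbreviation "M i j \<equiv> outer (av i) (cvec j)"

lemma lie_diag: "i \<in> {1..<n} \<Longrightarrow> M i i \<in> lie"
  using dten_diag by (simp add: lie_def)

text \<open>With \<open>j = i + 1\<close>, the bracket of \<open>M i i\<close> and
  \<open>M j j\<close> is \<open>q M i j - M j i\<close>. Bracketing again with \<open>M i i\<close>
  changes the relative sign of the two terms, up to a scalar and a multiple of \<open>M i i\<close>,
  so they can be separated.\<close>

lemma lie_adjacent:
  assumes i: "i \<in> {1..<n}" "i + 1 \<in> {1..<n}"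
  shows "M i (i + 1) \<in> lie" "M (i + 1) i \<in> lie"
proof -
  define j where "j = i + 1"
  have j: "j \<in> {1..<n}" "j \<noteq> i" using i by (auto simp: j_def)
  have p: "pair n (cvec i) (av i) = - (1 + q)" "pair n (cvec i) (av j) = q" "pair n (cvec j) (av i) = 1"
    using i j by (auto simp: pair_cvec_avec j_def)
  define W where "W = (\<lambda>a b. q * M i j a b - M j i a b)"
  have W: "W \<in> lie"
    using lie_bracket_outer[OF lie_diag lie_diag, of i j] i(1) j(1) by (simp add: p W_def)
  have "(\<lambda>a b. smul n (M i i) W a b - smul n W (M i i) a b) \<in> lie"
    by (rule lie_bracket[OF lie_diag[OF i(1)] W])
  moreover have "smul n (M i i) W a b - smul n W (M i i) a b
     = - (1 + q) * (q * M i j a b + M j i a b) + (- 2 * q) * M i i a b" for a b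
  proof -
    have W': "W = (\<lambda>a b. q * M i j a b + (-1) * M j i a b)" by (simp add: W_def)
    show ?thesis
      unfolding W' smul_lincomb_left smul_lincomb_right smul_outer p by (simp add: algebra_simps)
  qed
  ultimately have "(\<lambda>a b. - (1 + q) * (q * M i j a b + M j i a b) + (- 2 * q) * M i i a b) \<in> lie"
    by simp
  from lie_lincomb[OF this lie_diag[OF i(1)], of 1 "2 * q"]
  have "(\<lambda>a b. - (1 + q) * (q * M i j a b + M j i a b)) \<in> lie" by (simp add: algebra_simps)
  then have V: "(\<lambda>a b. q * M i j a b + M j i a b) \<in> lie" by (rule lie_scale[of _ "- (1 + q)"]) auto
  have "(\<lambda>a b. 1 * W a b + 1 * (q * M i j a b + M j i a b)) \<in> lie" using W V by (rule lie_lincomb)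
  then show "M i (i + 1) \<in> lie"
    by (rule lie_scale[of _ "2 * q"]) (auto simp: W_def j_def)
  have "(\<lambda>a b. (-1) * W a b + 1 * (q * M i j a b + M j i a b)) \<in> lie" using W V by (rule lie_lincomb)
  then show "M (i + 1) i \<in> lie"
    by (rule lie_scale[of _ 2]) (auto simp: W_def j_def)
qed

text \<open>The bracket of the two given operators is \<open>- (1 + q)\<close> times the goal minus
  a multiple of \<open>M k k\<close>, which is already available. This plays the role of multiplying
  matrix units.\<close>

lemma lie_step:
  assumes "outer \<alpha> (cvec k) \<in> lie" "outer (av k) \<psi> \<in> lie" "k \<in> {1..<n}"
  shows "outer \<alpha> \<psi> \<in> lie"
proof -
  have "(\<lambda>a b. 1 * (pair n (cvec k) (av k) * outer \<alpha> \<psi> a b - pair n \<psi> \<alpha> * M k k a b)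
      + pair n \<psi> \<alpha> * M k k a b) \<in> lie"
    using lie_lincomb[OF lie_bracket_outer[OF assms(1,2)] lie_diag[OF assms(3)]] .
  then show ?thesis
    by (rule lie_scale[where c="- (1 + q)"]) (simp_all add: pair_cvec_avec[OF assms(3,3)])
qed

lemma lie_M:
  assumes "i \<in> {1..<n}" "j \<in> {1..<n}"
  shows "M i j \<in> lie"
proof -
  have "M i (i + d) \<in> lie \<and> M (i + d) i \<in> lie" if "1 \<le> i" "i + d < n" for i d
    using that
  proof (induction d)
    case 0
    then show ?case using lie_diag[of i] by simp
  next
    case (Suc d)
    then have d: "M i (i + d) \<in> lie" "M (i + d) i \<in> lie" "i + d \<in> {1..<n}" by auto
    with Suc.prems lie_adjacent[of "i + d"]
    have "M (i + d) (i + Suc d) \<in> lie" "M (i + Suc d) (i + d) \<in> lie"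
      by (auto simp: One_nat_def)
    with d show ?case using lie_step by blast
  qed
  from this[of i "j - i"] this[of j "i - j"] show ?thesis
    using assms by (cases "i \<le> j") auto
qed

text \<open>Telescoping: each of these vectors is \<open>q\<close> times its predecessor minus one
  \<open>avec\<close>. They are the basis vectors projected to \<open>ker w\<close> along
  \<open>basis 1\<close>, the form in which \<open>centr_subset_lie\<close> can expand by matrix
  entries.\<close>

lemma lie_left:
  assumes "a \<in> {1..n}" "j \<in> {1..<n}"
  shows "outer (\<lambda>c. basis a c - q ^ (a - 1) * basis 1 c) (cvec j) \<in> lie"
proof -
  have "outer (\<lambda>c. basis (Suc a) c - q ^ a * basis 1 c) (cvec j) \<in> lie" if "Suc a \<le> n" for a
    using that
  proof (induction a)
    case 0
    \<comment> \<open>The vector is zero here; zero is written as a trivial combination of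
      \<open>M 1 1\<close>, for which \<open>n \<ge> 2\<close> is needed.\<close>
    have "(\<lambda>a b. 0 * M 1 1 a b + 0 * M 1 1 a b) \<in> lie"
      using n2 by (intro lie_lincomb lie_M) auto
    then show ?case by (simp add: outer_def One_nat_def)
  next
    case (Suc a)
    have "(\<lambda>c b. q * outer (\<lambda>c. basis (Suc a) c - q ^ a * basis 1 c) (cvec j) c b
        + (-1) * M (Suc a) j c b) \<in> lie"
      using Suc assms by (intro lie_lincomb lie_M Suc.IH) auto
    then show ?case by (rule lie_cong) (simp add: outer_def avec_def algebra_simps One_nat_def)
  qed
  from this[of "a - 1"] show ?thesis using assms by simp
qed

lemma lie_both:
  assumes "a \<in> {1..n}" "b \<in> {1..n}"
  shows "outer (\<lambda>c. basis a c - q ^ (a - 1) * basis 1 c) (\<lambda>c. basis b c - basis 1 c) \<in> lie"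
    (is "outer ?e _ \<in> lie")
proof -
  have "outer ?e (\<lambda>c. basis (Suc b) c - basis 1 c) \<in> lie" if "Suc b \<le> n" for b
    using that
  proof (induction b)
    case 0
    have "(\<lambda>a b. 0 * M 1 1 a b + 0 * M 1 1 a b) \<in> lie"
      using n2 by (intro lie_lincomb lie_M) auto
    then show ?case by (simp add: outer_def One_nat_def)
  next
    case (Suc b)
    have "(\<lambda>c d. 1 * outer ?e (\<lambda>c. basis (Suc b) c - basis 1 c) c d
        + 1 * outer ?e (cvec (Suc b)) c d) \<in> lie"
      using Suc assms by (intro lie_lincomb lie_left Suc.IH) auto
    then show ?case by (rule lie_cong) (simp add: outer_def cvec_def algebra_simps One_nat_def)
  qed
  from this[of "b - 1"] show ?thesis using assms by simp
qed

section \<open>The centraliser of the pseudo-projection\<close>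

definition centr :: "(nat \<Rightarrow> nat \<Rightarrow> complex) set" where
  "centr = {X. \<forall>a\<in>{1..n}. \<forall>b\<in>{1..n}. smul n X (pmat q) a b = smul n (pmat q) X a b}"

lemma centr_smul:
  assumes "X \<in> centr" "Y \<in> centr"
  shows "smul n X Y \<in> centr"
  unfolding centr_def
proof (intro CollectI ballI)
  fix a b assume ab: "a \<in> {1..n}" "b \<in> {1..n}"
  have "smul n (smul n X Y) (pmat q) a b = smul n X (smul n (pmat q) Y) a b"
    unfolding smul_assoc using assms ab by - (rule smul_cong, auto simp: centr_def)
  also have "\<dots> = smul n (smul n (pmat q) X) Y a b"
    unfolding smul_assoc[symmetric] using assms ab by - (rule smul_cong, auto simp: centr_def)
  finally show "smul n (smul n X Y) (pmat q) a b = smul n (pmat q) (smul n X Y) a b"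
    by (simp add: smul_assoc)
qed

text \<open>An endomorphism commuting with \<open>P = v w\<close> acts by the same scalar on the vector \<open>v\<close> and on the
  covector \<open>w\<close>; subtracting this scalar leaves an element of \<open>ker w \<otimes> v\<^sup>\<bottom>\<close>.\<close>

lemma centr_subset_lie: "centr \<subseteq> lie"
proof
  fix X assume X: "X \<in> centr"
  \<comment> \<open>The common scalar, read off from column \<open>1\<close>, where \<open>w\<close>
    has entry \<open>1\<close>.\<close>
  define l where "l = (\<Sum>c\<in>{1..n}. q ^ (c - 1) * X c 1)"
  have eq: "(\<Sum>c\<in>{1..n}. X a c) * q ^ (b - 1) = (\<Sum>c\<in>{1..n}. q ^ (c - 1) * X c b)"
    if "a \<in> {1..n}" "b \<in> {1..n}" for a b
    using X that by (auto simp: centr_def smul_def pmat_def sum_distrib_right)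
  have one: "1 \<in> {1..n}" using n2 by auto
  have rows: "(\<Sum>c\<in>{1..n}. X a c) = l" if "a \<in> {1..n}" for a
    using eq[OF that one] by (simp add: l_def)
  have cols: "(\<Sum>c\<in>{1..n}. q ^ (c - 1) * X c b) = l * q ^ (b - 1)" if "b \<in> {1..n}" for b
    using eq[OF one that] rows[OF one] by simp
  define Y where "Y a b = X a b - l * sid a b" for a b
  have sid: "sid a b = basis a b" "sid a b = basis b a" for a b by (auto simp: sid_def basis_def)
  have Yr: "(\<Sum>b\<in>{1..n}. Y a b) = 0" if a: "a \<in> {1..n}" for a
    using rows[OF a] sum_basis[OF a, of "\<lambda>_. 1"]
    by (simp add: Y_def sum_subtractf sid(1) flip: sum_distrib_left)
  have Yc: "(\<Sum>a\<in>{1..n}. q ^ (a - 1) * Y a b) = 0" if b: "b \<in> {1..n}" for b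
  proof -
    have "(\<Sum>a\<in>{1..n}. q ^ (a - 1) * Y a b)
      = (\<Sum>a\<in>{1..n}. q ^ (a - 1) * X a b) - l * (\<Sum>a\<in>{1..n}. basis b a * q ^ (a - 1))"
      by (simp add: Y_def sid(2) algebra_simps sum_subtractf sum_distrib_left)
    then show ?thesis using cols[OF b] sum_basis[OF b, of "\<lambda>a. q ^ (a - 1)"] by simp
  qed
  \<comment> \<open>Expanding \<open>Y\<close> in the operators \<open>N p\<close> with its own
    entries as coefficients is exact: the correction terms are row sums and weighted column sums of
    \<open>Y\<close>, which vanish.\<close>
  define N where "N p = outer (\<lambda>c. basis (fst p) c - q ^ (fst p - 1) * basis 1 c)
      (\<lambda>c. basis (snd p) c - basis 1 c)" for p :: "nat \<times> nat"
  have "X a b = 1 * (\<Sum>p\<in>{1..n} \<times> {1..n}. Y (fst p) (snd p) * N p a b) + l * sid a b"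
    if ab: "a \<in> {1..n}" "b \<in> {1..n}" for a b
  proof -
    have inner: "(\<Sum>d\<in>{1..n}. Y c d * (basis d b - basis 1 b)) = Y c b" if c: "c \<in> {1..n}" for c
    proof -
      have "(\<Sum>d\<in>{1..n}. Y c d * (basis d b - basis 1 b))
         = (\<Sum>d\<in>{1..n}. basis b d * Y c d) - basis 1 b * (\<Sum>d\<in>{1..n}. Y c d)"
        unfolding sum_distrib_left sum_subtractf[symmetric] basis_commute[of _ b]
        by (intro sum.cong refl) (simp add: algebra_simps)
      then show ?thesis using Yr[OF c] sum_basis[OF ab(2)] by simp
    qed
    have "(\<Sum>p\<in>{1..n} \<times> {1..n}. Y (fst p) (snd p) * N p a b)
       = (\<Sum>c\<in>{1..n}. (basis c a - q ^ (c - 1) * basis 1 a) * (\<Sum>d\<in>{1..n}. Y c d * (basis d b - basis 1 b)))"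
      unfolding sum.cartesian_product' N_def outer_def
      by (simp add: sum_distrib_left algebra_simps)
    also have "\<dots> = (\<Sum>c\<in>{1..n}. (basis c a - q ^ (c - 1) * basis 1 a) * Y c b)"
      by (intro sum.cong refl) (simp only: inner)
    also have "\<dots> = (\<Sum>c\<in>{1..n}. basis a c * Y c b) - basis 1 a * (\<Sum>c\<in>{1..n}. q ^ (c - 1) * Y c b)"
      unfolding sum_distrib_left sum_subtractf[symmetric] basis_commute[of _ a]
      by (intro sum.cong refl) (simp add: algebra_simps)
    also have "\<dots> = Y a b" using Yc[OF ab(2)] sum_basis[OF ab(1)] by simp
    finally show ?thesis by (simp add: Y_def)
  qed
  moreover have "(\<lambda>a b. 1 * (\<Sum>p\<in>{1..n} \<times> {1..n}. Y (fst p) (snd p) * N p a b) + l * sid a b) \<in> lie"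
  proof (intro lie_lincomb lie_sum)
    \<comment> \<open>The scalar part does not come from brackets: the derivation of the identity is
      \<open>r\<close> times \<open>mone n r\<close>.\<close>
    show "sid \<in> lie" unfolding lie_def imB_def by (simp add: dten_sid gen_smult gen_one)
    show "N p \<in> lie" if "p \<in> {1..n} \<times> {1..n}" for p
      unfolding N_def using that by (intro lie_both) auto
  qed auto
  ultimately show "X \<in> lie" by (rule lie_cong[rotated])
qed

text \<open>The reflection that is \<open>-1\<close> on \<open>v\<close> and \<open>1\<close> on
  \<open>ker w\<close>; the denominator reflects that \<open>P\<close> is \<open>qint n q\<close>
  times a projection.\<close>

definition tm :: "nat \<Rightarrow> nat \<Rightarrow> complex" where
  "tm = (\<lambda>a b. 1 * sid a b + (- 2 / qint n q) * pmat q a b)"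

lemma smul_pmat_pmat: "smul n (pmat q) (pmat q) = (\<lambda>a b. qint n q * pmat q a b)"
  by (simp add: smul_def pmat_def qint_eq flip: sum_distrib_right)

lemma smul_tm_tm: "a \<in> {1..n} \<Longrightarrow> b \<in> {1..n} \<Longrightarrow> smul n tm tm a b = sid a b"
  unfolding tm_def smul_lincomb_left smul_lincomb_right smul_pmat_pmat
  by (simp add: smul_sid_left smul_sid_right)

text \<open>Mean over conjugation by the two-element group generated by \<open>tm\<close>: the
  projection of \<open>End E\<close> onto the centraliser of \<open>P\<close>.\<close>

definition avg :: "(nat \<Rightarrow> nat \<Rightarrow> complex) \<Rightarrow> nat \<Rightarrow> nat \<Rightarrow> complex" where
  "avg X = (\<lambda>a b. (1/2) * X a b + (1/2) * smul n tm (smul n X tm) a b)"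

lemma avg_in_centr: "avg X \<in> centr"
proof -
  have tt: "smul n tm (smul n tm Y) a b = Y a b" "smul n (smul n Y tm) tm a b = Y a b"
    if "a \<in> {1..n}" "b \<in> {1..n}" for a b Y
  proof -
    have "smul n tm (smul n tm Y) a b = smul n sid Y a b"
      unfolding smul_assoc[symmetric] using that by (intro smul_cong) (auto simp: smul_tm_tm)
    then show "smul n tm (smul n tm Y) a b = Y a b" using that by (simp add: smul_sid_left)
    have "smul n (smul n Y tm) tm a b = smul n Y sid a b"
      unfolding smul_assoc using that by (intro smul_cong) (auto simp: smul_tm_tm)
    then show "smul n (smul n Y tm) tm a b = Y a b" using that by (simp add: smul_sid_right)
  qed
  have comm: "smul n tm (avg X) a b = smul n (avg X) tm a b" if "a \<in> {1..n}" "b \<in> {1..n}" for a b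
  proof -
    have "smul n (smul n tm (smul n X tm)) tm a b = smul n tm X a b"
      using tt(2)[of a b "smul n tm X"] that by (simp add: smul_assoc)
    then show ?thesis
      unfolding avg_def smul_lincomb_left smul_lincomb_right using tt(1) that by simp
  qed
  \<comment> \<open>\<open>P\<close> is a combination of the identity and \<open>tm\<close>, so
    whatever commutes with \<open>tm\<close> commutes with \<open>P\<close>.\<close>
  have pm: "pmat q = (\<lambda>a b. (qint n q / 2) * sid a b + (- qint n q / 2) * tm a b)"
    by (auto simp: tm_def fun_eq_iff field_simps)
  show ?thesis
    unfolding centr_def pm smul_lincomb_left smul_lincomb_right
    using comm by (auto simp: smul_sid_left smul_sid_right)
qed

lemma imP_subset_Mats: "imPr \<subseteq> Mats n r"
  unfolding imP_def by (intro alg_gen_subset_Mats) (auto simp: swap_mat_eq proj_mat_eq)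

lemma ten_tm_eq:
  assumes "j \<in> {1..r}"
  shows "ten n r ((\<lambda>_. sid)(j := tm)) = madd (mone n r) (msmult (- 2 / qint n q) (proj_mat n r q j))"
proof -
  have "(\<lambda>_. sid)(j := sid) = (\<lambda>_::nat. sid)" by auto
  then show ?thesis
    unfolding tm_def ten_upd_lincomb[OF assms] proj_mat_eq[OF assms] by (simp add: ten_one)
qed

lemma ten_tm_tm:
  "mmul n r (ten n r ((\<lambda>_. sid)(j := tm))) (ten n r ((\<lambda>_. sid)(j := tm))) = mone n r"
  unfolding ten_mul ten_one[symmetric]
  by (rule ten_cong) (auto simp: smul_tm_tm smul_sid_left)

text \<open>Conjugation by \<open>tm\<close> at one place fixes \<open>A\<close>, so averaging there
  leaves \<open>A\<close> unchanged but moves the matrix units of its expansion into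
  \<open>centr\<close>. The places of \<open>J\<close> are treated one at a time.\<close>

lemma commutant_imP_expand:
  assumes A: "A \<in> commutant n r imPr" and J: "J \<subseteq> {1..r}"
  shows "A = msum (Idx n r \<times> Idx n r) (\<lambda>p. msmult (A (fst p) (snd p)) (ten n r
      (\<lambda>k. if k \<in> J then avg (sunit (fst p k) (snd p k)) else sunit (fst p k) (snd p k))))"
proof -
  define T where "T J p = (\<lambda>k. if k \<in> J then avg (sunit (fst p k) (snd p k))
      else sunit (fst p k) (snd p k))" for J and p :: "midx \<times> midx"
  have AM: "A \<in> Mats n r" using A by (simp add: commutant_def)
  have "A = msum (Idx n r \<times> Idx n r) (\<lambda>p. msmult (A (fst p) (snd p)) (ten n r (T J p)))"
    using finite_subset[OF J finite_atLeastAtMost] J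
  proof (induction J rule: finite_induct)
    case empty
    show ?case using Mats_expand[OF AM] by (simp add: T_def split_def)
  next
    case (insert j J)
    have j: "j \<in> {1..r}" using insert by auto
    define t where "t = ten n r ((\<lambda>_. sid)(j := tm))"
    have "proj_mat n r q j \<in> imPr" unfolding imP_def using j by (intro gen_gen) auto
    then have "mmul n r A t = mmul n r t A"
      using A AM unfolding t_def ten_tm_eq[OF j] commutant_def
      by (auto simp: mmul_madd_left mmul_madd_right mmul_msmult_left mmul_msmult_right
          mmul_one_left mmul_one_right)
    then have "mmul n r t (mmul n r A t) = mmul n r (mmul n r t t) A" by (simp add: mmul_assoc)
    then have tAt: "mmul n r t (mmul n r A t) = A"
      using AM by (simp add: t_def ten_tm_tm mmul_one_left)
    have T: "ten n r (T (insert j J) p) = madd (msmult (1/2) (ten n r (T J p)))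
        (msmult (1/2) (mmul n r t (mmul n r (ten n r (T J p)) t)))" for p
    proof -
      have "mmul n r t (mmul n r (ten n r (T J p)) t)
         = ten n r ((T J p)(j := smul n tm (smul n (T J p j) tm)))"
        unfolding t_def ten_mul
        by (rule ten_cong) (auto simp: smul_sid_left smul_sid_right)
      moreover have "T (insert j J) p = (T J p)(j := \<lambda>a b. (1/2) * T J p j a b
          + (1/2) * smul n tm (smul n (T J p j) tm) a b)"
        using insert by (auto simp: T_def avg_def fun_eq_iff)
      ultimately show ?thesis by (simp only: ten_upd_lincomb[OF j] fun_upd_triv)
    qed
    have IH: "A = msum (Idx n r \<times> Idx n r) (\<lambda>p. msmult (A (fst p) (snd p)) (ten n r (T J p)))"
      using insert by simp
    have "A = madd (msmult (1/2) A) (msmult (1/2) (mmul n r t (mmul n r A t)))"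
      unfolding tAt by (simp add: madd_def msmult_def)
    also have "mmul n r t (mmul n r A t) = msum (Idx n r \<times> Idx n r)
       (\<lambda>p. msmult (A (fst p) (snd p)) (mmul n r t (mmul n r (ten n r (T J p)) t)))"
      by (subst IH) (simp only: mmul_msum_left mmul_msum_right mmul_msmult_left mmul_msmult_right)
    also have "madd (msmult (1/2) A) (msmult (1/2) \<dots>)
       = msum (Idx n r \<times> Idx n r) (\<lambda>p. msmult (A (fst p) (snd p)) (ten n r (T (insert j J) p)))"
      unfolding T
      by (subst IH) (simp add: msum_def madd_def msmult_def sum_distrib_left sum.distrib algebra_simps)
    finally show ?case .
  qed
  then show ?thesis by (simp add: T_def)
qed

lemma commutant_imP_invariant:
  assumes A: "A \<in> commutant n r imPr" and w: "w permutes {1..r}"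
  shows "act w A = A"
proof -
  have "w permutes {1..r} \<and> act w A = A"
  proof (rule transpose_generated[OF _ _ _ w])
    fix v w assume vw: "v permutes {1..r} \<and> act v A = A" "w permutes {1..r} \<and> act w A = A"
    then have "act (v \<circ> w) A = A" by (simp flip: act_act)
    then show "v \<circ> w permutes {1..r} \<and> act (v \<circ> w) A = A"
      using vw permutes_compose by blast
  next
    fix i assume i: "i \<in> {1..<r}"
    then have p: "transpose i (i + 1) permutes {1..r}" by (intro permutes_swap_id) auto
    have "swap_mat n r i \<in> imPr" unfolding imP_def using i by (intro gen_gen) auto
    then show "transpose i (i + 1) permutes {1..r} \<and> act (transpose i (i + 1)) A = A"
      using A p i by (auto intro!: act_eq_self_of_commutes[of _ r _ n] simp: commutant_def swap_mat_eq)
  qed (simp_all add: permutes_id del: id_apply)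
  then show ?thesis ..
qed

text \<open>\<open>fact r\<close> times \<open>A\<close> is its symmetrisation, hence a combination
  of symmetrised pure tensors with factors in \<open>centr\<close>, and derivations produce
  these.\<close>

lemma commutant_imP_subset: "commutant n r imPr \<subseteq> imBr"
proof
  fix A assume A: "A \<in> commutant n r imPr"
  define T where "T p = ten n r (\<lambda>k. if k \<in> {1..r} then avg (sunit (fst p k) (snd p k))
      else sid)" for p :: "midx \<times> midx"
  have T: "A = msum (Idx n r \<times> Idx n r) (\<lambda>p. msmult (A (fst p) (snd p)) (T p))"
  proof -
    have "T p = ten n r (\<lambda>k. if k \<in> {1..r} then avg (sunit (fst p k) (snd p k))
       else sunit (fst p k) (snd p k))" for p
      unfolding T_def by (rule ten_cong) auto
    then show ?thesis using commutant_imP_expand[OF A order.refl] by simp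
  qed
  have "msmult (fact r) A = symz r A"
    by (rule symz_eq_of_invariant[symmetric]) (rule commutant_imP_invariant[OF A])
  also have "\<dots> = msum (Idx n r \<times> Idx n r) (\<lambda>p. msmult (A (fst p) (snd p)) (symz r (T p)))"
    by (subst T) (simp only: symz_msum symz_msmult)
  also have "\<dots> \<in> imBr"
    unfolding imB_def T_def
  proof (intro alg_gen_msum gen_smult symz_ten_in_alg_gen[of centr] centr_smul)
    fix X assume "X \<in> centr"
    then show "dten n r X \<in> alg_gen n r ({bten n r q1 q2 i |i. i \<in> {1..<n}} \<union>
        {binv n r q1 q2 i |i. i \<in> {1..<n}})"
      using centr_subset_lie by (auto simp: lie_def imB_def)
  qed (auto simp: avg_in_centr)
  finally have "msmult (1 / fact r) (msmult (fact r) A) \<in> imBr"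
    unfolding imB_def by (rule gen_smult)
  then show "A \<in> imBr" by simp
qed

end

section \<open>Double commutant\<close>

text \<open>A linear complement is chosen in the whole function space, so \<open>p\<close> has no
  compatibility with multiplication yet; averaging supplies it later.\<close>

lemma alg_gen_projection:
  obtains p where "\<And>X. p X \<in> alg_gen n r G" "\<And>X. X \<in> alg_gen n r G \<Longrightarrow> p X = X"
    "\<And>X Y. p (madd X Y) = madd (p X) (p Y)" "\<And>c X. p (msmult c X) = msmult c (p X)"
proof -
  interpret V: vector_space msmult
    by unfold_locales (auto simp: msmult_def fun_eq_iff algebra_simps)
  interpret VP: vector_space_pair msmult msmult ..
  have madd: "madd A B = A + B" for A B by (simp add: madd_def plus_fun_def)
  have "V.subspace (alg_gen n r G)"
    unfolding V.subspace_def
  proof (intro conjI ballI allI)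
    have "msmult 0 (mone n r) \<in> alg_gen n r G" by (intro gen_smult gen_one)
    then show "0 \<in> alg_gen n r G" by (simp add: msmult_def zero_fun_def)
    show "A + B \<in> alg_gen n r G" if "A \<in> alg_gen n r G" "B \<in> alg_gen n r G" for A B
      using that unfolding madd[symmetric] by (rule gen_add)
    show "msmult c A \<in> alg_gen n r G" if "A \<in> alg_gen n r G" for c A
      using that by (rule gen_smult)
  qed
  from VP.linear_exists_left_inverse_on[OF V.linear_id this]
  obtain p where p: "range p \<subseteq> alg_gen n r G" "Vector_Spaces.linear msmult msmult p"
    "\<forall>v\<in>alg_gen n r G. p v = v"
    by auto
  interpret P: Vector_Spaces.linear msmult msmult p by (rule p(2))
  show ?thesis
  proof (rule that[of p])
    show "p (madd X Y) = madd (p X) (p Y)" for X Y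
      unfolding madd by (rule P.add)
    show "p (msmult c X) = msmult c (p X)" for c X
      by (rule P.scale)
  qed (use p in auto)
qed

definition eunit :: "midx \<Rightarrow> midx \<Rightarrow> tmat" where
  "eunit a b = (\<lambda>x y. if x = a \<and> y = b then 1 else 0)"

lemma Mats_eunit [simp]: "a \<in> Idx n r \<Longrightarrow> b \<in> Idx n r \<Longrightarrow> eunit a b \<in> Mats n r"
  by (rule MatsI) (auto simp: eunit_def)

lemma mmul_eunit:
  assumes "A \<in> Mats n r" "a \<in> Idx n r"
  shows "mmul n r A (eunit a b) = msum (Idx n r) (\<lambda>s. msmult (A s a) (eunit s b))"
proof (intro ext)
  fix x y
  have "mmul n r A (eunit a b) x y = (\<Sum>z\<in>Idx n r. if z = a then (if y = b then A x a else 0) else 0)"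
    unfolding mmul_def eunit_def by (rule sum.cong) auto
  also have "\<dots> = (if y = b then A x a else 0)" using assms by simp
  also have "\<dots> = (\<Sum>s\<in>Idx n r. if s = x then (if y = b then A x a else 0) else 0)"
    using MatsD[OF assms(1), of x a] by auto
  also have "\<dots> = msum (Idx n r) (\<lambda>s. msmult (A s a) (eunit s b)) x y"
    unfolding msum_def msmult_def eunit_def by (rule sum.cong) auto
  finally show "mmul n r A (eunit a b) x y = msum (Idx n r) (\<lambda>s. msmult (A s a) (eunit s b)) x y" .
qed

text \<open>Maschke's argument on the left module of all matrices: averaging a linear projection onto the
  algebra \<open>B\<close> over the group \<open>m ` U\<close> gives an equivariant projection \<open>L\<close>. The matrix blocks of \<open>L\<close>
  commute with \<open>B\<close>, so every \<open>A\<close> in the double commutant satisfies \<open>A = A L(1) = L(A) \<in> B\<close>.\<close>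

lemma double_commutant_of_averaging:
  fixes m m' :: "'u \<Rightarrow> tmat"
  assumes G: "G \<subseteq> Mats n r" and U: "finite U" "U \<noteq> {}"
    and mB: "\<And>u. u \<in> U \<Longrightarrow> m u \<in> alg_gen n r G" "\<And>u. u \<in> U \<Longrightarrow> m' u \<in> alg_gen n r G"
    and inv: "\<And>u. u \<in> U \<Longrightarrow> mmul n r (m u) (m' u) = mone n r"
    and H: "H \<subseteq> Mats n r" "commutant n r H \<subseteq> commutant n r (alg_gen n r G)"
    and shift: "\<And>g. g \<in> H \<Longrightarrow> \<exists>g' \<beta>. mmul n r g' g = mone n r \<and> bij_betw \<beta> U U \<and>
        (\<forall>u\<in>U. m (\<beta> u) = mmul n r g (m u) \<and> m' (\<beta> u) = mmul n r (m' u) g')"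
    and A: "A \<in> commutant n r (commutant n r (alg_gen n r G))"
  shows "A \<in> alg_gen n r G"
proof -
  define B where "B = alg_gen n r G"
  have BM: "B \<subseteq> Mats n r" unfolding B_def by (rule alg_gen_subset_Mats[OF G])
  have AM: "A \<in> Mats n r" using A by (simp add: commutant_def)
  obtain p where p: "\<And>X. p X \<in> B" "\<And>X. X \<in> B \<Longrightarrow> p X = X"
    "\<And>X Y. p (madd X Y) = madd (p X) (p Y)" "\<And>c X. p (msmult c X) = msmult c (p X)"
    by (rule alg_gen_projection[of n r G, folded B_def]) (rule that)
  define L where "L X = msum U (\<lambda>u. mmul n r (m u) (p (mmul n r (m' u) X)))" for X
  have LB: "L X \<in> B" for X
    unfolding L_def B_def using mB p(1) by (intro alg_gen_msum gen_mul) (auto simp: B_def)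
  have Lone: "L (mone n r) = msmult (of_nat (card U)) (mone n r)"
  proof -
    have "L (mone n r) = msum U (\<lambda>u. mone n r)"
      unfolding L_def
    proof (intro msum_cong refl)
      fix u assume u: "u \<in> U"
      then have "m' u \<in> B" "m' u \<in> Mats n r" using mB BM by (auto simp: B_def)
      then show "mmul n r (m u) (p (mmul n r (m' u) (mone n r))) = mone n r"
        using inv[OF u] by (simp add: mmul_one_right p(2))
    qed
    then show ?thesis by (simp add: msum_def msmult_def)
  qed
  have Ladd: "L (madd X Y) = madd (L X) (L Y)" for X Y
    by (simp add: L_def mmul_madd_right p(3)) (simp add: msum_def madd_def sum.distrib)
  have Lscale: "L (msmult c X) = msmult c (L X)" for c X
    by (simp add: L_def mmul_msmult_right p(4)) (simp add: msum_def msmult_def sum_distrib_left)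
  have Lsum: "finite S \<Longrightarrow> L (msum S F) = msum S (\<lambda>i. L (F i))" for S :: "midx set" and F
  proof (induction S rule: finite_induct)
    case empty
    show ?case unfolding msum_empty[of _ "mone n r"] Lscale by (simp add: msum_def msmult_def)
  qed (simp add: msum_insert Ladd)
  have Lequiv: "L (mmul n r g X) = mmul n r g (L X)" if g: "g \<in> H" and X: "X \<in> Mats n r" for g X
  proof -
    \<comment> \<open>\<open>\<beta>\<close> is left translation by \<open>g\<close> on the index
      set \<open>U\<close>, and \<open>g'\<close> is a left inverse of \<open>g\<close>; reindexing
      by \<open>\<beta>\<close> pulls \<open>g\<close> out of \<open>L\<close>.\<close>
    obtain g' \<beta> where gg: "mmul n r g' g = mone n r" and \<beta>: "bij_betw \<beta> U U"
      and m: "\<forall>u\<in>U. m (\<beta> u) = mmul n r g (m u) \<and> m' (\<beta> u) = mmul n r (m' u) g'"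
      using shift[OF g] by blast
    have g'g: "mmul n r g' (mmul n r g X) = X"
      using gg X by (simp add: mmul_one_left flip: mmul_assoc)
    have "L (mmul n r g X) = msum U (\<lambda>u. mmul n r (m (\<beta> u)) (p (mmul n r (m' (\<beta> u)) (mmul n r g X))))"
      unfolding L_def by (rule msum_reindex[OF \<beta>])
    also have "\<dots> = msum U (\<lambda>u. mmul n r g (mmul n r (m u) (p (mmul n r (m' u) X))))"
      using m by (intro msum_cong refl) (simp add: mmul_assoc g'g)
    finally show ?thesis by (simp add: L_def mmul_msum_right)
  qed
  \<comment> \<open>The block of \<open>L\<close> from column \<open>y\<close> of the argument to
    column \<open>z\<close> of the result. Equivariance of \<open>L\<close> makes the blocks commute
    with \<open>H\<close>.\<close>
  define T where "T z y = (\<lambda>x x'. if x' \<in> Idx n r then L (eunit x' y) x z else 0)" for z y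
  have TM: "T z y \<in> Mats n r" for z y
  proof (rule MatsI)
    fix x x' assume "x \<notin> Idx n r \<or> x' \<notin> Idx n r"
    moreover have "L (eunit x' y) \<in> Mats n r" using LB BM by auto
    ultimately show "T z y x x' = 0" using MatsD[of "L (eunit x' y)" n r x z] by (auto simp: T_def)
  qed
  have left: "mmul n r X (L (eunit a y)) x z = mmul n r X (T z y) x a"
    if "a \<in> Idx n r" for X a x y z
    using that by (simp add: mmul_def T_def)
  have right: "L (mmul n r X (eunit a y)) x z = mmul n r (T z y) X x a"
    if "X \<in> Mats n r" "a \<in> Idx n r" for X a x y z
  proof -
    have "L (mmul n r X (eunit a y)) x z = (\<Sum>s\<in>Idx n r. X s a * L (eunit s y) x z)"
      unfolding mmul_eunit[OF that] Lsum[OF finite_Idx] Lscale by (simp add: msum_def msmult_def)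
    also have "\<dots> = mmul n r (T z y) X x a"
      unfolding mmul_def T_def by (rule sum.cong) auto
    finally show ?thesis .
  qed
  have "T z y \<in> commutant n r H" if y: "y \<in> Idx n r" for z y
    unfolding commutant_def
  proof (intro CollectI conjI ballI TM)
    fix g assume g: "g \<in> H"
    then have gM: "g \<in> Mats n r" using H by auto
    show "mmul n r (T z y) g = mmul n r g (T z y)"
    proof (rule Mats_eqI[of _ n r])
      fix x a assume "a \<in> Idx n r"
      then show "mmul n r (T z y) g x a = mmul n r g (T z y) x a"
        using left[of a g y x z] right[of g a y x z] gM Lequiv[OF g, of "eunit a y"] y by simp
    qed (use TM gM in auto)
  qed
  then have comm: "mmul n r A (T z y) = mmul n r (T z y) A" if "y \<in> Idx n r" for z y
    using A H(2) that unfolding commutant_def[of n r "commutant n r (alg_gen n r G)"] by blast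
  \<comment> \<open>The units \<open>eunit y y\<close> add up to the identity matrix, so commutation
    of \<open>A\<close> with all blocks gives the relation between \<open>L A\<close> and
    \<open>A L(1)\<close>.\<close>
  have "L (mmul n r A (eunit y y)) = mmul n r A (L (eunit y y))" if "y \<in> Idx n r" for y
    using that AM left right comm by (intro ext) simp
  moreover have one: "mone n r = msum (Idx n r) (\<lambda>y. eunit y y)"
  proof (intro ext)
    fix x y
    have "msum (Idx n r) (\<lambda>y. eunit y y) x y = (\<Sum>z\<in>Idx n r. if z = x then (if x = y then 1 else 0) else 0)"
      unfolding msum_def eunit_def by (rule sum.cong) auto
    then show "mone n r x y = msum (Idx n r) (\<lambda>y. eunit y y) x y" by (simp add: mone_def)
  qed
  ultimately have "L (mmul n r A (mone n r)) = mmul n r A (L (mone n r))"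
    unfolding one mmul_msum_right Lsum[OF finite_Idx] by (intro msum_cong refl) simp
  then have "L A = msmult (of_nat (card U)) A"
    using AM by (simp add: Lone mmul_one_right mmul_msmult_right)
  then have "A = msmult (1 / of_nat (card U)) (L A)" using U by simp
  then show ?thesis using LB unfolding B_def by (metis gen_smult)
qed

section \<open>Inverse generators and the two duality equalities\<close>

context burau_rep
begin

text \<open>\<open>P = v w\<close> annihilates the rank-one part of the generator on both sides:
  \<open>w\<close> kills \<open>a\<^sub>i\<close> because \<open>q * q ^ (i - 1) = q ^ i\<close>,
  and \<open>cvec i\<close> kills \<open>v\<close>.\<close>

lemma burau_in_centr:
  assumes i: "i \<in> {1..<n}"
  shows "burau q1 q2 i \<in> centr"
proof -
  have P: "pmat q = outer (\<lambda>_. 1) (\<lambda>b. q ^ (b - 1))" by (simp add: pmat_def outer_def)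
  have b: "burau q1 q2 i = (\<lambda>a b. q1 * sid a b + q1 * M i i a b)"
    by (simp add: burau_eq algebra_simps fun_eq_iff)
  have "pair n (\<lambda>b. q ^ (b - 1)) (av i)
      = q * (\<Sum>c\<in>{1..n}. basis i c * q ^ (c - 1)) - (\<Sum>c\<in>{1..n}. basis (i + 1) c * q ^ (c - 1))"
    by (simp add: pair_def avec_def algebra_simps sum_subtractf sum_distrib_left)
  also have "\<dots> = q * q ^ (i - 1) - q ^ i"
    using i sum_basis[of i n "\<lambda>c. q ^ (c - 1)"] sum_basis[of "i + 1" n "\<lambda>c. q ^ (c - 1)"] by simp
  also have "\<dots> = 0" using i by (simp flip: power_Suc)
  finally have 1: "pair n (\<lambda>b. q ^ (b - 1)) (av i) = 0" .
  have 2: "pair n (cvec i) (\<lambda>_. 1) = 0" using i by (simp add: pair_cvec)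
  have "smul n (M i i) (pmat q) = (\<lambda>a b. 0)" "smul n (pmat q) (M i i) = (\<lambda>a b. 0)"
    unfolding P smul_outer 1 2 by simp_all
  then show ?thesis
    unfolding centr_def by (simp add: b smul_lincomb_left smul_lincomb_right smul_sid_left smul_sid_right)
qed

lemma bten_eq: "bten n r q1 q2 i = ten n r (\<lambda>_. burau q1 q2 i)"
  by (simp add: bten_def ten_def)

lemma binv_props:
  assumes i: "i \<in> {1..<n}"
  shows "binv n r q1 q2 i \<in> Mats n r"
    "mmul n r (bten n r q1 q2 i) (binv n r q1 q2 i) = mone n r"
    "mmul n r (binv n r q1 q2 i) (bten n r q1 q2 i) = mone n r"
proof -
  \<comment> \<open>With \<open>R = M i i\<close>, the relation
    \<open>R\<^sup>2 = - (1 + q) R\<close> makes \<open>1 + R / q\<close> inverse to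
    \<open>1 + R\<close>. An explicit inverse is needed because \<open>binv\<close> is a definite
    description.\<close>
  define N where "N = (\<lambda>a b. (1 / q1) * sid a b + (1 / (q1 * q)) * M i i a b)"
  define B where "B = ten n r (\<lambda>_. N)"
  have b: "burau q1 q2 i = (\<lambda>a b. q1 * sid a b + q1 * M i i a b)"
    by (simp add: burau_eq algebra_simps fun_eq_iff)
  have MM: "smul n (M i i) (M i i) = (\<lambda>a b. - (1 + q) * M i i a b)"
    unfolding smul_outer using i by (simp add: pair_cvec_avec)
  have 1: "smul n (burau q1 q2 i) N c d = sid c d" "smul n N (burau q1 q2 i) c d = sid c d"
    if "c \<in> {1..n}" "d \<in> {1..n}" for c d
    unfolding N_def b smul_lincomb_left smul_lincomb_right MM
    using that by (simp_all add: smul_sid_left smul_sid_right divide_simps)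
      (simp_all add: algebra_simps)
  have B: "mmul n r (bten n r q1 q2 i) B = mone n r" "mmul n r B (bten n r q1 q2 i) = mone n r"
    unfolding B_def bten_eq ten_mul ten_one[symmetric] by (rule ten_cong, simp add: 1)+
  have BM: "B \<in> Mats n r" by (simp add: B_def)
  have "binv n r q1 q2 i = B"
    unfolding binv_def
  proof (rule the_equality)
    fix C assume C: "C \<in> Mats n r \<and> mmul n r (bten n r q1 q2 i) C = mone n r
        \<and> mmul n r C (bten n r q1 q2 i) = mone n r"
    have "C = mmul n r (mmul n r B (bten n r q1 q2 i)) C"
      using C B by (simp add: mmul_one_left)
    also have "\<dots> = B" using C BM unfolding mmul_assoc by (simp add: mmul_one_right)
    finally show "C = B" .
  qed (use B BM in auto)
  then show "binv n r q1 q2 i \<in> Mats n r"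
    "mmul n r (bten n r q1 q2 i) (binv n r q1 q2 i) = mone n r"
    "mmul n r (binv n r q1 q2 i) (bten n r q1 q2 i) = mone n r"
    using B BM by simp_all
qed

definition gensP :: "tmat set" where
  "gensP = {swap_mat n r i | i. i \<in> {1..<r}} \<union> {proj_mat n r q j | j. j \<in> {1..r}}"

lemma imP_alt: "imPr = alg_gen n r gensP"
  by (simp add: imP_def gensP_def)

lemma gensP_Mats: "gensP \<subseteq> Mats n r"
  unfolding gensP_def by (auto simp: swap_mat_eq proj_mat_eq)

lemma bten_in_commutant:
  assumes i: "i \<in> {1..<n}"
  shows "bten n r q1 q2 i \<in> commutant n r gensP"
  unfolding commutant_def
proof (intro CollectI conjI ballI)
  show BM: "bten n r q1 q2 i \<in> Mats n r" by (simp add: bten_eq)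
  fix S assume "S \<in> gensP"
  then consider k where "k \<in> {1..<r}" "S = swap_mat n r k"
    | j where "j \<in> {1..r}" "S = proj_mat n r q j" unfolding gensP_def by auto
  then show "mmul n r (bten n r q1 q2 i) S = mmul n r S (bten n r q1 q2 i)"
  proof cases
    case 1
    then have tr: "transpose k (k + 1) permutes {1..r}" by (intro permutes_swap_id) auto
    have "act (transpose k (k + 1)) (bten n r q1 q2 i) = bten n r q1 q2 i"
      unfolding bten_eq act_ten[OF tr] by (simp add: comp_def)
    then show ?thesis using perm_mat_mmul_eq_act[OF tr BM] 1 by (simp add: swap_mat_eq)
  next
    case 2
    then show ?thesis
      unfolding 2(2) proj_mat_eq[OF 2(1)] bten_eq ten_mul using burau_in_centr[OF i]
      by (intro ten_cong) (auto simp: centr_def smul_sid_left smul_sid_right)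
  qed
qed

lemma imB_eq: "imBr = commutant n r imPr"
proof
  show "imBr \<subseteq> commutant n r imPr"
    unfolding imP_alt commutant_alg_gen unfolding imB_def
  proof (rule alg_gen_subset_commutant[OF _ gensP_Mats], intro Un_least subsetI)
    fix X assume "X \<in> {bten n r q1 q2 i |i. i \<in> {1..<n}}"
    then show "X \<in> commutant n r gensP" using bten_in_commutant by auto
  next
    fix X assume "X \<in> {binv n r q1 q2 i |i. i \<in> {1..<n}}"
    then show "X \<in> commutant n r gensP"
      using commutant_inverse[OF bten_in_commutant _ gensP_Mats] binv_props by auto
  qed
qed (rule commutant_imP_subset)

lemma perm_mat_in_imP:
  assumes "w permutes {1..r}"
  shows "perm_mat n r w \<in> imPr"
proof -
  have "w permutes {1..r} \<and> perm_mat n r w \<in> imPr"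
  proof (rule transpose_generated[OF _ _ _ assms])
    show "id permutes {1..r} \<and> perm_mat n r id \<in> imPr"
      unfolding perm_mat_id imP_def by (simp add: permutes_id gen_one)
  next
    fix v w assume "v permutes {1..r} \<and> perm_mat n r v \<in> imPr" "w permutes {1..r} \<and> perm_mat n r w \<in> imPr"
    then show "v \<circ> w permutes {1..r} \<and> perm_mat n r (v \<circ> w) \<in> imPr"
      using perm_mat_mult[of w r v n, symmetric] permutes_compose[of w "{1..r}" v]
      unfolding imP_def by (simp only: gen_mul simp_thms)
  next
    fix i assume i: "i \<in> {1..<r}"
    then have "swap_mat n r i \<in> imPr" unfolding imP_def by (intro gen_gen) auto
    then show "transpose i (i + 1) permutes {1..r} \<and> perm_mat n r (transpose i (i + 1)) \<in> imPr"
      using i by (auto simp: swap_mat_eq intro!: permutes_swap_id)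
  qed
  then show ?thesis ..
qed

lemma ten_set_in_imP:
  assumes one: "\<And>j. j \<in> {1..r} \<Longrightarrow> ten n r ((\<lambda>_. sid)(j := X)) \<in> imPr" and J: "J \<subseteq> {1..r}"
  shows "ten n r (\<lambda>k. if k \<in> J then X else sid) \<in> imPr"
  using finite_subset[OF J finite_atLeastAtMost] J
proof (induction J rule: finite_induct)
  case empty
  show ?case by (simp add: ten_one imP_def gen_one)
next
  case (insert j J)
  have "ten n r (\<lambda>k. if k \<in> insert j J then X else sid)
      = mmul n r (ten n r ((\<lambda>_. sid)(j := X))) (ten n r (\<lambda>k. if k \<in> J then X else sid))"
    unfolding ten_mul using insert by (intro ten_cong) (auto simp: smul_sid_left smul_sid_right)
  then show ?case using insert one unfolding imP_def by (auto intro: gen_mul)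
qed

lemma ten_tm_in_imP: "j \<in> {1..r} \<Longrightarrow> ten n r ((\<lambda>_. sid)(j := tm)) \<in> imPr"
proof -
  assume j: "j \<in> {1..r}"
  then have "proj_mat n r q j \<in> imPr" unfolding imP_def by (intro gen_gen) auto
  then show ?thesis unfolding ten_tm_eq[OF j] imP_def by (simp only: gen_add gen_smult gen_one)
qed

definition tset :: "nat set \<Rightarrow> tmat" where
  "tset J = ten n r (\<lambda>k. if k \<in> J then tm else sid)"

lemma tset_in_imP: "J \<subseteq> {1..r} \<Longrightarrow> tset J \<in> imPr"
  unfolding tset_def by (rule ten_set_in_imP) (rule ten_tm_in_imP)

lemma Mats_tset [simp]: "tset J \<in> Mats n r"
  by (simp add: tset_def)

lemma tset_sing: "tset {j} = ten n r ((\<lambda>_. sid)(j := tm))"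
  unfolding tset_def by (rule ten_cong) simp

lemma tset_mult: "mmul n r (tset J) (tset K) = tset (sym_diff J K)"
  unfolding tset_def ten_mul
  by (rule ten_cong) (auto simp: smul_tm_tm smul_sid_left smul_sid_right)

lemma tset_empty: "tset {} = mone n r"
  by (simp add: tset_def ten_one)

text \<open>The semidirect product relation: a sign change at \<open>j\<close> becomes one at
  \<open>w j\<close> when it moves past the permutation.\<close>

lemma tset_perm:
  assumes w: "w permutes {1..r}"
  shows "mmul n r (tset {j}) (perm_mat n r w) = mmul n r (perm_mat n r w) (tset {w j})"
proof -
  have "(\<lambda>k. if k \<in> {j} then tm else sid) \<circ> inv w = (\<lambda>k. if k \<in> {w j} then tm else sid)"
    using permutes_inverses[OF w] by (auto simp: fun_eq_iff)
  then have "act w (tset {j}) = tset {w j}" unfolding tset_def act_ten[OF w] by simp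
  then show ?thesis using perm_mat_mmul_eq_act[OF w, of "tset {j}" n] by simp
qed

text \<open>\<open>imP\<close> is spanned by the image of the hyperoctahedral group, in which the sign change at place \<open>j\<close>
  acts as the reflection \<open>1 - 2 P / [n]\<^sub>q\<close>.\<close>

lemma commutant_imB_eq: "commutant n r imBr = imPr"
proof
  show "imPr \<subseteq> commutant n r imBr"
    using imP_subset_Mats unfolding imB_eq by (auto simp: commutant_def)
  \<comment> \<open>\<open>U\<close> indexes the hyperoctahedral group by a permutation and a set of
    sign changes; \<open>m'\<close> gives the inverse elements.\<close>
  define U where "U = {w. w permutes {1..r}} \<times> Pow {1..r}"
  define m where "m = (\<lambda>(w, J). mmul n r (perm_mat n r w) (tset J))"
  define m' where "m' = (\<lambda>(w, J). mmul n r (tset J) (perm_mat n r (inv w)))"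
  define H where "H = {perm_mat n r w | w. w permutes {1..r}} \<union> {tset {j} | j. j \<in> {1..r}}"
  show "commutant n r imBr \<subseteq> imPr"
  proof
    fix A assume "A \<in> commutant n r imBr"
    then have A: "A \<in> commutant n r (commutant n r (alg_gen n r gensP))"
      by (simp add: imB_eq imP_alt)
    show "A \<in> imPr"
      unfolding imP_alt
    proof (rule double_commutant_of_averaging[of gensP n r U m m' H, OF gensP_Mats _ _ _ _ _ _ _ _ A])
      show "finite U" by (simp add: U_def finite_permutations)
      show "U \<noteq> {}" using permutes_id[of "{1..r}"] unfolding U_def by blast
      show "m u \<in> alg_gen n r gensP" if "u \<in> U" for u
        using that perm_mat_in_imP tset_in_imP
        by (auto simp: U_def m_def imP_alt intro!: gen_mul)
      show "m' u \<in> alg_gen n r gensP" if "u \<in> U" for u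
        using that perm_mat_in_imP[OF permutes_inv] tset_in_imP
        by (auto simp: U_def m'_def imP_alt intro!: gen_mul)
      show "mmul n r (m u) (m' u) = mone n r" if uU: "u \<in> U" for u
      proof -
        obtain w J where u: "u = (w, J)" and w: "w permutes {1..r}" using uU by (auto simp: U_def)
        have "mmul n r (m u) (m' u) = mmul n r (perm_mat n r w)
            (mmul n r (mmul n r (tset J) (tset J)) (perm_mat n r (inv w)))"
          by (simp add: u m_def m'_def mmul_assoc)
        also have "\<dots> = mone n r"
          using permutes_inv_o[OF w]
          by (simp add: tset_mult tset_empty mmul_one_left perm_mat_mult w permutes_inv perm_mat_id)
        finally show ?thesis .
      qed
      show "H \<subseteq> Mats n r" by (auto simp: H_def)
      show "commutant n r H \<subseteq> commutant n r (alg_gen n r gensP)"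
        unfolding commutant_alg_gen
      proof
        fix X assume X: "X \<in> commutant n r H"
        then have XM: "X \<in> Mats n r" by (simp add: commutant_def)
        show "X \<in> commutant n r gensP"
          unfolding commutant_def
        proof (intro CollectI conjI ballI XM)
          fix S assume "S \<in> gensP"
          then consider k where "k \<in> {1..<r}" "S = swap_mat n r k"
            | j where "j \<in> {1..r}" "S = proj_mat n r q j" unfolding gensP_def by auto
          then show "mmul n r X S = mmul n r S X"
          proof cases
            case 1
            then have "S \<in> H"
              by (auto simp: H_def swap_mat_eq intro!: exI permutes_swap_id)
            then show ?thesis using X by (simp add: commutant_def)
          next
            case 2
            \<comment> \<open>The reflection \<open>tm\<close> at place \<open>j\<close> is solved
              for \<open>P\<close> at that place.\<close>
            have "S = msmult (- qint n q / 2) (madd (tset {j}) (msmult (-1) (mone n r)))"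
              unfolding tset_sing ten_tm_eq[OF 2(1)] 2(2) by (simp add: madd_def msmult_def)
            moreover have "tset {j} \<in> H" using 2 by (auto simp: H_def)
            ultimately show ?thesis using X XM
              by (simp add: commutant_def mmul_msmult_left mmul_msmult_right mmul_madd_left
                  mmul_madd_right mmul_one_left mmul_one_right)
          qed
        qed
      qed
      fix g assume "g \<in> H"
      then consider v where "v permutes {1..r}" "g = perm_mat n r v"
        | j where "j \<in> {1..r}" "g = tset {j}" by (auto simp: H_def)
      then show "\<exists>g' \<beta>. mmul n r g' g = mone n r \<and> bij_betw \<beta> U U \<and>
          (\<forall>u\<in>U. m (\<beta> u) = mmul n r g (m u) \<and> m' (\<beta> u) = mmul n r (m' u) g')"
      proof cases
        case 1
        note v = 1(1)
        \<comment> \<open>Left multiplication by \<open>perm_mat n r v\<close> composes with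
          \<open>v\<close> on the right, by the reversed order in
          \<open>perm_mat_mult\<close>.\<close>
        let ?\<beta> = "\<lambda>(w, J). (w \<circ> v, J)"
        show ?thesis
        proof (intro exI conjI ballI)
          show "mmul n r (perm_mat n r (inv v)) g = mone n r"
            using 1 permutes_inv_o[OF v] by (simp add: perm_mat_mult permutes_inv perm_mat_id)
          show "bij_betw ?\<beta> U U"
            by (rule bij_betw_byWitness[where f' = "\<lambda>(w, J). (w \<circ> inv v, J)"])
               (auto simp: U_def comp_assoc permutes_inv_o[OF v] v permutes_compose permutes_inv[OF v])
          fix u assume "u \<in> U"
          then obtain w J where u: "u = (w, J)" and w: "w permutes {1..r}" by (auto simp: U_def)
          show "m (?\<beta> u) = mmul n r g (m u)"
            using v w by (simp add: u m_def 1(2) perm_mat_mult flip: mmul_assoc)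
          have "inv (w \<circ> v) = inv v \<circ> inv w"
            using v w by (simp add: o_inv_distrib permutes_bij)
          then show "m' (?\<beta> u) = mmul n r (m' u) (perm_mat n r (inv v))"
            using v w by (simp add: u m'_def mmul_assoc perm_mat_mult permutes_inv)
        qed
      next
        case 2
        let ?\<beta> = "\<lambda>(w, J). (w, sym_diff J {w j})"
        have "w j \<in> {1..r}" if "w permutes {1..r}" for w
          using that 2(1) by (simp only: permutes_in_image)
        then have wj: "?\<beta> u \<in> U" if "u \<in> U" for u
          using that by (auto simp: U_def)
        show ?thesis
        proof (intro exI conjI ballI)
          show "mmul n r (tset {j}) g = mone n r" unfolding 2(2) by (simp add: tset_mult tset_empty)
          show "bij_betw ?\<beta> U U"
            by (rule bij_betw_byWitness[where f' = ?\<beta>]) (use wj in auto)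
          fix u assume "u \<in> U"
          then obtain w J where u: "u = (w, J)" and w: "w permutes {1..r}" by (auto simp: U_def)
          have "mmul n r g (m u) = mmul n r (mmul n r (tset {j}) (perm_mat n r w)) (tset J)"
            by (simp add: u m_def 2(2) mmul_assoc)
          also have "\<dots> = mmul n r (perm_mat n r w) (tset (sym_diff {w j} J))"
            unfolding tset_perm[OF w] mmul_assoc tset_mult ..
          finally show "m (?\<beta> u) = mmul n r g (m u)" by (simp add: u m_def Un_commute)
          have "mmul n r (tset {w j}) (perm_mat n r (inv w)) = mmul n r (perm_mat n r (inv w)) (tset {j})"
            using tset_perm[OF permutes_inv[OF w], of "w j"] by (simp add: permutes_inverses[OF w])
          then have "mmul n r (m' u) (tset {j}) = mmul n r (mmul n r (tset J) (tset {w j})) (perm_mat n r (inv w))"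
            by (simp add: u m'_def mmul_assoc)
          then show "m' (?\<beta> u) = mmul n r (m' u) (tset {j})" by (simp add: u m'_def tset_mult)
        qed
      qed
    qed
  qed
qed

end

section \<open>The action of partial permutations\<close>

lemma PPermD:
  assumes "d \<in> PPerm r"
  shows "dom d \<subseteq> {1..r}" "ran d \<subseteq> {1..r}" "inj_on d (dom d)" "finite (dom d)" "finite (ran d)"
  using assms by (auto simp: PPerm_def intro: finite_subset[OF _ finite_atLeastAtMost])

lemma PPerm_inj: "d \<in> PPerm r \<Longrightarrow> d k = Some l \<Longrightarrow> d k' = Some l \<Longrightarrow> k = k'"
  by (metis PPermD(3) domI inj_onD)

lemma finite_PPerm [simp]: "finite (PPerm r)"
proof (rule finite_subset)
  show "PPerm r \<subseteq> (\<Union>A\<in>Pow {1..r}. {m. dom m = A \<and> ran m \<subseteq> {1..r}})"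
    by (auto simp: PPerm_def)
  show "finite (\<Union>A\<in>Pow {1..r}. {m :: nat \<rightharpoonup> nat. dom m = A \<and> ran m \<subseteq> {1..r}})"
    by (intro finite_UN_I finite_set_of_finite_maps) (auto intro: finite_subset[OF _ finite_atLeastAtMost])
qed

lemma PPerm_comp:
  assumes "d1 \<in> PPerm r" "d2 \<in> PPerm r"
  shows "d2 \<circ>\<^sub>m d1 \<in> PPerm r"
  unfolding PPerm_def
proof (intro CollectI conjI)
  have "dom (d2 \<circ>\<^sub>m d1) \<subseteq> dom d1" "ran (d2 \<circ>\<^sub>m d1) \<subseteq> ran d2"
    by (auto simp: ran_def map_comp_Some_iff)
  then show "dom (d2 \<circ>\<^sub>m d1) \<subseteq> {1..r}" "ran (d2 \<circ>\<^sub>m d1) \<subseteq> {1..r}"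
    using PPermD[OF assms(1)] PPermD[OF assms(2)] by auto
  show "inj_on (d2 \<circ>\<^sub>m d1) (dom (d2 \<circ>\<^sub>m d1))"
  proof (rule inj_onI)
    fix k k' assume k: "k \<in> dom (d2 \<circ>\<^sub>m d1)" and eq: "(d2 \<circ>\<^sub>m d1) k = (d2 \<circ>\<^sub>m d1) k'"
    from k obtain m where "(d2 \<circ>\<^sub>m d1) k = Some m" by auto
    with eq have "(d2 \<circ>\<^sub>m d1) k' = Some m" by simp
    with \<open>(d2 \<circ>\<^sub>m d1) k = Some m\<close> obtain l l'
      where l: "d1 k = Some l" "d2 l = Some m" "d1 k' = Some l'" "d2 l' = Some m"
      unfolding map_comp_Some_iff by blast
    have "l = l'" by (rule PPerm_inj[OF assms(2) l(2,4)])
    with l show "k = k'" using PPerm_inj[OF assms(1) l(1), of k'] by simp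
  qed
qed

lemma prod_indicator:
  assumes "finite A"
  shows "(\<Prod>k\<in>A. if P k then 1 else 0) = (if \<forall>k\<in>A. P k then 1 else (0::complex))"
proof (cases "\<forall>k\<in>A. P k")
  case False
  then show ?thesis using assms by (auto intro!: prod_zero)
qed simp

lemma prod_if_one:
  assumes "finite A" "B \<subseteq> A"
  shows "(\<Prod>k\<in>A. if k \<in> B then f k else 1) = (\<Prod>k\<in>B. f k :: complex)"
proof -
  have "{k \<in> A. k \<in> B} = B" using assms by auto
  then show ?thesis using prod.inter_filter[OF assms(1), of f "\<lambda>k. k \<in> B"] by simp
qed

lemma Mats_pp_mat [simp]: "pp_mat n r q d \<in> Mats n r"
  by (rule MatsI) (auto simp: pp_mat_def)

text \<open>This form factors over the places of the output \<open>x\<close>, and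
  \<open>pp_mat_eq_range\<close> over those of the input \<open>y\<close>. In a product of two such
  matrices the second form for the left factor and the first for the right one make the sum over the
  middle index factor place by place.\<close>

lemma pp_mat_eq_domain:
  assumes "d \<in> PPerm r" "x \<in> Idx n r" "y \<in> Idx n r"
  shows "pp_mat n r q d x y = (\<Prod>k\<in>{1..r}. if k \<in> dom d then (if x k = y (the (d k)) then 1 else 0) else 1)
     * (\<Prod>l\<in>{1..r} - ran d. q ^ (y l - 1))"
  unfolding prod_if_one[OF finite_atLeastAtMost PPermD(1)[OF assms(1)]]
    prod_indicator[OF PPermD(4)[OF assms(1)]]
  using assms by (simp add: pp_mat_def)

definition pinv :: "(nat \<rightharpoonup> nat) \<Rightarrow> nat \<Rightarrow> nat" where
  "pinv d l = (THE k. d k = Some l)"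

lemma pinv:
  assumes "d \<in> PPerm r"
  shows "d k = Some l \<Longrightarrow> pinv d l = k" and "l \<in> ran d \<Longrightarrow> d (pinv d l) = Some l"
proof -
  show *: "pinv d l = k" if "d k = Some l" for k l
    unfolding pinv_def using that PPerm_inj[OF assms] by (intro the_equality) auto
  show "d (pinv d l) = Some l" if "l \<in> ran d"
    using that * by (auto simp: ran_def)
qed

lemma prod_reindex_dom:
  assumes d: "d \<in> PPerm r"
  shows "(\<Prod>k\<in>dom d. f k (the (d k))) = (\<Prod>l\<in>ran d. f (pinv d l) l :: complex)"
  by (rule prod.reindex_bij_witness[of _ "pinv d" "\<lambda>k. the (d k)"])
     (use pinv[OF d] in \<open>auto intro: ranI\<close>)

lemma pp_mat_eq_range:
  assumes "d \<in> PPerm r" "x \<in> Idx n r" "y \<in> Idx n r"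
  shows "pp_mat n r q d x y = (\<Prod>l\<in>{1..r}. if l \<in> ran d then (if y l = x (pinv d l) then 1 else 0)
     else q ^ (y l - 1))"
proof -
  have "(\<Prod>k\<in>{1..r}. if k \<in> dom d then (if x k = y (the (d k)) then 1 else 0) else 1)
      = (\<Prod>l\<in>ran d. if y l = x (pinv d l) then 1 else (0::complex))"
    unfolding prod_if_one[OF finite_atLeastAtMost PPermD(1)[OF assms(1)]]
      prod_reindex_dom[OF assms(1), of "\<lambda>k l. if x k = y l then 1 else 0"]
    by (intro prod.cong) auto
  moreover have "(\<Prod>l\<in>{1..r}. if l \<in> ran d then (if y l = x (pinv d l) then 1 else 0)
     else q ^ (y l - 1)) = (\<Prod>l\<in>{1..r} - ran d. q ^ (y l - 1))
       * (\<Prod>l\<in>ran d. if y l = x (pinv d l) then 1 else (0::complex))"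
    unfolding prod.subset_diff[OF PPermD(2)[OF assms(1)] finite_atLeastAtMost]
    by simp
  ultimately show ?thesis unfolding pp_mat_eq_domain[OF assms] by simp
qed

text \<open>The sum over the middle multi-index splits over places. A place outside both
  \<open>ran d1\<close> and \<open>dom d2\<close> contributes \<open>w v = qint n q\<close>, which
  produces the power in the product of partial permutations.\<close>

lemma pp_mat_mult:
  assumes d1: "d1 \<in> PPerm r" and d2: "d2 \<in> PPerm r"
  shows "mmul n r (pp_mat n r q d1) (pp_mat n r q d2)
     = msmult (qint n q ^ (r - card (ran d1 \<union> dom d2))) (pp_mat n r q (d2 \<circ>\<^sub>m d1))"
proof (rule Mats_eqI[of _ n r])
  fix x z assume xz: "x \<in> Idx n r" "z \<in> Idx n r"
  define W where "W = (\<Prod>l\<in>{1..r} - ran d2. q ^ (z l - 1))"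
  define F where "F l a = (if l \<in> ran d1 then (if a = x (pinv d1 l) then 1 else 0) else q ^ (a - 1))
     * (if l \<in> dom d2 then (if a = z (the (d2 l)) then 1 else 0) else 1)" for l a
  \<comment> \<open>\<open>g1\<close> joins two strands, \<open>g2\<close> carries the weight of a
    free place of \<open>d1\<close> along a strand of \<open>d2\<close>, and \<open>g3\<close>
    counts the places free on both sides.\<close>
  define g1 where "g1 l = (if l \<in> ran d1 \<inter> dom d2 then (if x (pinv d1 l) = z (the (d2 l)) then 1 else 0)
     else (1::complex))" for l
  define g2 where "g2 l = (if l \<in> dom d2 - ran d1 then q ^ (z (the (d2 l)) - 1) else 1)" for l
  define g3 where "g3 l = (if l \<in> {1..r} - (ran d1 \<union> dom d2) then qint n q else 1)" for l
  have F: "(\<Sum>a\<in>{1..n}. F l a) = g1 l * (g2 l * g3 l)" if l: "l \<in> {1..r}" for l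
  proof -
    have xr: "x (pinv d1 l) \<in> {1..n}" if "l \<in> ran d1"
      using Idx_range[OF xz(1)] PPermD(1)[OF d1] pinv(2)[OF d1 that] by blast
    have zr: "z (the (d2 l)) \<in> {1..n}" if "l \<in> dom d2"
      using Idx_range[OF xz(2), of "the (d2 l)"] PPermD(2)[OF d2] that by (force simp: ran_def)
    have qi: "(\<Sum>c\<in>{1..n}. q ^ (c - 1)) = qint n q"
      unfolding qint_def by (rule sum.reindex_bij_witness[of _ "\<lambda>k. k + 1" "\<lambda>c. c - 1"]) auto
    consider "l \<in> ran d1" "l \<in> dom d2" | "l \<in> ran d1" "l \<notin> dom d2"
      | "l \<notin> ran d1" "l \<in> dom d2" | "l \<notin> ran d1" "l \<notin> dom d2" by blast
    then show ?thesis
    proof cases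
      case 1
      have "(\<Sum>a\<in>{1..n}. F l a)
         = (\<Sum>a\<in>{1..n}. if a = z (the (d2 l)) then (if x (pinv d1 l) = z (the (d2 l)) then 1 else 0) else 0)"
        unfolding F_def using 1 by (intro sum.cong) auto
      then show ?thesis using 1 zr by (simp add: g1_def g2_def g3_def del: atLeastAtMost_iff)
    next
      case 2
      then show ?thesis using xr by (simp add: F_def g1_def g2_def g3_def del: atLeastAtMost_iff)
    next
      case 3
      have "(\<Sum>a\<in>{1..n}. F l a)
         = (\<Sum>a\<in>{1..n}. if a = z (the (d2 l)) then q ^ (z (the (d2 l)) - 1) else 0)"
        unfolding F_def using 3 by (intro sum.cong) auto
      then show ?thesis using 3 zr by (simp add: g1_def g2_def g3_def del: atLeastAtMost_iff)
    next
      case 4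
      then show ?thesis using qi l by (simp add: F_def g1_def g2_def g3_def)
    qed
  qed
  have "mmul n r (pp_mat n r q d1) (pp_mat n r q d2) x z = (\<Sum>y\<in>Idx n r. (\<Prod>l\<in>{1..r}. F l (y l)) * W)"
    unfolding mmul_def
  proof (rule sum.cong)
    fix y assume y: "y \<in> Idx n r"
    show "pp_mat n r q d1 x y * pp_mat n r q d2 y z = (\<Prod>l\<in>{1..r}. F l (y l)) * W"
      unfolding pp_mat_eq_range[OF d1 xz(1) y] pp_mat_eq_domain[OF d2 y xz(2)] W_def F_def
        prod.distrib by simp
  qed simp
  also have "\<dots> = (\<Prod>l\<in>{1..r}. \<Sum>a\<in>{1..n}. F l a) * W"
    unfolding Idx_def by (subst prod_sum_PiE) (auto simp: sum_distrib_right)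
  also have "\<dots> = (\<Prod>l\<in>{1..r}. g1 l) * ((\<Prod>l\<in>{1..r}. g2 l) * (\<Prod>l\<in>{1..r}. g3 l)) * W"
  proof -
    have "(\<Prod>l\<in>{1..r}. \<Sum>a\<in>{1..n}. F l a) = (\<Prod>l\<in>{1..r}. g1 l * (g2 l * g3 l))"
      by (rule prod.cong) (use F in auto)
    then show ?thesis by (simp add: prod.distrib)
  qed
  also have "(\<Prod>l\<in>{1..r}. g3 l) = qint n q ^ (r - card (ran d1 \<union> dom d2))"
  proof -
    have "(\<Prod>l\<in>{1..r}. g3 l) = qint n q ^ card ({1..r} - (ran d1 \<union> dom d2))"
      unfolding g3_def by (subst prod_if_one) auto
    also have "card ({1..r} - (ran d1 \<union> dom d2)) = r - card (ran d1 \<union> dom d2)"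
      using PPermD[OF d1] PPermD[OF d2] by (subst card_Diff_subset) auto
    finally show ?thesis .
  qed
  also have "(\<Prod>l\<in>{1..r}. g1 l)
      = (if \<forall>k\<in>dom (d2 \<circ>\<^sub>m d1). x k = z (the ((d2 \<circ>\<^sub>m d1) k)) then 1 else 0)"
  proof -
    have "(\<forall>l\<in>ran d1 \<inter> dom d2. x (pinv d1 l) = z (the (d2 l)))
        \<longleftrightarrow> (\<forall>k\<in>dom (d2 \<circ>\<^sub>m d1). x k = z (the ((d2 \<circ>\<^sub>m d1) k)))"
    proof (intro iffI ballI)
      fix k assume a: "\<forall>l\<in>ran d1 \<inter> dom d2. x (pinv d1 l) = z (the (d2 l))" and "k \<in> dom (d2 \<circ>\<^sub>m d1)"
      then obtain l m where lm: "d1 k = Some l" "d2 l = Some m" by (auto simp: map_comp_Some_iff)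
      have "l \<in> ran d1 \<inter> dom d2" using lm by (auto intro: ranI)
      then have "x (pinv d1 l) = z (the (d2 l))" by (rule a[rule_format])
      then show "x k = z (the ((d2 \<circ>\<^sub>m d1) k))" using pinv(1)[OF d1 lm(1)] lm by simp
    next
      fix l assume a: "\<forall>k\<in>dom (d2 \<circ>\<^sub>m d1). x k = z (the ((d2 \<circ>\<^sub>m d1) k))" and l: "l \<in> ran d1 \<inter> dom d2"
      then have "d1 (pinv d1 l) = Some l" using pinv(2)[OF d1] by auto
      with l have "(d2 \<circ>\<^sub>m d1) (pinv d1 l) = d2 l" by simp
      with a l show "x (pinv d1 l) = z (the (d2 l))" by force
    qed
    moreover have "ran d1 \<inter> dom d2 \<subseteq> {1..r}" using PPermD[OF d1] by auto
    ultimately show ?thesis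
      unfolding g1_def using PPermD(5)[OF d1]
      by (subst prod_if_one) (simp_all add: prod_indicator)
  qed
  \<comment> \<open>A strand of \<open>d2\<close> that starts at a free place of \<open>d1\<close>
    ends at a place that becomes free in the composite; reindexing along \<open>d2\<close> puts the
    weight there.\<close>
  also have "(\<Prod>l\<in>{1..r}. g2 l) = (\<Prod>l\<in>ran d2 - ran (d2 \<circ>\<^sub>m d1). q ^ (z l - 1))"
  proof -
    have "(\<Prod>l\<in>{1..r}. g2 l) = (\<Prod>l\<in>dom d2 - ran d1. q ^ (z (the (d2 l)) - 1))"
      unfolding g2_def using PPermD[OF d2] by (subst prod_if_one) auto
    also have "\<dots> = (\<Prod>l\<in>ran d2 - ran (d2 \<circ>\<^sub>m d1). q ^ (z l - 1))"
    proof (rule prod.reindex_bij_witness[of _ "pinv d2" "\<lambda>l. the (d2 l)"])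
      fix l assume l: "l \<in> dom d2 - ran d1"
      then obtain m where m: "d2 l = Some m" by auto
      then show "pinv d2 (the (d2 l)) = l" using pinv(1)[OF d2] by simp
      have "m \<notin> ran (d2 \<circ>\<^sub>m d1)"
      proof
        assume "m \<in> ran (d2 \<circ>\<^sub>m d1)"
        then obtain k l' where "d1 k = Some l'" "d2 l' = Some m"
          by (auto simp: ran_def map_comp_Some_iff)
        then show False using l PPerm_inj[OF d2 m, of l'] by (auto intro: ranI)
      qed
      then show "the (d2 l) \<in> ran d2 - ran (d2 \<circ>\<^sub>m d1)" using m by (auto intro: ranI)
    next
      fix m assume m: "m \<in> ran d2 - ran (d2 \<circ>\<^sub>m d1)"
      then have *: "d2 (pinv d2 m) = Some m" using pinv(2)[OF d2] by simp
      then show "the (d2 (pinv d2 m)) = m" by simp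
      have "pinv d2 m \<notin> ran d1"
      proof
        assume "pinv d2 m \<in> ran d1"
        then obtain k where "d1 k = Some (pinv d2 m)" by (auto simp: ran_def)
        then have "(d2 \<circ>\<^sub>m d1) k = Some m" using * by simp
        then show False using m by (auto intro: ranI)
      qed
      then show "pinv d2 m \<in> dom d2 - ran d1" using * by auto
    qed simp
    finally show ?thesis .
  qed
  finally have eq: "mmul n r (pp_mat n r q d1) (pp_mat n r q d2) x z
     = (if \<forall>k\<in>dom (d2 \<circ>\<^sub>m d1). x k = z (the ((d2 \<circ>\<^sub>m d1) k)) then 1 else 0) *
       ((\<Prod>l\<in>ran d2 - ran (d2 \<circ>\<^sub>m d1). q ^ (z l - 1)) * qint n q ^ (r - card (ran d1 \<union> dom d2))) * W" .
  have "ran (d2 \<circ>\<^sub>m d1) \<subseteq> ran d2" by (auto simp: ran_def map_comp_Some_iff)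
  then have "{1..r} - ran (d2 \<circ>\<^sub>m d1) = (ran d2 - ran (d2 \<circ>\<^sub>m d1)) \<union> ({1..r} - ran d2)"
    using PPermD[OF d2] by auto
  then have "(\<Prod>l\<in>{1..r} - ran (d2 \<circ>\<^sub>m d1). q ^ (z l - 1))
      = (\<Prod>l\<in>ran d2 - ran (d2 \<circ>\<^sub>m d1). q ^ (z l - 1)) * W"
    unfolding W_def using PPermD[OF d2] by (simp add: prod.union_disjoint Diff_Int_distrib2 disjoint_iff)
  then show "mmul n r (pp_mat n r q d1) (pp_mat n r q d2) x z
     = msmult (qint n q ^ (r - card (ran d1 \<union> dom d2))) (pp_mat n r q (d2 \<circ>\<^sub>m d1)) x z"
    unfolding eq using xz by (simp add: msmult_def pp_mat_def)
qed auto

lemma pact_eq: "pact n r q c = msum (PPerm r) (\<lambda>d. msmult (c d) (pp_mat n r q d))"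
  by (simp add: pact_def msum_def msmult_def)

lemma pact_mult: "pact n r q (pmul r (qint n q) c c') = mmul n r (pact n r q c) (pact n r q c')"
proof (intro ext)
  fix x y
  define h where "h p = c (fst p) * c' (snd p) * qint n q ^ (r - card (ran (fst p) \<union> dom (snd p)))
     * pp_mat n r q (snd p \<circ>\<^sub>m fst p) x y" for p
  have "mmul n r (pact n r q c) (pact n r q c') x y
    = (\<Sum>d1\<in>PPerm r. \<Sum>d2\<in>PPerm r. c d1 * (c' d2 * mmul n r (pp_mat n r q d1) (pp_mat n r q d2) x y))"
    unfolding pact_eq mmul_msum_left mmul_msum_right mmul_msmult_left mmul_msmult_right
    by (simp add: msum_def msmult_def sum_distrib_left)
      (subst sum.swap, simp add: mult.left_commute)
  also have "\<dots> = (\<Sum>d1\<in>PPerm r. \<Sum>d2\<in>PPerm r. h (d1, d2))"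
    by (intro sum.cong refl) (simp add: pp_mat_mult h_def msmult_def)
  also have "\<dots> = (\<Sum>p\<in>PPerm r \<times> PPerm r. h p)" by (simp add: sum.cartesian_product)
  also have "\<dots> = (\<Sum>d\<in>PPerm r. \<Sum>p\<in>{p \<in> PPerm r \<times> PPerm r. snd p \<circ>\<^sub>m fst p = d}. h p)"
    by (rule sum.group[symmetric]) (auto intro: PPerm_comp)
  also have "\<dots> = pact n r q (pmul r (qint n q) c c') x y"
    unfolding pact_def pmul_def sum_distrib_right h_def by (intro sum.cong refl) auto
  finally show "pact n r q (pmul r (qint n q) c c') x y = mmul n r (pact n r q c) (pact n r q c') x y" ..
qed

section \<open>Partial permutations in terms of the generators\<close>

definition pmap :: "nat set \<Rightarrow> (nat \<Rightarrow> nat) \<Rightarrow> nat \<rightharpoonup> nat" where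
  "pmap S w = (\<lambda>k. if k \<in> S then Some (w k) else None)"

lemma dom_ran_pmap [simp]: "dom (pmap S w) = S" "ran (pmap S w) = w ` S"
  by (auto simp: pmap_def ran_def dom_def)

lemma pmap_in_PPerm:
  assumes "S \<subseteq> {1..r}" "w permutes {1..r}"
  shows "pmap S w \<in> PPerm r"
proof -
  have "w ` S \<subseteq> {1..r}" using assms permutes_image[OF assms(2)] by blast
  moreover have "inj_on (pmap S w) S"
    using permutes_inj[OF assms(2)] by (auto simp: pmap_def inj_on_def inj_def)
  ultimately show ?thesis using assms by (simp add: PPerm_def)
qed

lemma pp_mat_perm:
  assumes w: "w permutes {1..r}"
  shows "pp_mat n r q (pmap {1..r} w) = perm_mat n r w"
proof (rule Mats_eqI[of _ n r])
  fix x y assume xy: "x \<in> Idx n r" "y \<in> Idx n r"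
  have "(\<forall>k\<in>{1..r}. x k = y (w k)) \<longleftrightarrow> x = y \<circ> w"
  proof
    assume "\<forall>k\<in>{1..r}. x k = y (w k)"
    then show "x = y \<circ> w"
      using xy Idx_comp_permutes[OF w] by (intro Idx_eqI[of _ n r]) auto
  qed auto
  then show "pp_mat n r q (pmap {1..r} w) x y = perm_mat n r w x y"
    using xy permutes_image[OF w] by (simp add: pp_mat_def perm_mat_def) (simp add: pmap_def)
qed auto

lemma pp_mat_proj:
  assumes "j \<in> {1..r}"
  shows "pp_mat n r q (pmap ({1..r} - {j}) id) = proj_mat n r q j"
proof -
  have "{1..r} - id ` ({1..r} - {j}) = {j}" using assms by auto
  then show ?thesis
    unfolding pp_mat_def proj_mat_def dom_ran_pmap by (intro ext) (auto simp: pmap_def)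
qed

lemma PPerm_extend:
  assumes d: "d \<in> PPerm r"
  obtains w where "w permutes {1..r}" "\<And>k. k \<in> dom d \<Longrightarrow> d k = Some (w k)"
proof -
  have bd: "bij_betw (\<lambda>k. the (d k)) (dom d) (ran d)"
    by (rule bij_betw_byWitness[where f' = "pinv d"]) (use pinv[OF d] in \<open>auto intro: ranI\<close>)
  have "card ({1..r} - dom d) = card ({1..r} - ran d)"
    using PPermD[OF d] bij_betw_same_card[OF bd] by (simp add: card_Diff_subset)
  then obtain g where g: "bij_betw g ({1..r} - dom d) ({1..r} - ran d)"
    using finite_same_card_bij by (metis finite_Diff finite_atLeastAtMost)
  define w where "w k = (if k \<in> dom d then the (d k) else if k \<in> {1..r} then g k else k)" for k
  have "bij_betw w (dom d) (ran d)"
    using bd by (rule bij_betw_cong[THEN iffD1, rotated]) (simp add: w_def)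
  moreover have "bij_betw w ({1..r} - dom d) ({1..r} - ran d)"
    using g by (rule bij_betw_cong[THEN iffD1, rotated]) (simp add: w_def)
  ultimately have "bij_betw w (dom d \<union> ({1..r} - dom d)) (ran d \<union> ({1..r} - ran d))"
    by (rule bij_betw_combine) auto
  moreover have "dom d \<union> ({1..r} - dom d) = {1..r}" "ran d \<union> ({1..r} - ran d) = {1..r}"
    using PPermD[OF d] by auto
  ultimately have "bij_betw w {1..r} {1..r}" by simp
  moreover have "w k = k" if "k \<notin> {1..r}" for k
    using that PPermD(1)[OF d] unfolding w_def by (metis subsetD)
  ultimately have "w permutes {1..r}" by (rule bij_imp_permutes)
  moreover have "d k = Some (w k)" if "k \<in> dom d" for k
    using that by (auto simp: w_def)
  ultimately show ?thesis by (rule that)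
qed

lemma pmul_in_PAlg: "pmul r z c c' \<in> PAlg r"
  unfolding PAlg_def pmul_def using PPerm_comp by (auto intro!: sum.neutral)

lemma pact_single: "d \<in> PPerm r \<Longrightarrow> pact n r q (\<lambda>d'. if d' = d then 1 else 0) = pp_mat n r q d"
proof -
  assume d: "d \<in> PPerm r"
  have "(\<Sum>d'\<in>PPerm r. (if d' = d then 1 else 0) * pp_mat n r q d' x y)
      = (\<Sum>d'\<in>PPerm r. if d' = d then pp_mat n r q d x y else 0)" for x y
    by (rule sum.cong) auto
  then have "(\<Sum>d'\<in>PPerm r. (if d' = d then 1 else 0) * pp_mat n r q d' x y) = pp_mat n r q d x y" for x y
    using d by (simp only: sum.delta finite_PPerm if_True)
  then show ?thesis unfolding pact_def by (intro ext)
qed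

lemma pact_punit: "pact n r q (punit r) = mone n r"
proof -
  have "punit r = (\<lambda>d. if d = pmap {1..r} id then 1 else 0)"
    by (simp add: punit_def pmap_def id_def)
  then show ?thesis
    using pact_single[OF pmap_in_PPerm[OF order.refl permutes_id]]
    by (simp add: pp_mat_perm permutes_id perm_mat_id)
qed

context burau_rep
begin

text \<open>Extend \<open>d\<close> to a permutation and multiply by \<open>P\<close> at the places
  outside \<open>ran d\<close>. As all rows of \<open>P\<close> are equal, the values of the
  extension off \<open>dom d\<close> are immaterial.\<close>

lemma pp_mat_in_imP:
  assumes d: "d \<in> PPerm r"
  shows "pp_mat n r q d \<in> imPr"
proof -
  obtain w where w: "w permutes {1..r}" and dw: "\<And>k. k \<in> dom d \<Longrightarrow> d k = Some (w k)"
    by (rule PPerm_extend[OF d]) (rule that)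
  define J where "J = {1..r} - ran d"
  have "pp_mat n r q d = mmul n r (perm_mat n r w) (ten n r (\<lambda>l. if l \<in> J then pmat q else sid))"
    unfolding perm_mat_mmul_left[OF w Mats_ten]
  proof (intro ext)
    fix x y
    have pi: "pinv d l = inv w l" if l: "l \<in> ran d" for l
    proof -
      have "d (pinv d l) = Some l" by (rule pinv(2)[OF d l])
      then have "w (pinv d l) = l" using dw[of "pinv d l"] by (simp add: domI)
      then show ?thesis using permutes_inverses(2)[OF w] by metis
    qed
    show "pp_mat n r q d x y = ten n r (\<lambda>l. if l \<in> J then pmat q else sid) (x \<circ> inv w) y"
    proof (cases "x \<in> Idx n r \<and> y \<in> Idx n r")
      case True
      then have xy: "x \<in> Idx n r" "y \<in> Idx n r" by auto
      show ?thesis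
        unfolding pp_mat_eq_range[OF d xy] ten_def Idx_comp_permutes[OF permutes_inv[OF w]]
        using True by (auto simp: J_def pmat_def sid_def pi intro!: prod.cong)
    next
      case False
      then show ?thesis
        unfolding ten_def Idx_comp_permutes[OF permutes_inv[OF w]] by (auto simp: pp_mat_def)
    qed
  qed
  moreover have "ten n r (\<lambda>l. if l \<in> J then pmat q else sid) \<in> imPr"
  proof (rule ten_set_in_imP)
    show "ten n r ((\<lambda>_. sid)(j := pmat q)) \<in> imPr" if "j \<in> {1..r}" for j
      unfolding proj_mat_eq[OF that, symmetric] imP_def using that by (intro gen_gen) auto
  qed (simp add: J_def)
  ultimately show ?thesis using perm_mat_in_imP[OF w] by (simp add: imP_def gen_mul)
qed

lemma pact_image: "pact n r q ` PAlg r = imPr"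
proof (intro equalityI subsetI)
  fix A assume "A \<in> pact n r q ` PAlg r"
  then show "A \<in> imPr"
    using pp_mat_in_imP unfolding imP_def by (auto simp: pact_eq intro!: alg_gen_msum gen_smult)
next
  have single: "pp_mat n r q d \<in> pact n r q ` PAlg r" if "d \<in> PPerm r" for d
    unfolding pact_single[OF that, symmetric] using that by (intro imageI) (auto simp: PAlg_def)
  fix A assume "A \<in> imPr"
  then have "A \<in> alg_gen n r gensP" by (simp add: imP_alt)
  then show "A \<in> pact n r q ` PAlg r"
  proof induction
    case gen_one
    show ?case
      using single[OF pmap_in_PPerm[OF order.refl permutes_id]]
      by (simp add: pp_mat_perm permutes_id perm_mat_id)
  next
    case (gen_gen g)
    then consider k where "k \<in> {1..<r}" "g = swap_mat n r k"
      | j where "j \<in> {1..r}" "g = proj_mat n r q j" unfolding gensP_def by auto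
    then show ?case
    proof cases
      case 1
      then have tr: "transpose k (k + 1) permutes {1..r}" by (intro permutes_swap_id) auto
      show ?thesis
        using single[OF pmap_in_PPerm[OF order.refl tr]]
        by (simp add: 1(2) swap_mat_eq[OF 1(1)] pp_mat_perm[OF tr])
    next
      case 2
      then show ?thesis
        using single[OF pmap_in_PPerm[OF Diff_subset permutes_id, of r "{j}"]]
        by (simp add: pp_mat_proj)
    qed
  next
    case (gen_mul A B)
    then obtain c c' where "A = pact n r q c" "B = pact n r q c'" by auto
    then have "mmul n r A B = pact n r q (pmul r (qint n q) c c')" by (simp add: pact_mult)
    then show ?case using pmul_in_PAlg by blast
  next
    case (gen_add A B)
    then obtain c c' where c: "A = pact n r q c" "B = pact n r q c'" "c \<in> PAlg r" "c' \<in> PAlg r" by auto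
    then have "madd A B = pact n r q (\<lambda>d. c d + c' d)"
      by (simp add: pact_def madd_def sum.distrib algebra_simps)
    then show ?case using c by (auto simp: PAlg_def)
  next
    case (gen_smult A a)
    then obtain c where c: "A = pact n r q c" "c \<in> PAlg r" by auto
    then have "msmult a A = pact n r q (\<lambda>d. a * c d)"
      by (simp add: pact_def msmult_def sum_distrib_left mult.assoc)
    then show ?case using c by (auto simp: PAlg_def)
  qed
qed

end

section \<open>Faithfulness\<close>

text \<open>The determinant of a product through a space of dimension \<open>card B\<close>,
  expanded over maps \<open>f\<close> from \<open>A\<close> to \<open>B\<close>. No such
  \<open>f\<close> is injective, and composing \<open>p\<close> with a transposition of two points
  identified by \<open>f\<close> flips the sign but preserves the product.\<close>

lemma alternating_sum_low_rank:
  fixes R S :: "'a \<Rightarrow> 'b \<Rightarrow> complex"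
  assumes A: "finite A" and B: "finite B" and card: "card B < card A"
  shows "(\<Sum>p | p permutes A. of_int (sign p) * (\<Prod>k\<in>A. \<Sum>a\<in>B. R k a * S (p k) a)) = 0"
proof -
  have vanish: "(\<Sum>p | p permutes A. of_int (sign p) * (\<Prod>k\<in>A. S (p k) (f k))) = 0"
    (is "?s = 0") if f: "f \<in> PiE A (\<lambda>_. B)" for f
  proof -
    have "\<not> inj_on f A"
      using card_inj_on_le[of f A B] f B card by auto
    then obtain a b where ab: "a \<in> A" "b \<in> A" "a \<noteq> b" "f a = f b" by (auto simp: inj_on_def)
    have tr: "transpose a b permutes A" using ab by (intro permutes_swap_id)
    have ft: "f (transpose a b k) = f k" for k using ab by (auto simp: transpose_def)
    have "?s = (\<Sum>p | p permutes A. of_int (sign (p \<circ> transpose a b))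
        * (\<Prod>k\<in>A. S ((p \<circ> transpose a b) k) (f k)))"
      by (rule sum_permutations_compose_right[OF tr])
    also have "\<dots> = (\<Sum>p | p permutes A. - (of_int (sign p) * (\<Prod>k\<in>A. S (p k) (f k))))"
    proof (rule sum.cong)
      fix p assume "p \<in> {p. p permutes A}"
      then have p: "permutation p" using A by (auto simp: permutation_permutes)
      have "sign (p \<circ> transpose a b) = - sign p"
        using ab by (simp add: sign_compose[OF p permutation_swap_id] sign_swap_id)
      moreover have "(\<Prod>k\<in>A. S ((p \<circ> transpose a b) k) (f k)) = (\<Prod>k\<in>A. S (p k) (f k))"
        using prod.reindex_bij_betw[OF permutes_imp_bij[OF tr], of "\<lambda>k. S (p k) (f k)"]
        by (simp add: ft)
      ultimately show "of_int (sign (p \<circ> transpose a b)) * (\<Prod>k\<in>A. S ((p \<circ> transpose a b) k) (f k))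
         = - (of_int (sign p) * (\<Prod>k\<in>A. S (p k) (f k)))" by simp
    qed simp
    also have "\<dots> = - ?s" by (simp add: sum_negf)
    finally show ?thesis by simp
  qed
  have "(\<Sum>p | p permutes A. of_int (sign p) * (\<Prod>k\<in>A. \<Sum>a\<in>B. R k a * S (p k) a))
     = (\<Sum>p | p permutes A. \<Sum>f\<in>PiE A (\<lambda>_. B).
         (\<Prod>k\<in>A. R k (f k)) * (of_int (sign p) * (\<Prod>k\<in>A. S (p k) (f k))))"
    unfolding prod_sum_PiE[OF A B] by (simp add: prod.distrib sum_distrib_left algebra_simps)
  also have "\<dots> = (\<Sum>f\<in>PiE A (\<lambda>_. B). (\<Prod>k\<in>A. R k (f k)) *
      (\<Sum>p | p permutes A. of_int (sign p) * (\<Prod>k\<in>A. S (p k) (f k))))"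
    by (subst sum.swap) (simp add: sum_distrib_left)
  also have "\<dots> = 0" using vanish by (intro sum.neutral) auto
  finally show ?thesis .
qed

text \<open>Pairing with pure tensors factors along the diagram: a free place of the domain
  evaluates \<open>\<xi> k\<close> on \<open>v\<close>, a free place of the range evaluates
  \<open>w\<close> on \<open>u l\<close>, and a strand pairs the covector and the vector at its
  ends.\<close>

lemma pp_mat_functional:
  assumes d: "d \<in> PPerm r"
  shows "(\<Sum>x\<in>Idx n r. \<Sum>y\<in>Idx n r. (\<Prod>k\<in>{1..r}. \<xi> k (x k)) * pp_mat n r q d x y * (\<Prod>l\<in>{1..r}. u l (y l)))
    = (\<Prod>k\<in>{1..r} - dom d. \<Sum>a\<in>{1..n}. \<xi> k a) *
      (\<Prod>l\<in>{1..r}. \<Sum>a\<in>{1..n}. (if l \<in> ran d then \<xi> (pinv d l) a else q ^ (a - 1)) * u l a)"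
proof -
  define S where "S = (\<Prod>k\<in>{1..r} - dom d. \<Sum>a\<in>{1..n}. \<xi> k a)"
  have "(\<Sum>x\<in>Idx n r. (\<Prod>k\<in>{1..r}. \<xi> k (x k)) * pp_mat n r q d x y)
      = S * (\<Prod>l\<in>{1..r}. if l \<in> ran d then \<xi> (pinv d l) (y l) else q ^ (y l - 1))"
    if y: "y \<in> Idx n r" for y
  proof -
    define W where "W = (\<Prod>l\<in>{1..r} - ran d. q ^ (y l - 1))"
    define D where "D k a = (if k \<in> dom d then (if a = y (the (d k)) then 1 else 0) else (1::complex))" for k a
    have "(\<Sum>x\<in>Idx n r. (\<Prod>k\<in>{1..r}. \<xi> k (x k)) * pp_mat n r q d x y)
       = (\<Sum>x\<in>Idx n r. (\<Prod>k\<in>{1..r}. \<xi> k (x k) * D k (x k))) * W"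
      unfolding sum_distrib_right using y
      by (intro sum.cong refl) (simp add: pp_mat_eq_domain[OF d] D_def W_def prod.distrib)
    also have "(\<Sum>x\<in>Idx n r. (\<Prod>k\<in>{1..r}. \<xi> k (x k) * D k (x k)))
       = (\<Prod>k\<in>{1..r}. \<Sum>a\<in>{1..n}. \<xi> k a * D k a)"
      unfolding Idx_def by (rule prod_sum_PiE[symmetric]) auto
    also have "\<dots> = S * (\<Prod>k\<in>dom d. \<Sum>a\<in>{1..n}. \<xi> k a * D k a)"
      unfolding prod.subset_diff[OF PPermD(1)[OF d] finite_atLeastAtMost]
      by (simp add: S_def D_def)
    also have "(\<Prod>k\<in>dom d. \<Sum>a\<in>{1..n}. \<xi> k a * D k a) = (\<Prod>k\<in>dom d. \<xi> k (y (the (d k))))"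
    proof (rule prod.cong)
      fix k assume k: "k \<in> dom d"
      then have "the (d k) \<in> {1..r}" using PPermD(2)[OF d] by (force simp: ran_def)
      then have "y (the (d k)) \<in> {1..n}" using y Idx_range by blast
      moreover have "(\<Sum>a\<in>{1..n}. \<xi> k a * D k a)
          = (\<Sum>a\<in>{1..n}. if a = y (the (d k)) then \<xi> k (y (the (d k))) else 0)"
        using k by (intro sum.cong) (auto simp: D_def)
      ultimately show "(\<Sum>a\<in>{1..n}. \<xi> k a * D k a) = \<xi> k (y (the (d k)))"
        by (simp del: atLeastAtMost_iff)
    qed simp
    also have "\<dots> = (\<Prod>l\<in>ran d. \<xi> (pinv d l) (y l))"
      by (rule prod_reindex_dom[OF d, of "\<lambda>k l. \<xi> k (y l)"])
    finally show ?thesis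
      unfolding prod.subset_diff[OF PPermD(2)[OF d] finite_atLeastAtMost, of "\<lambda>l. if l \<in> ran d then _ l else _ l"]
      by (simp add: W_def)
  qed
  then have "(\<Sum>y\<in>Idx n r. (\<Sum>x\<in>Idx n r. (\<Prod>k\<in>{1..r}. \<xi> k (x k)) * pp_mat n r q d x y) * (\<Prod>l\<in>{1..r}. u l (y l)))
    = S * (\<Sum>y\<in>Idx n r. \<Prod>l\<in>{1..r}. (if l \<in> ran d then \<xi> (pinv d l) (y l) else q ^ (y l - 1)) * u l (y l))"
    by (simp add: prod.distrib sum_distrib_left mult.assoc)
  also have "(\<Sum>y\<in>Idx n r. \<Prod>l\<in>{1..r}. (if l \<in> ran d then \<xi> (pinv d l) (y l) else q ^ (y l - 1)) * u l (y l))
    = (\<Prod>l\<in>{1..r}. \<Sum>a\<in>{1..n}. (if l \<in> ran d then \<xi> (pinv d l) a else q ^ (a - 1)) * u l a)"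
    unfolding Idx_def by (rule prod_sum_PiE[symmetric]) auto
  finally show ?thesis
    unfolding S_def by (subst sum.swap) (simp add: sum_distrib_right)
qed

context burau_rep
begin

lemma weight_basis: "j \<in> {1..n} \<Longrightarrow> (\<Sum>a\<in>{1..n}. q ^ (a - 1) * basis j a) = q ^ (j - 1)"
  using sum_basis[of j n "\<lambda>a. q ^ (a - 1)"] by (simp add: mult.commute)

text \<open>For \<open>d\<^sub>0\<close> of maximal rank with nonzero coefficient, test against covectors vanishing on \<open>v\<close> at the
  places of \<open>dom d\<^sub>0\<close> and dual vectors of \<open>ker w\<close> at those of \<open>ran d\<^sub>0\<close>; all other
  diagrams in the support are killed.\<close>

lemma pact_eq_0_imp:
  assumes nr: "n > r" and c: "c \<in> PAlg r" and zero: "\<And>x y. pact n r q c x y = 0"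
  shows "c d = 0"
proof (rule ccontr)
  assume "c d \<noteq> 0"
  define Su where "Su = {d. c d \<noteq> 0}"
  have SuP: "Su \<subseteq> PPerm r" using c by (auto simp: Su_def PAlg_def)
  have Su: "finite Su" "Su \<noteq> {}" using SuP finite_subset[OF SuP] \<open>c d \<noteq> 0\<close> by (auto simp: Su_def)
  then have "Max ((\<lambda>d. card (dom d)) ` Su) \<in> (\<lambda>d. card (dom d)) ` Su" by (intro Max_in) auto
  then obtain d0 where d0: "d0 \<in> Su" and Max: "Max ((\<lambda>d. card (dom d)) ` Su) = card (dom d0)"
    by blast
  have max: "card (dom d) \<le> card (dom d0)" if "d \<in> Su" for d
    unfolding Max[symmetric] using Su that by simp
  have d0P: "d0 \<in> PPerm r" using d0 SuP by auto
  \<comment> \<open>\<open>\<eta> j\<close> is a coordinate covector corrected by a multiple of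
    \<open>w\<close> to vanish on \<open>v\<close>. Indices are shifted by one because
    \<open>basis 1\<close> is the correction term in \<open>u\<close>; this uses
    \<open>r + 1 \<le> n\<close>. At free places \<open>basis 1\<close> pairs to \<open>1\<close>
    with both \<open>v\<close> and \<open>w\<close>.\<close>
  define \<eta> where "\<eta> j = (\<lambda>a. basis (j + 1) a - q ^ (a - 1) / qint n q)" for j
  define \<xi> where "\<xi> k = (if k \<in> dom d0 then \<eta> (the (d0 k)) else basis 1)" for k
  define u where "u l = (if l \<in> ran d0 then (\<lambda>a. basis (l + 1) a - q ^ l * basis 1 a) else basis 1)" for l
  define \<Phi> where "\<Phi> d = (\<Prod>k\<in>{1..r} - dom d. \<Sum>a\<in>{1..n}. \<xi> k a) *
      (\<Prod>l\<in>{1..r}. \<Sum>a\<in>{1..n}. (if l \<in> ran d then \<xi> (pinv d l) a else q ^ (a - 1)) * u l a)" for d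
  have one: "1 \<in> {1..n}" using n2 by auto
  have sb: "(\<Sum>a\<in>{1..n}. basis j a) = 1" if "j \<in> {1..n}" for j
    using sum_basis[OF that, of "\<lambda>_. 1"] by simp
  have xi0: "(\<Sum>a\<in>{1..n}. \<xi> k a) = 0" if "k \<in> dom d0" for k
  proof -
    have "the (d0 k) \<in> {1..r}" using that PPermD(2)[OF d0P] by (force simp: ran_def)
    then have "the (d0 k) + 1 \<in> {1..n}" using nr by auto
    then show ?thesis
      using that by (simp add: \<xi>_def \<eta>_def sum_subtractf sb qint_eq flip: sum_divide_distrib)
  qed
  have u0: "(\<Sum>a\<in>{1..n}. q ^ (a - 1) * u l a) = 0" if l: "l \<in> ran d0" for l
  proof -
    have "l + 1 \<in> {1..n}" using l PPermD(2)[OF d0P] nr by auto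
    then show ?thesis
      using l one weight_basis[of "l + 1"] weight_basis[of 1]
      by (simp add: u_def right_diff_distrib sum_subtractf mult.left_commute[of _ "q ^ l"]
          flip: sum_distrib_left)
  qed
  have dual: "(\<Sum>a\<in>{1..n}. \<eta> j a * u l a) = (if j = l then 1 else 0)"
    if j: "j \<in> {1..r}" and l: "l \<in> ran d0" for j l
  proof -
    have "(\<Sum>a\<in>{1..n}. \<eta> j a * u l a) = (\<Sum>a\<in>{1..n}. basis (j + 1) a * u l a)
        - (\<Sum>a\<in>{1..n}. q ^ (a - 1) * u l a) / qint n q"
      by (simp add: \<eta>_def left_diff_distrib sum_subtractf sum_divide_distrib)
    also have "\<dots> = u l (j + 1)"
      using u0[OF l] sum_basis[of "j + 1" n "u l"] j nr by simp
    also have "\<dots> = (if j = l then 1 else 0)" using l j by (auto simp: u_def basis_def)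
    finally show ?thesis .
  qed
  have \<Phi>: "\<Phi> d = (if d = d0 then 1 else 0)" if d: "d \<in> Su" for d
  proof (cases "d = d0")
    case True
    have "(\<Sum>a\<in>{1..n}. \<xi> k a) = 1" if "k \<in> {1..r} - dom d0" for k
      using that sb[OF one] by (simp add: \<xi>_def)
    moreover have "(\<Sum>a\<in>{1..n}. (if l \<in> ran d0 then \<xi> (pinv d0 l) a else q ^ (a - 1)) * u l a) = 1"
      if l: "l \<in> {1..r}" for l
    proof (cases "l \<in> ran d0")
      case True
      then have "d0 (pinv d0 l) = Some l" by (rule pinv(2)[OF d0P])
      then show ?thesis using True dual[OF l True] by (simp add: \<xi>_def domI)
    next
      case False
      then show ?thesis using weight_basis[OF one] by (simp add: u_def)
    qed
    ultimately show ?thesis unfolding \<Phi>_def True by simp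
  next
    case False
    have dP: "d \<in> PPerm r" using d SuP by auto
    have "\<Phi> d = 0"
    proof (rule ccontr)
      assume nz: "\<Phi> d \<noteq> 0"
      \<comment> \<open>A place of \<open>dom d0\<close> outside \<open>dom d\<close> would
        contribute the value of \<open>\<xi>\<close> on \<open>v\<close>, which is zero; maximality
        of \<open>d0\<close> then forces equal domains.\<close>
      have "dom d0 \<subseteq> dom d"
      proof
        fix k assume k: "k \<in> dom d0"
        show "k \<in> dom d"
        proof (rule ccontr)
          assume "k \<notin> dom d"
          then have "k \<in> {1..r} - dom d" using k PPermD(1)[OF d0P] by auto
          then have "(\<Prod>k\<in>{1..r} - dom d. \<Sum>a\<in>{1..n}. \<xi> k a) = 0"
            using xi0[OF k] by (intro prod_zero) auto
          then show False using nz by (simp add: \<Phi>_def)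
        qed
      qed
      then have dom: "dom d0 = dom d"
        using max[OF d] PPermD(4)[OF dP] by (intro card_seteq) auto
      have nzl: "(\<Sum>a\<in>{1..n}. (if l \<in> ran d then \<xi> (pinv d l) a else q ^ (a - 1)) * u l a) \<noteq> 0"
        if l: "l \<in> {1..r}" for l
      proof
        assume "(\<Sum>a\<in>{1..n}. (if l \<in> ran d then \<xi> (pinv d l) a else q ^ (a - 1)) * u l a) = 0"
        then have "(\<Prod>l\<in>{1..r}. \<Sum>a\<in>{1..n}. (if l \<in> ran d then \<xi> (pinv d l) a else q ^ (a - 1)) * u l a) = 0"
          using l by (intro prod_zero) auto
        then show False using nz by (simp add: \<Phi>_def)
      qed
      have sub: "ran d0 \<subseteq> ran d"
      proof
        fix l assume l: "l \<in> ran d0"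
        then have "l \<in> {1..r}" using PPermD(2)[OF d0P] by auto
        show "l \<in> ran d"
        proof (rule ccontr)
          assume "l \<notin> ran d"
          with nzl[OF \<open>l \<in> {1..r}\<close>] show False by (simp only: if_False u0[OF l] simp_thms)
        qed
      qed
      have "d0 k = d k" for k
      proof (cases "k \<in> dom d0")
        case True
        then obtain l where l: "d0 k = Some l" by auto
        then have l0: "l \<in> ran d0" and lr: "l \<in> {1..r}" using PPermD(2)[OF d0P] by (auto intro: ranI)
        define k' where "k' = pinv d l"
        have k': "d k' = Some l" unfolding k'_def using pinv(2)[OF dP] sub l0 by auto
        then have k'd: "k' \<in> dom d0" using dom by auto
        then obtain l' where l': "d0 k' = Some l'" by auto
        then have "l' \<in> {1..r}" using PPermD(2)[OF d0P] by (auto intro: ranI)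
        moreover have "(\<Sum>a\<in>{1..n}. \<eta> l' a * u l a) \<noteq> 0"
        proof -
          have ld: "l \<in> ran d" using sub l0 by auto
          have "\<xi> (pinv d l) = \<eta> l'" using k'd l' by (simp add: \<xi>_def k'_def)
          then show ?thesis using nzl[OF lr] by (simp add: ld)
        qed
        ultimately have "l' = l" using dual[OF _ l0] by (metis (full_types))
        then have "k' = k" using PPerm_inj[OF d0P] l l' by blast
        then show ?thesis using k' l by simp
      next
        case False
        then show ?thesis using dom by (metis domIff)
      qed
      then show False using False by auto
    qed
    then show ?thesis using False by simp
  qed
  have "0 = (\<Sum>x\<in>Idx n r. \<Sum>y\<in>Idx n r.
      (\<Prod>k\<in>{1..r}. \<xi> k (x k)) * pact n r q c x y * (\<Prod>l\<in>{1..r}. u l (y l)))"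
    by (simp add: zero)
  also have "\<dots> = (\<Sum>x\<in>Idx n r. \<Sum>y\<in>Idx n r. \<Sum>d\<in>PPerm r. c d *
      ((\<Prod>k\<in>{1..r}. \<xi> k (x k)) * pp_mat n r q d x y * (\<Prod>l\<in>{1..r}. u l (y l))))"
    unfolding pact_def by (simp add: sum_distrib_left sum_distrib_right algebra_simps)
  also have "\<dots> = (\<Sum>x\<in>Idx n r. \<Sum>d\<in>PPerm r. \<Sum>y\<in>Idx n r. c d *
      ((\<Prod>k\<in>{1..r}. \<xi> k (x k)) * pp_mat n r q d x y * (\<Prod>l\<in>{1..r}. u l (y l))))"
    by (intro sum.cong refl sum.swap)
  also have "\<dots> = (\<Sum>d\<in>PPerm r. \<Sum>x\<in>Idx n r. \<Sum>y\<in>Idx n r. c d *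
      ((\<Prod>k\<in>{1..r}. \<xi> k (x k)) * pp_mat n r q d x y * (\<Prod>l\<in>{1..r}. u l (y l))))"
    by (rule sum.swap)
  also have "\<dots> = (\<Sum>d\<in>PPerm r. c d * \<Phi> d)"
    unfolding sum_distrib_left[symmetric] \<Phi>_def by (intro sum.cong refl) (simp only: pp_mat_functional)
  also have "\<dots> = (\<Sum>d\<in>PPerm r. if d = d0 then c d0 else 0)"
  proof (intro sum.cong refl)
    fix d
    show "c d * \<Phi> d = (if d = d0 then c d0 else 0)"
      using \<Phi>[of d] d0 by (cases "c d = 0") (auto simp: Su_def)
  qed
  also have "\<dots> = c d0" using d0P by simp
  finally show False using d0 by (simp add: Su_def)
qed

text \<open>The bordered matrix with rows \<open>x\<^sub>k\<close>, \<open>w\<close> and columns \<open>y\<^sub>l\<close>, \<open>v\<close> has size \<open>n + 1\<close> (the border has index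
  \<open>0\<close>) but rank at most \<open>n\<close>, since its corner is \<open>w v = [n]\<^sub>q\<close>. Expanding its determinant gives a
  combination of partial permutations acting by zero.\<close>

lemma pact_not_inj:
  assumes nr: "n \<le> r"
  shows "\<not> inj_on (pact n r q) (PAlg r)"
proof
  assume inj: "inj_on (pact n r q) (PAlg r)"
  define Q where "Q = {p. p permutes {0..n}}"
  \<comment> \<open>Deleting the border index leaves a partial permutation that misses at most one
    place and is the identity above \<open>n\<close>.\<close>
  define D where "D p = pmap {k \<in> {1..r}. p k \<noteq> 0} p" for p :: "nat \<Rightarrow> nat"
  \<comment> \<open>If \<open>p 0 = 0\<close>, then \<open>D p\<close> has no free place and the
    coefficient must supply the corner entry \<open>qint n q\<close>; otherwise the free place
    \<open>p 0\<close> of the range supplies the entry of row \<open>0\<close>.\<close>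
  define wt where "wt p = of_int (sign p) * (if p 0 = 0 then qint n q else 1)" for p :: "nat \<Rightarrow> nat"
  define c where "c d = (\<Sum>p\<in>{p \<in> Q. D p = d}. wt p)" for d
  have finQ: "finite Q" by (simp add: Q_def finite_permutations)
  have Qr: "p permutes {0..r}" if "p \<in> Q" for p
    using that nr by (auto simp: Q_def intro: permutes_subset)
  have ranD: "{1..r} - ran (D p) = {p 0} - {0}" if p: "p \<in> Q" for p
  proof -
    have img: "p ` {0..r} = {0..r}" by (rule permutes_image[OF Qr[OF p]])
    have ran: "ran (D p) = {0..r} - {p 0, 0}"
      unfolding D_def dom_ran_pmap
    proof (intro equalityI subsetI)
      fix m assume "m \<in> p ` {k \<in> {1..r}. p k \<noteq> 0}"
      then obtain k where k: "k \<in> {1..r}" "m = p k" "p k \<noteq> 0" by blast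
      have "p k \<noteq> p 0" using permutes_inj[OF Qr[OF p]] k(1) by (simp add: inj_eq)
      moreover have "p k \<in> {0..r}" using k(1) img by auto
      ultimately show "m \<in> {0..r} - {p 0, 0}" using k by simp
    next
      fix m assume m: "m \<in> {0..r} - {p 0, 0}"
      then obtain k where k: "k \<in> {0..r}" "m = p k" using img by blast
      then have "k \<noteq> 0" using m by (metis DiffD2 insertI1)
      with k have "k \<in> {1..r}" by auto
      then show "m \<in> p ` {k \<in> {1..r}. p k \<noteq> 0}" using k m by blast
    qed
    have "p 0 \<in> {0..r}" using img by auto
    then show ?thesis unfolding ran by auto
  qed
  have DP: "D p \<in> PPerm r" if p: "p \<in> Q" for p
  proof -
    have "p k \<in> {1..r}" if "k \<in> {1..r}" "p k \<noteq> 0" for k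
      using permutes_in_image[OF Qr[OF p], of k] that by auto
    then have "p ` {k \<in> {1..r}. p k \<noteq> 0} \<subseteq> {1..r}" by blast
    moreover have "inj_on (pmap {k \<in> {1..r}. p k \<noteq> 0} p) {k \<in> {1..r}. p k \<noteq> 0}"
    proof (rule inj_onI)
      fix k k' assume "k \<in> {k \<in> {1..r}. p k \<noteq> 0}" "k' \<in> {k \<in> {1..r}. p k \<noteq> 0}"
        "pmap {k \<in> {1..r}. p k \<noteq> 0} p k = pmap {k \<in> {1..r}. p k \<noteq> 0} p k'"
      then have "p k = p k'" by (simp add: pmap_def)
      then show "k = k'" using permutes_inj[OF Qr[OF p]] by (simp add: inj_eq)
    qed
    moreover have "{k \<in> {1..r}. p k \<noteq> 0} \<subseteq> {1..r}" by blast
    ultimately show ?thesis unfolding PPerm_def D_def by (simp only: mem_Collect_eq dom_ran_pmap simp_thms)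
  qed
  have cP: "c \<in> PAlg r"
  proof -
    have e: "{p \<in> Q. D p = d} = {}" if "d \<notin> PPerm r" for d using DP that by blast
    have "c d = 0" if "d \<notin> PPerm r" for d unfolding c_def e[OF that] by simp
    then show ?thesis unfolding PAlg_def by blast
  qed
  have "pact n r q c x y = 0" if xy: "x \<in> Idx n r" "y \<in> Idx n r" for x y
  proof -
    \<comment> \<open>\<open>N\<close> factors through the \<open>n\<close>-dimensional space:
      \<open>R 0\<close> is \<open>w\<close>, \<open>S 0\<close> is \<open>v\<close>, and the others
      are the coordinate covectors and basis vectors selected by \<open>x\<close> and
      \<open>y\<close>.\<close>
    define R where "R k a = (if k = 0 then q ^ (a - 1) else if a = x k then 1 else 0)" for k a
    define S where "S l a = (if l = 0 then 1 else if a = y l then 1 else (0::complex))" for l a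
    define N where "N k l = (\<Sum>a\<in>{1..n}. R k a * S l a)" for k l
    \<comment> \<open>Places above \<open>n\<close> are fixed by every \<open>p\<close>, so they
      contribute one common factor.\<close>
    define E where "E = (\<Prod>k\<in>{n+1..r}. if x k = y k then 1 else (0::complex))"
    have xr: "x k \<in> {1..n}" and yr: "y k \<in> {1..n}" if "k \<in> {1..r}" for k
      using that xy Idx_range by blast+
    have N00: "N 0 0 = qint n q" by (simp add: N_def R_def S_def qint_eq)
    have N0: "N 0 l = q ^ (y l - 1)" if "l \<in> {1..r}" for l
    proof -
      have "N 0 l = (\<Sum>a\<in>{1..n}. if a = y l then q ^ (y l - 1) else 0)"
        unfolding N_def R_def S_def using that by (intro sum.cong) auto
      then show ?thesis using yr[OF that] by (simp del: atLeastAtMost_iff)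
    qed
    have Nk: "N k l = (if l = 0 then 1 else if x k = y l then 1 else 0)" if "k \<in> {1..r}" for k l
    proof -
      have "N k l = (\<Sum>a\<in>{1..n}. if a = x k then S l (x k) else 0)"
        unfolding N_def R_def using that by (intro sum.cong) auto
      then show ?thesis using xr[OF that] by (simp add: S_def del: atLeastAtMost_iff)
    qed
    have expand: "wt p * pp_mat n r q (D p) x y = E * (of_int (sign p) * (\<Prod>k\<in>{0..n}. N k (p k)))"
      if p: "p \<in> Q" for p
    proof -
      have fix_p: "p k = k" if "k \<notin> {0..n}" for k
        using p that by (auto simp: Q_def permutes_not_in)
      have dom: "k \<in> dom (D p) \<longleftrightarrow> p k \<noteq> 0" if "k \<in> {1..r}" for k
        using that by (simp add: D_def)
      have "(\<Prod>k\<in>{1..r}. if k \<in> dom (D p) then (if x k = y (the (D p k)) then 1 else 0) else 1)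
         = (\<Prod>k\<in>{1..r}. N k (p k))"
      proof (intro prod.cong refl)
        fix k assume k: "k \<in> {1..r}"
        have "p k \<noteq> 0 \<Longrightarrow> the (D p k) = p k" using k by (simp add: D_def pmap_def)
        then show "(if k \<in> dom (D p) then (if x k = y (the (D p k)) then 1 else 0) else 1) = N k (p k)"
          unfolding Nk[OF k] dom[OF k] by simp
      qed
      also have "\<dots> = (\<Prod>k\<in>{1..n}. N k (p k)) * (\<Prod>k\<in>{n+1..r}. N k (p k))"
      proof -
        have "{1..r} = {1..n} \<union> {n+1..r}" using nr by auto
        then show ?thesis using prod.union_disjoint[of "{1..n}" "{n+1..r}"] by simp
      qed
      also have "(\<Prod>k\<in>{n+1..r}. N k (p k)) = E"
        unfolding E_def by (intro prod.cong refl) (auto simp: fix_p Nk)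
      finally have 1: "(\<Prod>k\<in>{1..r}. if k \<in> dom (D p) then (if x k = y (the (D p k)) then 1 else 0) else 1)
         = (\<Prod>k\<in>{1..n}. N k (p k)) * E" .
      have p0: "p 0 \<in> {0..r}" using permutes_in_image[OF Qr[OF p], of 0] by auto
      have 2: "(if p 0 = 0 then qint n q else 1) * (\<Prod>l\<in>{1..r} - ran (D p). q ^ (y l - 1)) = N 0 (p 0)"
        unfolding ranD[OF p] using p0 N0[of "p 0"] by (simp add: N00)
      have "{0..n} = insert 0 {1..n}" by auto
      then have 3: "(\<Prod>k\<in>{0..n}. N k (p k)) = N 0 (p 0) * (\<Prod>k\<in>{1..n}. N k (p k))" by simp
      show ?thesis
        unfolding pp_mat_eq_domain[OF DP[OF p] xy] 1 3 2[symmetric] wt_def by simp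
    qed
    have "pact n r q c x y = (\<Sum>d\<in>PPerm r. \<Sum>p\<in>{p \<in> Q. D p = d}. wt p * pp_mat n r q (D p) x y)"
      unfolding pact_def c_def sum_distrib_right by (intro sum.cong refl) auto
    also have "\<dots> = (\<Sum>p\<in>Q. wt p * pp_mat n r q (D p) x y)"
      using DP by (intro sum.group finQ) auto
    also have "\<dots> = E * (\<Sum>p\<in>Q. of_int (sign p) * (\<Prod>k\<in>{0..n}. N k (p k)))"
      unfolding sum_distrib_left by (rule sum.cong[OF refl expand])
    also have "(\<Sum>p\<in>Q. of_int (sign p) * (\<Prod>k\<in>{0..n}. N k (p k))) = 0"
      unfolding Q_def N_def by (rule alternating_sum_low_rank) auto
    finally show ?thesis by simp
  qed
  moreover have "pact n r q c \<in> Mats n r" "pact n r q (\<lambda>_. 0) \<in> Mats n r"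
    by (auto simp: pact_eq intro!: Mats_msum)
  ultimately have "pact n r q c = pact n r q (\<lambda>_. 0)"
    by (intro Mats_eqI[of _ n r]) (auto simp: pact_def)
  moreover have "(\<lambda>_. 0) \<in> PAlg r" by (simp add: PAlg_def)
  ultimately have "c = (\<lambda>_. 0)" using inj cP by (meson inj_onD)
  \<comment> \<open>Only \<open>p = id\<close> yields the identity diagram, so this coefficient is a
    single nonzero term and the relation is nontrivial.\<close>
  moreover have "c (pmap {1..r} id) = qint n q"
  proof -
    have "{p \<in> Q. D p = pmap {1..r} id} = {id}"
    proof (intro equalityI subsetI)
      fix p assume p: "p \<in> {p \<in> Q. D p = pmap {1..r} id}"
      have pk: "p k = k" if "k \<in> {1..r}" for k
      proof -
        have "D p k = Some k" using p that by (simp add: pmap_def)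
        then show ?thesis by (auto simp: D_def pmap_def split: if_splits)
      qed
      have pos: "p k = k" if "k \<noteq> 0" for k
      proof (cases "k \<in> {1..r}")
        case False
        then have "k \<notin> {0..r}" using that by auto
        then show ?thesis using p permutes_not_in[OF Qr, of p k] by blast
      qed (rule pk)
      have zero: "p 0 = 0"
      proof (rule ccontr)
        assume "p 0 \<noteq> 0"
        then have "p (p 0) = p 0" by (rule pos)
        moreover have "inj p" using p Qr permutes_inj by blast
        ultimately show False using \<open>p 0 \<noteq> 0\<close> by (simp add: inj_eq)
      qed
      have "p k = k" for k by (cases "k = 0") (use pos zero in auto)
      then show "p \<in> {id}" by auto
    next
      fix p assume p: "p \<in> {id :: nat \<Rightarrow> nat}"
      moreover have "{k \<in> {1..r}. id k \<noteq> 0} = {1..r}" by auto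
      ultimately show "p \<in> {p \<in> Q. D p = pmap {1..r} id}"
        by (auto simp: Q_def D_def permutes_id)
    qed
    then show ?thesis by (simp add: c_def wt_def)
  qed
  ultimately show False by simp
qed

lemma pact_inj_iff: "inj_on (pact n r q) (PAlg r) \<longleftrightarrow> n > r"
proof
  assume nr: "n > r"
  show "inj_on (pact n r q) (PAlg r)"
  proof (intro inj_onI ext)
    fix c c' d assume c: "c \<in> PAlg r" "c' \<in> PAlg r" and eq: "pact n r q c = pact n r q c'"
    have "pact n r q (\<lambda>d. c d - c' d) x y = pact n r q c x y - pact n r q c' x y" for x y
      by (simp add: pact_def left_diff_distrib sum_subtractf)
    then have "c d - c' d = 0"
      using c eq by (intro pact_eq_0_imp[OF nr, of "\<lambda>d. c d - c' d"]) (auto simp: PAlg_def)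
    then show "c d = c' d" by simp
  qed
qed (metis pact_not_inj not_le)

end

theorem theorem9p3:
  fixes n r :: nat and q1 q2 :: complex
  assumes "n \<ge> 2" and "r \<ge> 1" and "q1 * q2 \<noteq> 0"
    and "\<forall>k::nat. k > 0 \<longrightarrow> (qpar q1 q2) ^ k \<noteq> 1"
  shows "imB n r q1 q2 = commutant n r (imP n r (qpar q1 q2))
       \<and> imP n r (qpar q1 q2) = commutant n r (imB n r q1 q2)
       \<and> (inj_on (pact n r (qpar q1 q2)) (PAlg r) \<longleftrightarrow> n > r)
       \<and> (n > r \<longrightarrow> (\<exists>f. bij_betw f (PAlg r) (commutant n r (imB n r q1 q2))
             \<and> (\<forall>c\<in>PAlg r. \<forall>c'\<in>PAlg r. f (\<lambda>d. c d + c' d) = madd (f c) (f c'))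
             \<and> (\<forall>a. \<forall>c\<in>PAlg r. f (\<lambda>d. a * c d) = msmult a (f c))
             \<and> (\<forall>c\<in>PAlg r. \<forall>c'\<in>PAlg r.
                   f (pmul r (qint n (qpar q1 q2)) c c') = mmul n r (f c) (f c'))
             \<and> f (punit r) = mone n r))"
proof -
  interpret burau_rep n r q1 q2 "qpar q1 q2"
    using assms by unfold_locales auto
  let ?f = "pact n r (qpar q1 q2)"
  have "bij_betw ?f (PAlg r) (commutant n r (imB n r q1 q2))" if "n > r"
    using pact_inj_iff that by (simp add: bij_betw_def pact_image commutant_imB_eq)
  moreover have "?f (\<lambda>d. c d + c' d) = madd (?f c) (?f c')" for c c'
    by (simp add: pact_def madd_def sum.distrib distrib_right)
  moreover have "?f (\<lambda>d. a * c d) = msmult a (?f c)" for a c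
    by (simp add: pact_def msmult_def sum_distrib_left mult.assoc)
  ultimately show ?thesis
    using imB_eq commutant_imB_eq pact_inj_iff pact_mult pact_punit by blast
qed

end
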